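(* Let $\Omega=(0,1)\times(0,1)$. There exists a family of maps $\mathcal R_\varepsilon: L^2(\Omega)\times L^2(\Omega)\times L^1(0,1)\to L^2(\mathbb R^2)$, $0<\varepsilon<1$ (the maps do not depend on any exact solution or exact data), with the following property. Let $g_{0ex},g_{1ex}\in L^2(\Omega)$, let $\varphi_{ex}\in L^1(0,1)$ with $\varphi_{ex}\not\equiv0$, and let $u_{ex}\in C^1([0,1];L^2(\Omega))\cap L^2(0,1;H^2(\Omega))$, $f_{ex}\in L^2(\Omega)$ be such that $(u_{ex},f_{ex})$ solves the source problem with data $(\varphi_{ex},g_{0ex},g_{1ex})$ (defined in the context). For each $\varepsilon\in(0,1)$ let $g_{0\varepsilon},g_{1\varepsilon}\in L^2(\Omega)$ and $\varphi_\varepsilon\in L^1(0,1)$ satisfy $$\|g_{0\varepsilon}-g_{0ex}\|_{L^2(\Omega)}\le\varepsilon,\quad \|g_{1\varepsilon}-g_{1ex}\|_{L^2(\Omega)}\le\varepsilon,\quad \|\varphi_\varepsilon-\varphi_{ex}\|_{L^1(0,1)}\le\varepsilon,$$ and put $f_{1\varepsilon}=\mathcal R_\varepsilon(g_{0\varepsilon},g_{1\varepsilon},\varphi_\varepsilon)$. Then $$\lim_{\varepsilon\to0}\|f_{1\varepsilon}-f_{ex}\|_{L^2(\Omega)}=0.$$ Moreover, if $f_{ex}\in H^1(\Omega)$, then for each $\beta\in(0,1/2)$ there exists $\varepsilon_0\in(0,1)$, depending only on $u_{ex}$, $\varphi_{ex}$ and $\beta$, such that for all $0<\varepsilon<\varepsilon_0$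 $$\|f_{1\varepsilon}-f_{ex}\|_{L^2(\Omega)}^2\le 4\pi^{-1}\left(1+9\|f_{ex}\|_{H^1(\Omega)}^2\right)\left(\ln(\varepsilon^{-1})\right)^{-\beta}.$$
   Context: Functions are real-valued. A pair $(u,f)$ with $u\in C^1([0,1];L^2(\Omega))\cap L^2(0,1;H^2(\Omega))$ and $f\in L^2(\Omega)$ solves the source problem with data $(\varphi,g_0,g_1)$ if $$u_t-\Delta u=\varphi(t)f(x,y)\quad\text{for } t\in(0,1),\ (x,y)\in\Omega,$$ $$u_x(0,y,t)=u_x(1,y,t)=u_y(x,0,t)=u_y(x,1,t)=0,\qquad u(1,y,t)=0$$ for $x,y,t\in(0,1)$, and $$u(x,y,0)=g_0(x,y),\qquad u(x,y,1)=g_1(x,y)\quad\text{in }\Omega.$$ Here the equation is understood in $L^2(\Omega)$ for a.e. $t$, and the boundary values in the sense of traces for a.e. $t$. The norm on $H^1(\Omega)$ is $\|w\|_{H^1(\Omega)}^2=\|w\|_{L^2(\Omega)}^2+\|\partial_xw\|_{L^2(\Omega)}^2+\|\partial_yw\|_{L^2(\Omega)}^2$. *)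

theory Defs
  imports "HOL-Analysis.Analysis"
begin

text \<open>
  Elements of Lebesgue and Sobolev spaces are represented by functions, and all notions below are
  invariant under changing these functions on null sets. The representatives are
  Lebesgue measurable (measurable with respect to the completed measure).
\<close>

definition L1 :: "'a measure \<Rightarrow> ('a \<Rightarrow> real) set" where
  "L1 M = {f. integrable M f}"

definition L1_norm :: "'a measure \<Rightarrow> ('a \<Rightarrow> real) \<Rightarrow> real" where
  "L1_norm M f = (LINT x|M. \<bar>f x\<bar>)"

definition L2 :: "'a measure \<Rightarrow> ('a \<Rightarrow> real) set" where
  "L2 M = {f \<in> borel_measurable M. integrable M (\<lambda>x. (f x)\<^sup>2)}"

definition L2_norm :: "'a measure \<Rightarrow> ('a \<Rightarrow> real) \<Rightarrow> real" where
  "L2_norm M f = sqrt (LINT x|M. (f x)\<^sup>2)"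

abbreviation unit_time :: "real measure" where
  "unit_time \<equiv> lebesgue_on {0<..<1}"

definition Omega :: "(real \<times> real) set" where
  "Omega = {0<..<1} \<times> {0<..<1}"

abbreviation L2\<Omega> :: "(real \<times> real \<Rightarrow> real) set" where
  "L2\<Omega> \<equiv> L2 (lebesgue_on Omega)"

abbreviation norm_L2\<Omega> :: "(real \<times> real \<Rightarrow> real) \<Rightarrow> real" where
  "norm_L2\<Omega> \<equiv> L2_norm (lebesgue_on Omega)"


section \<open>Sobolev spaces on the unit square\<close>

abbreviation ex :: "real \<times> real" where "ex \<equiv> (1, 0)"
abbreviation ey :: "real \<times> real" where "ey \<equiv> (0, 1)"

definition pderiv_along :: "real \<times> real \<Rightarrow> (real \<times> real \<Rightarrow> real) \<Rightarrow> real \<times> real \<Rightarrow> real" where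
  "pderiv_along v f p = frechet_derivative f (at p) v"

primrec Ck :: "nat \<Rightarrow> (real \<times> real \<Rightarrow> real) \<Rightarrow> bool" where
  "Ck 0 f \<longleftrightarrow> continuous_on UNIV f"
| "Ck (Suc k) f \<longleftrightarrow>
     (\<forall>p. f differentiable (at p)) \<and> Ck k (pderiv_along ex f) \<and> Ck k (pderiv_along ey f)"

definition smooth :: "(real \<times> real \<Rightarrow> real) \<Rightarrow> bool" where
  "smooth f \<longleftrightarrow> (\<forall>k. Ck k f)"

definition test_function :: "(real \<times> real \<Rightarrow> real) \<Rightarrow> bool" where
  "test_function \<psi> \<longleftrightarrow>
     smooth \<psi> \<and> compact (closure {p. \<psi> p \<noteq> 0}) \<and> closure {p. \<psi> p \<noteq> 0} \<subseteq> Omega"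

definition has_weak_deriv ::
  "real \<times> real \<Rightarrow> (real \<times> real \<Rightarrow> real) \<Rightarrow> (real \<times> real \<Rightarrow> real) \<Rightarrow> bool" where
  "has_weak_deriv v f g \<longleftrightarrow>
     (\<forall>\<psi>. test_function \<psi> \<longrightarrow>
        (LINT p|lebesgue_on Omega. f p * pderiv_along v \<psi> p) =
        - (LINT p|lebesgue_on Omega. g p * \<psi> p))"

text \<open>The weak derivative in $L^2$ is unique up to a null set; one representative is selected.\<close>

definition weak_deriv :: "real \<times> real \<Rightarrow> (real \<times> real \<Rightarrow> real) \<Rightarrow> real \<times> real \<Rightarrow> real" where
  "weak_deriv v f = (SOME g. g \<in> L2\<Omega> \<and> has_weak_deriv v f g)"

definition H1 :: "(real \<times> real \<Rightarrow> real) set" where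
  "H1 = {f \<in> L2\<Omega>. \<forall>v \<in> {ex, ey}. \<exists>g \<in> L2\<Omega>. has_weak_deriv v f g}"

definition H1_norm :: "(real \<times> real \<Rightarrow> real) \<Rightarrow> real" where
  "H1_norm f =
     sqrt ((norm_L2\<Omega> f)\<^sup>2 + (norm_L2\<Omega> (weak_deriv ex f))\<^sup>2 + (norm_L2\<Omega> (weak_deriv ey f))\<^sup>2)"

definition H2 :: "(real \<times> real \<Rightarrow> real) set" where
  "H2 = {f \<in> H1. weak_deriv ex f \<in> H1 \<and> weak_deriv ey f \<in> H1}"

definition H2_norm :: "(real \<times> real \<Rightarrow> real) \<Rightarrow> real" where
  "H2_norm f =
     sqrt ((H1_norm f)\<^sup>2 + (norm_L2\<Omega> (weak_deriv ex (weak_deriv ex f)))\<^sup>2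
       + (norm_L2\<Omega> (weak_deriv ex (weak_deriv ey f)))\<^sup>2
       + (norm_L2\<Omega> (weak_deriv ey (weak_deriv ey f)))\<^sup>2)"

definition laplacian :: "(real \<times> real \<Rightarrow> real) \<Rightarrow> real \<times> real \<Rightarrow> real" where
  "laplacian f p = weak_deriv ex (weak_deriv ex f) p + weak_deriv ey (weak_deriv ey f) p"

text \<open>
  The trace on a side of the square, parametrised by \<open>\<gamma>\<close> over $(0,1)$: the trace operator is the
  continuous extension to $H^1$ of the restriction of functions smooth up to the boundary, so its
  graph is the closure of the graph of that restriction.
\<close>

definition has_trace ::
  "(real \<Rightarrow> real \<times> real) \<Rightarrow> (real \<times> real \<Rightarrow> real) \<Rightarrow> (real \<Rightarrow> real) \<Rightarrow> bool" where
  "has_trace \<gamma> w h \<longleftrightarrow>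
     w \<in> H1 \<and> h \<in> L2 unit_time \<and>
     (\<exists>W :: nat \<Rightarrow> real \<times> real \<Rightarrow> real.
        (\<forall>n. smooth (W n)) \<and>
        (\<lambda>n. H1_norm (\<lambda>p. W n p - w p)) \<longlonglongrightarrow> 0 \<and>
        (\<lambda>n. L2_norm unit_time (\<lambda>s. W n (\<gamma> s) - h s)) \<longlonglongrightarrow> 0)"

definition zero_trace :: "(real \<Rightarrow> real \<times> real) \<Rightarrow> (real \<times> real \<Rightarrow> real) \<Rightarrow> bool" where
  "zero_trace \<gamma> w \<longleftrightarrow> has_trace \<gamma> w (\<lambda>s. 0)"


section \<open>Spaces of functions of time\<close>

text \<open>\<open>u\<close> belongs to $C^1([0,1];L^2(\Omega))$ and has the time derivative \<open>u'\<close>.\<close>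

definition C1_L2_with_deriv ::
  "(real \<Rightarrow> real \<times> real \<Rightarrow> real) \<Rightarrow> (real \<Rightarrow> real \<times> real \<Rightarrow> real) \<Rightarrow> bool" where
  "C1_L2_with_deriv u u' \<longleftrightarrow>
     (\<forall>t \<in> {0..1}. u t \<in> L2\<Omega> \<and> u' t \<in> L2\<Omega> \<and>
        ((\<lambda>s. norm_L2\<Omega> (\<lambda>p. (u s p - u t p) / (s - t) - u' t p)) \<longlongrightarrow> 0) (at t within {0..1}) \<and>
        ((\<lambda>s. norm_L2\<Omega> (\<lambda>p. u' s p - u' t p)) \<longlongrightarrow> 0) (at t within {0..1}))"

text \<open>
  The Bochner space $L^2(0,1;H^2(\Omega))$; strong measurability is approximation almost everywhere
  by simple functions.
\<close>

definition L2_H2 :: "(real \<Rightarrow> real \<times> real \<Rightarrow> real) set" where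
  "L2_H2 = {u.
     (AE t in unit_time. u t \<in> H2) \<and>
     (\<exists>s :: nat \<Rightarrow> real \<Rightarrow> real \<times> real \<Rightarrow> real.
        (\<forall>n. simple_function unit_time (s n) \<and> (\<forall>t \<in> {0<..<1}. s n t \<in> H2)) \<and>
        (AE t in unit_time. (\<lambda>n. H2_norm (\<lambda>p. s n t p - u t p)) \<longlonglongrightarrow> 0)) \<and>
     integrable unit_time (\<lambda>t. (H2_norm (u t))\<^sup>2)}"


section \<open>The source problem\<close>

definition solves_source_problem ::
  "(real \<Rightarrow> real) \<Rightarrow> (real \<times> real \<Rightarrow> real) \<Rightarrow> (real \<times> real \<Rightarrow> real) \<Rightarrow>
   (real \<Rightarrow> real \<times> real \<Rightarrow> real) \<Rightarrow> (real \<times> real \<Rightarrow> real) \<Rightarrow> bool" where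
  "solves_source_problem \<phi> g0 g1 u f \<longleftrightarrow>
     f \<in> L2\<Omega> \<and> u \<in> L2_H2 \<and>
     (\<exists>u'. C1_L2_with_deriv u u' \<and>
        (AE t in unit_time. AE p in lebesgue_on Omega.
           u' t p - laplacian (u t) p = \<phi> t * f p)) \<and>
     (AE t in unit_time.
        zero_trace (\<lambda>y. (0, y)) (weak_deriv ex (u t)) \<and>
        zero_trace (\<lambda>y. (1, y)) (weak_deriv ex (u t)) \<and>
        zero_trace (\<lambda>x. (x, 0)) (weak_deriv ey (u t)) \<and>
        zero_trace (\<lambda>x. (x, 1)) (weak_deriv ey (u t)) \<and>
        zero_trace (\<lambda>y. (1, y)) (u t)) \<and>
     (AE p in lebesgue_on Omega. u 0 p = g0 p) \<and>
     (AE p in lebesgue_on Omega. u 1 p = g1 p)"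

text \<open>
  A map $L^2(\Omega)\times L^2(\Omega)\times L^1(0,1)\to L^2(\mathbb R^2)$: on representatives, it has to
  respect equality almost everywhere.
\<close>

definition source_map ::
  "((real \<times> real \<Rightarrow> real) \<Rightarrow> (real \<times> real \<Rightarrow> real) \<Rightarrow> (real \<Rightarrow> real) \<Rightarrow> real \<times> real \<Rightarrow> real) \<Rightarrow> bool"
  where
  "source_map R \<longleftrightarrow>
     (\<forall>g0 \<in> L2\<Omega>. \<forall>g1 \<in> L2\<Omega>. \<forall>\<phi> \<in> L1 unit_time. R g0 g1 \<phi> \<in> L2 lebesgue) \<and>
     (\<forall>g0 \<in> L2\<Omega>. \<forall>g1 \<in> L2\<Omega>. \<forall>\<phi> \<in> L1 unit_time.
      \<forall>h0 \<in> L2\<Omega>. \<forall>h1 \<in> L2\<Omega>. \<forall>\<psi> \<in> L1 unit_time.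
        (AE p in lebesgue_on Omega. g0 p = h0 p) \<longrightarrow>
        (AE p in lebesgue_on Omega. g1 p = h1 p) \<longrightarrow>
        (AE t in unit_time. \<phi> t = \<psi> t) \<longrightarrow>
        (AE p in lebesgue. R g0 g1 \<phi> p = R h0 h1 \<psi> p))"

definition noisy_data ::
  "real \<Rightarrow> (real \<times> real \<Rightarrow> real) \<Rightarrow> (real \<times> real \<Rightarrow> real) \<Rightarrow> (real \<Rightarrow> real) \<Rightarrow>
   (real \<times> real \<Rightarrow> real) \<Rightarrow> (real \<times> real \<Rightarrow> real) \<Rightarrow> (real \<Rightarrow> real) \<Rightarrow> bool" where
  "noisy_data \<epsilon> g0ex g1ex \<phi>ex g0 g1 \<phi> \<longleftrightarrow>
     g0 \<in> L2\<Omega> \<and> g1 \<in> L2\<Omega> \<and> \<phi> \<in> L1 unit_time \<and>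
     norm_L2\<Omega> (\<lambda>p. g0 p - g0ex p) \<le> \<epsilon> \<and>
     norm_L2\<Omega> (\<lambda>p. g1 p - g1ex p) \<le> \<epsilon> \<and>
     L1_norm unit_time (\<lambda>t. \<phi> t - \<phi>ex t) \<le> \<epsilon>"

end

theory Submission
  imports Defs "HOL-Real_Asymp.Real_Asymp"
begin

text \<open>
  Write $v(x,y)=\cosh(\sqrt{z}\,x)\cos(n\pi y)$ with $z=\lambda+n^2\pi^2$. Since \<open>u\<close> and $u_x$ vanish at
  $x=1$ and $v_x$ vanishes at $x=0$, testing the equation with \<open>v\<close> gives
  $D(\lambda)\int fv=e^{-\lambda}\int g_1v-\int g_0v$ with $D(\lambda)=\int_0^1 e^{-\lambda t}\varphi(t)\,dt$.
  If the \<open>p\<close>-th moment of $\varphi$ is the first one that does not vanish, then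
  $|D(\lambda)|\ge c\lambda^p$ for small $\lambda>0$, so
  $\int fv$ can be recovered for all small positive $\lambda$. The cosine coefficient of \<open>f\<close> with
  indices $(k,n)$ is the value at $z=-k^2\pi^2$ of the same entire function of \<open>z\<close>, of order $1/2$; it is
  obtained by Lagrange extrapolation from $N^2$ nodes $\lambda=i/N^3$. For $k,n<N$ the extrapolation
  error decays like $e^{-cN^2}$ and the noise is amplified by $e^{O(N^2\ln N)}$ only, which leaves room for
  $N\approx(\ln\varepsilon^{-1})^{1/4}$. Truncating the cosine series at \<open>N\<close> costs $O(1/N)$ if \<open>f\<close> is
  in $H^1$. As \<open>f\<close> is determined by \<open>u\<close> and $\varphi$, constants depending on \<open>f\<close> are harmless.
\<close>

section \<open>Square integrable functions\<close>

text \<open>The product of cos(k pi x) and cos(n pi y) is itself an admissible test function, with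
  \<lambda> = -(k^2 + n^2) pi^2, but D may vanish there. Only the behaviour of D to the right of 0
  is under control, hence the detour through small positive \<lambda> and extrapolation. It succeeds
  because order 1/2 gives the m-th derivative of the entire function a factor 1/m! on top of the
  1/m! of divided differences. With m = N^2, one factorial absorbs the powers of N^2 coming from the
  distances between nodes, and the other beats every exp(C N^2).

  The numbers c and p depend on the unknown \<phi>. The reconstruction never uses them: they enter
  the error only through the factor N^(3p)/c, which the noise level exp(-N^4) swallows. With N about
  (ln(1/\<epsilon>))^(1/4), a squared error of order N^(-2) is of order (ln(1/\<epsilon>))^(-1/2).
  The gap between \<beta> and 1/2 absorbs all constants, so the factor in the claimed estimate is
  reached merely because it is at least 1.\<close>

lemma L2_D: "f \<in> L2 M \<Longrightarrow> f \<in> borel_measurable M" "f \<in> L2 M \<Longrightarrow> integrable M (\<lambda>x. (f x)\<^sup>2)"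
  by (auto simp: L2_def)

lemma L2_integrable_mult:
  assumes f: "f \<in> L2 M" and g: "g \<in> L2 M"
  shows "integrable M (\<lambda>x. f x * g x)"
proof (rule Bochner_Integration.integrable_bound)
  show "integrable M (\<lambda>x. (f x)\<^sup>2 + (g x)\<^sup>2)"
    using L2_D(2)[OF f] L2_D(2)[OF g] by simp
  show "(\<lambda>x. f x * g x) \<in> borel_measurable M"
    using L2_D(1)[OF f] L2_D(1)[OF g] by simp
  show "AE x in M. norm (f x * g x) \<le> norm ((f x)\<^sup>2 + (g x)\<^sup>2)"
  proof (rule AE_I2)
    fix x
    have "2 * \<bar>f x * g x\<bar> \<le> (f x)\<^sup>2 + (g x)\<^sup>2"
      using sum_squares_bound[of "\<bar>f x\<bar>" "\<bar>g x\<bar>"] by (simp add: abs_mult)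
    then show "norm (f x * g x) \<le> norm ((f x)\<^sup>2 + (g x)\<^sup>2)" by simp
  qed
qed

lemma L2_cmult: "f \<in> L2 M \<Longrightarrow> (\<lambda>x. c * f x) \<in> L2 M"
  by (auto simp: L2_def power_mult_distrib)

lemma L2_add: 
  assumes f: "f \<in> L2 M" and g: "g \<in> L2 M"
  shows "(\<lambda>x. f x + g x) \<in> L2 M"
proof -
  have "integrable M (\<lambda>x. (f x)\<^sup>2 + 2 * (f x * g x) + (g x)\<^sup>2)"
    using L2_D(2)[OF f] L2_D(2)[OF g] L2_integrable_mult[OF f g] by simp
  moreover have "(\<lambda>x. (f x)\<^sup>2 + 2 * (f x * g x) + (g x)\<^sup>2) = (\<lambda>x. (f x + g x)\<^sup>2)"
    by (auto simp: power2_eq_square algebra_simps)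
  ultimately show ?thesis
    using L2_D(1)[OF f] L2_D(1)[OF g] by (simp add: L2_def)
qed

lemma L2_diff: "f \<in> L2 M \<Longrightarrow> g \<in> L2 M \<Longrightarrow> (\<lambda>x. f x - g x) \<in> L2 M"
  using L2_add[of f M "\<lambda>x. (-1) * g x"] L2_cmult[of g M "-1"] by simp

lemma L2_zero: "(\<lambda>x. 0) \<in> L2 M"
  by (simp add: L2_def)

lemma L2_sum: "(\<And>i. i \<in> I \<Longrightarrow> f i \<in> L2 M) \<Longrightarrow> (\<lambda>x. \<Sum>i\<in>I. f i x) \<in> L2 M"
  by (induction I rule: infinite_finite_induct) (auto intro: L2_zero L2_add)

lemma L2_cong_AE:
  assumes "f \<in> L2 M" "g \<in> borel_measurable M" "AE x in M. f x = g x"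
  shows "g \<in> L2 M"
proof -
  have "integrable M (\<lambda>x. (g x)\<^sup>2) \<longleftrightarrow> integrable M (\<lambda>x. (f x)\<^sup>2)"
    using assms by (intro integrable_cong_AE) (auto simp: L2_def)
  with assms show ?thesis by (simp add: L2_def)
qed

lemma L2_norm_nonneg [simp]: "0 \<le> L2_norm M f"
  by (simp add: L2_norm_def)

lemma L2_norm_power2: "(L2_norm M f)\<^sup>2 = (LINT x|M. (f x)\<^sup>2)"
  by (simp add: L2_norm_def)

lemma L2_norm_cong_AE:
  assumes "f \<in> borel_measurable M" "g \<in> borel_measurable M" "AE x in M. f x = g x"
  shows "L2_norm M f = L2_norm M g"
proof -
  have "(LINT x|M. (f x)\<^sup>2) = (LINT x|M. (g x)\<^sup>2)"
    using assms by (intro integral_cong_AE) auto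
  then show ?thesis by (simp add: L2_norm_def)
qed

lemma L2_norm_minus_commute: "L2_norm M (\<lambda>x. f x - g x) = L2_norm M (\<lambda>x. g x - f x)"
  by (simp add: L2_norm_def power2_commute)

lemma L2_Cauchy_Schwarz:
  assumes f: "f \<in> L2 M" and g: "g \<in> L2 M"
  shows "\<bar>LINT x|M. f x * g x\<bar> \<le> L2_norm M f * L2_norm M g"
proof -
  define a b c where "a = (LINT x|M. (f x)\<^sup>2)" and "b = (LINT x|M. f x * g x)"
    and "c = (LINT x|M. (g x)\<^sup>2)"
  have *: "0 \<le> s\<^sup>2 * a + 2 * s * t * b + t\<^sup>2 * c" for s t
  proof -
    have "s\<^sup>2 * a + 2 * s * t * b + t\<^sup>2 * c
        = (LINT x|M. s\<^sup>2 * (f x)\<^sup>2 + 2 * s * t * (f x * g x) + t\<^sup>2 * (g x)\<^sup>2)"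
      unfolding a_def b_def c_def
      using L2_D(2)[OF f] L2_D(2)[OF g] L2_integrable_mult[OF f g] by simp
    also have "\<dots> = (LINT x|M. (s * f x + t * g x)\<^sup>2)"
      by (intro Bochner_Integration.integral_cong) (auto simp: power2_eq_square algebra_simps)
    also have "\<dots> \<ge> 0" by simp
    finally show ?thesis .
  qed
  have ac: "0 \<le> a" "0 \<le> c" by (auto simp: a_def c_def)
  have "b\<^sup>2 \<le> a * c"
  proof (cases "c = 0")
    case True
    have "b = 0"
    proof (rule ccontr)
      \<comment> \<open>With \<open>c = 0\<close> the form at \<open>s = 1\<close> is
        \<open>a + 2 * t * b\<close>, which the \<open>t\<close> chosen below turns into -1.\<close>
      assume "b \<noteq> 0"
      then show False
        using *[of 1 "-(a + 1) / (2 * b)"] True by (simp add: field_simps)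
    qed
    then show ?thesis using True by simp
  next
    case False
    with ac have "c > 0" by simp
    \<comment> \<open>Up to scaling, \<open>s = c\<close> and \<open>t = - b\<close> is the
      minimiser of the quadratic form.\<close>
    have "0 \<le> c\<^sup>2 * a + 2 * c * (-b) * b + (-b)\<^sup>2 * c" by (rule *)
    also have "\<dots> = c * (a * c - b\<^sup>2)" by (simp add: power2_eq_square algebra_simps)
    finally show ?thesis using \<open>c > 0\<close> by (simp add: zero_le_mult_iff)
  qed
  then have "\<bar>b\<bar> \<le> sqrt (a * c)" by (simp add: real_le_rsqrt)
  then show ?thesis by (simp add: a_def b_def c_def L2_norm_def real_sqrt_mult)
qed

lemma L2_norm_triangle:
  assumes f: "f \<in> L2 M" and g: "g \<in> L2 M"
  shows "L2_norm M (\<lambda>x. f x + g x) \<le> L2_norm M f + L2_norm M g"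
proof (rule power2_le_imp_le)
  have "(L2_norm M (\<lambda>x. f x + g x))\<^sup>2 = (LINT x|M. (f x)\<^sup>2 + 2 * (f x * g x) + (g x)\<^sup>2)"
    unfolding L2_norm_power2 by (simp add: power2_eq_square algebra_simps)
  also have "\<dots> = (L2_norm M f)\<^sup>2 + 2 * (LINT x|M. f x * g x) + (L2_norm M g)\<^sup>2"
    unfolding L2_norm_power2
    using L2_D(2)[OF f] L2_D(2)[OF g] L2_integrable_mult[OF f g] by simp
  also have "\<dots> \<le> (L2_norm M f)\<^sup>2 + 2 * (L2_norm M f * L2_norm M g) + (L2_norm M g)\<^sup>2"
    using L2_Cauchy_Schwarz[OF f g] by linarith
  finally show "(L2_norm M (\<lambda>x. f x + g x))\<^sup>2 \<le> (L2_norm M f + L2_norm M g)\<^sup>2"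
    by (simp add: power2_sum)
qed simp

lemma L2_norm_triangle_diff:
  assumes "f \<in> L2 M" "g \<in> L2 M" "h \<in> L2 M"
  shows "L2_norm M (\<lambda>x. f x - h x) \<le> L2_norm M (\<lambda>x. f x - g x) + L2_norm M (\<lambda>x. g x - h x)"
  using L2_norm_triangle[OF L2_diff[OF assms(1,2)] L2_diff[OF assms(2,3)]] by simp

lemma L2_norm_eq_0_D:
  assumes "f \<in> L2 M" "L2_norm M f = 0"
  shows "AE x in M. f x = 0"
proof -
  have "AE x in M. (f x)\<^sup>2 = 0"
    using assms integral_nonneg_eq_0_iff_AE[OF L2_D(2)[OF assms(1)]] by (simp add: L2_norm_def)
  then show ?thesis by simp
qed

lemma L2_inner_tendsto:
  assumes f: "\<And>n. f n \<in> L2 M" and F: "F \<in> L2 M" and v: "v \<in> L2 M"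
    and lim: "(\<lambda>n. L2_norm M (\<lambda>x. f n x - F x)) \<longlonglongrightarrow> 0"
  shows "(\<lambda>n. LINT x|M. f n x * v x) \<longlonglongrightarrow> (LINT x|M. F x * v x)"
proof (rule LIM_zero_cancel, rule Lim_null_comparison)
  show "\<forall>\<^sub>F n in sequentially. norm ((LINT x|M. f n x * v x) - (LINT x|M. F x * v x))
      \<le> L2_norm M (\<lambda>x. f n x - F x) * L2_norm M v"
  proof (rule always_eventually, rule allI)
    fix n
    have "(LINT x|M. f n x * v x) - (LINT x|M. F x * v x) = (LINT x|M. (f n x - F x) * v x)"
      using L2_integrable_mult[OF f v] L2_integrable_mult[OF F v] by (simp add: algebra_simps)
    then show "norm ((LINT x|M. f n x * v x) - (LINT x|M. F x * v x))
        \<le> L2_norm M (\<lambda>x. f n x - F x) * L2_norm M v"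
      using L2_Cauchy_Schwarz[OF L2_diff[OF f F] v] by simp
  qed
  show "(\<lambda>n. L2_norm M (\<lambda>x. f n x - F x) * L2_norm M v) \<longlonglongrightarrow> 0"
    using tendsto_mult_left_zero[OF lim] by simp
qed

text \<open>Squared norm 0 is allowed because the sine mode with index 0 vanishes. Keeping it in the
  family lets sine and cosine products share all pairs of natural numbers as indices.\<close>

definition orthosystem :: "'a measure \<Rightarrow> ('i \<Rightarrow> 'a \<Rightarrow> real) \<Rightarrow> bool" where
  "orthosystem M e \<longleftrightarrow> (\<forall>i. e i \<in> L2 M) \<and> (\<forall>i j. i \<noteq> j \<longrightarrow> (LINT x|M. e i x * e j x) = 0) \<and>
     (\<forall>i. (LINT x|M. e i x * e i x) \<in> {0, 1})"

lemma orthosystem_D: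
  assumes "orthosystem M e"
  shows "e i \<in> L2 M" "i \<noteq> j \<Longrightarrow> (LINT x|M. e i x * e j x) = 0" "(LINT x|M. e i x * e i x) \<le> 1"
  using assms unfolding orthosystem_def
  by (auto, metis insert_iff empty_iff zero_le_one order_refl)

lemma orthosystem_sum_inner:
  assumes "orthosystem M e" "finite I" "j \<in> I"
  shows "(LINT x|M. (\<Sum>i\<in>I. c i * e i x) * e j x) = c j * (LINT x|M. e j x * e j x)"
proof -
  have "(LINT x|M. (\<Sum>i\<in>I. c i * e i x) * e j x) = (LINT x|M. (\<Sum>i\<in>I. c i * (e i x * e j x)))"
    by (simp add: sum_distrib_right mult.assoc)
  also have "\<dots> = (\<Sum>i\<in>I. c i * (LINT x|M. e i x * e j x))"
    using L2_integrable_mult[OF orthosystem_D(1)[OF assms(1)] orthosystem_D(1)[OF assms(1)]] by simp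
  also have "\<dots> = (\<Sum>i\<in>I. if i = j then c j * (LINT x|M. e j x * e j x) else 0)"
    using orthosystem_D(2)[OF assms(1)] by (intro sum.cong) auto
  finally show ?thesis using assms by simp
qed

lemma orthosystem_sum_norm:
  assumes e: "orthosystem M e" and I: "finite I"
  shows "(L2_norm M (\<lambda>x. \<Sum>i\<in>I. c i * e i x))\<^sup>2 = (\<Sum>i\<in>I. (c i)\<^sup>2 * (LINT x|M. e i x * e i x))"
proof -
  have S: "(\<lambda>x. \<Sum>i\<in>I. c i * e i x) \<in> L2 M"
    using orthosystem_D(1)[OF e] by (intro L2_sum L2_cmult)
  have "(L2_norm M (\<lambda>x. \<Sum>i\<in>I. c i * e i x))\<^sup>2
      = (LINT x|M. (\<Sum>j\<in>I. c j * ((\<Sum>i\<in>I. c i * e i x) * e j x)))"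
    unfolding L2_norm_power2 unfolding power2_eq_square
    by (simp add: sum_distrib_left[of "\<Sum>i\<in>I. c i * e i _"] mult.left_commute)
  also have "\<dots> = (\<Sum>j\<in>I. c j * (LINT x|M. (\<Sum>i\<in>I. c i * e i x) * e j x))"
    using L2_integrable_mult[OF S orthosystem_D(1)[OF e]] by simp
  also have "\<dots> = (\<Sum>j\<in>I. (c j)\<^sup>2 * (LINT x|M. e j x * e j x))"
    using orthosystem_sum_inner[OF e I] by (intro sum.cong) (auto simp: power2_eq_square)
  finally show ?thesis .
qed

text \<open>Expanding the square gives the norm of \<open>f\<close> minus twice the sum plus the
  norm of the partial sum; the last is at most the sum of the squares because each member has norm
  at most 1.\<close>

lemma orthosystem_diff_norm:
  assumes e: "orthosystem M e" and I: "finite I" and f: "f \<in> L2 M"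
  defines "c \<equiv> \<lambda>i. LINT x|M. f x * e i x"
  shows "(L2_norm M (\<lambda>x. f x - (\<Sum>i\<in>I. c i * e i x)))\<^sup>2
    \<le> (L2_norm M f)\<^sup>2 - (\<Sum>i\<in>I. (c i)\<^sup>2)"
proof -
  define S where "S = (\<lambda>x. \<Sum>i\<in>I. c i * e i x)"
  have S: "S \<in> L2 M"
    unfolding S_def using orthosystem_D(1)[OF e] by (intro L2_sum L2_cmult)
  have fS: "(LINT x|M. f x * S x) = (\<Sum>i\<in>I. (c i)\<^sup>2)"
  proof -
    have "(LINT x|M. f x * S x) = (LINT x|M. (\<Sum>i\<in>I. c i * (f x * e i x)))"
      by (simp add: S_def sum_distrib_left mult_ac)
    also have "\<dots> = (\<Sum>i\<in>I. c i * (LINT x|M. f x * e i x))"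
      using L2_integrable_mult[OF f orthosystem_D(1)[OF e]] by simp
    finally show ?thesis by (simp add: c_def power2_eq_square)
  qed
  have SS: "(L2_norm M S)\<^sup>2 \<le> (\<Sum>i\<in>I. (c i)\<^sup>2)"
    unfolding S_def orthosystem_sum_norm[OF e I]
    using orthosystem_D(3)[OF e] by (intro sum_mono) (auto intro: mult_left_le)
  have "(L2_norm M (\<lambda>x. f x - S x))\<^sup>2 = (LINT x|M. (f x)\<^sup>2 - 2 * (f x * S x) + (S x)\<^sup>2)"
    unfolding L2_norm_power2
    by (intro Bochner_Integration.integral_cong) (auto simp: power2_eq_square algebra_simps)
  also have "\<dots> = (L2_norm M f)\<^sup>2 - 2 * (\<Sum>i\<in>I. (c i)\<^sup>2) + (L2_norm M S)\<^sup>2"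
    unfolding fS[symmetric] L2_norm_power2
    using L2_D(2)[OF f] L2_D(2)[OF S] L2_integrable_mult[OF f S] by simp
  finally show ?thesis using SS by (simp add: S_def)
qed

lemma Bessel_inequality:
  assumes "orthosystem M e" "finite I" "f \<in> L2 M"
  shows "(\<Sum>i\<in>I. (LINT x|M. f x * e i x)\<^sup>2) \<le> (L2_norm M f)\<^sup>2"
  using orthosystem_diff_norm[OF assms]
  by (meson diff_ge_0_iff_ge order_trans zero_le_power2)

section \<open>Integration over the unit square\<close>

text \<open>The compact closure of \<open>Omega\<close>, on which continuous functions are bounded
  and can be approximated uniformly.\<close>

definition Q :: "(real \<times> real) set" where "Q = cbox (0, 0) (1, 1)"

lemma Q_eq: "Q = {0..1} \<times> {0..1}"
  by (auto simp: Q_def cbox_Pair_eq)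

lemma compact_Q: "compact Q"
  by (simp add: Q_def compact_cbox)

lemma Omega_box: "Omega = box (0, 0) (1, 1)"
  by (auto simp: Omega_def box_def Basis_prod_def)

lemma Omega_sub_Q: "Omega \<subseteq> Q"
  by (auto simp: Omega_def Q_eq)

lemma Omega_sets [measurable, simp]: "Omega \<in> sets lebesgue"
  by (simp add: Omega_box)

lemma lmeasurable_Omega: "Omega \<in> lmeasurable"
  by (simp add: Omega_box)

lemma finite_measure_Omega: "finite_measure (lebesgue_on Omega)"
  using lmeasurable_Omega by (simp add: finite_measure_lebesgue_on)

lemma measure_Omega: "measure (lebesgue_on Omega) Omega = 1"
proof -
  have "measure lebesgue (box (0, 0) (1, 1) :: (real \<times> real) set) = measure lebesgue (cbox (0, 0) (1, 1) :: (real \<times> real) set)"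
    by (metis content_cbox_plus measure_lborel_box_eq measure_lborel_cbox_eq measure_completion box_borel borel_closed closed_cbox sets_lborel)
  then show ?thesis by (simp add: measure_restrict_space Omega_box content_Pair)
qed

lemma space_Omega [simp]: "space (lebesgue_on Omega) = Omega"
  by simp

lemma continuous_measurable_Omega: 
  "continuous_on UNIV (f :: real \<times> real \<Rightarrow> real) \<Longrightarrow> f \<in> borel_measurable (lebesgue_on Omega)"
  by (intro continuous_imp_measurable_on_sets_lebesgue) (auto intro: continuous_on_subset)

lemma continuous_bounded_Q:
  assumes "continuous_on UNIV (f :: real \<times> real \<Rightarrow> real)"
  obtains B where "B \<ge> 0" "\<And>p. p \<in> Q \<Longrightarrow> \<bar>f p\<bar> \<le> B"
proof -
  have "bounded (f ` Q)"
    using assms compact_Q by (meson compact_continuous_image compact_imp_bounded continuous_on_subset top_greatest)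
  then obtain B where "\<forall>p\<in>Q. norm (f p) \<le> B" by (auto simp: bounded_iff)
  then show ?thesis by (intro that[of "\<bar>B\<bar>"]) force+
qed

lemma bounded_L2_Omega:
  assumes "f \<in> borel_measurable (lebesgue_on Omega)" "\<And>p. p \<in> Omega \<Longrightarrow> \<bar>f p\<bar> \<le> B"
  shows "f \<in> L2\<Omega>"
proof -
  have "integrable (lebesgue_on Omega) (\<lambda>p. (f p)\<^sup>2)"
  proof (rule finite_measure.integrable_const_bound[OF finite_measure_Omega])
    show "AE p in lebesgue_on Omega. norm ((f p)\<^sup>2) \<le> B\<^sup>2"
      using assms(2) by (intro AE_I2) (metis abs_ge_zero power2_abs power_mono real_norm_def abs_power2 space_Omega)
  qed (use assms in simp)
  with assms show ?thesis by (simp add: L2_def)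
qed

lemma continuous_L2_Omega:
  assumes "continuous_on UNIV f"
  shows "f \<in> L2\<Omega>"
proof -
  obtain B where "\<And>p. p \<in> Q \<Longrightarrow> \<bar>f p\<bar> \<le> B" using continuous_bounded_Q[OF assms] by metis
  then show ?thesis
    using Omega_sub_Q by (intro bounded_L2_Omega[where B=B] continuous_measurable_Omega assms) auto
qed

lemma L2_Omega_integrable:
  assumes "f \<in> L2\<Omega>"
  shows "integrable (lebesgue_on Omega) f"
  using L2_integrable_mult[OF assms continuous_L2_Omega[of "\<lambda>_. 1"]] by simp

lemma L2_norm_bounded_Omega:
  assumes "f \<in> borel_measurable (lebesgue_on Omega)" "\<And>p. p \<in> Omega \<Longrightarrow> \<bar>f p\<bar> \<le> B" "0 \<le> B"
  shows "norm_L2\<Omega> f \<le> B"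
proof (rule power2_le_imp_le)
  have "(norm_L2\<Omega> f)\<^sup>2 \<le> (LINT p|lebesgue_on Omega. B\<^sup>2)"
    unfolding L2_norm_power2
  proof (rule integral_mono)
    show "integrable (lebesgue_on Omega) (\<lambda>p. (f p)\<^sup>2)"
      using bounded_L2_Omega[OF assms(1,2)] by (simp add: L2_def)
    show "integrable (lebesgue_on Omega) (\<lambda>p. B\<^sup>2)"
      using finite_measure_Omega by (simp add: finite_measure.integrable_const)
    show "(f p)\<^sup>2 \<le> B\<^sup>2" if "p \<in> space (lebesgue_on Omega)" for p
      using assms(2)[of p] that by (metis abs_ge_zero power2_abs power_mono space_Omega)
  qed
  also have "\<dots> = B\<^sup>2" using measure_Omega by simp
  finally show "(norm_L2\<Omega> f)\<^sup>2 \<le> B\<^sup>2" .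
qed (use assms in simp)

lemma inner_bounded_Omega:
  assumes "f \<in> L2\<Omega>" "g \<in> borel_measurable (lebesgue_on Omega)" "\<And>p. p \<in> Omega \<Longrightarrow> \<bar>g p\<bar> \<le> B" "0 \<le> B"
  shows "\<bar>LINT p|lebesgue_on Omega. f p * g p\<bar> \<le> norm_L2\<Omega> f * B"
  using L2_Cauchy_Schwarz[OF assms(1) bounded_L2_Omega[OF assms(2,3)]]
    L2_norm_bounded_Omega[OF assms(2-4)]
  by (meson L2_norm_nonneg mult_left_mono order_trans)

text \<open>The boundary of the square is negligible, so the gauge integral over the closed box
  gives the same value, and there both orders of iterated integration are available.\<close>

lemma integral_Omega_eq:
  fixes f :: "real \<times> real \<Rightarrow> real"
  assumes "continuous_on UNIV f"
  shows "(LINT p|lebesgue_on Omega. f p) = integral {0..1} (\<lambda>x. integral {0..1} (\<lambda>y. f (x, y)))"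
    and "(LINT p|lebesgue_on Omega. f p) = integral {0..1} (\<lambda>y. integral {0..1} (\<lambda>x. f (x, y)))"
proof -
  have cont: "continuous_on (cbox (0, 0) (1, 1)) f" using assms continuous_on_subset by blast
  have "integrable (lebesgue_on Omega) f"
    by (intro L2_Omega_integrable continuous_L2_Omega assms)
  then have "(LINT p|lebesgue_on Omega. f p) = integral Omega f"
    by (intro lebesgue_integral_eq_integral) auto
  also have "\<dots> = integral (cbox (0, 0) (1, 1)) f"
    unfolding Omega_box by (rule integral_open_interval)
  finally have *: "(LINT p|lebesgue_on Omega. f p) = integral (cbox (0, 0) (1, 1)) f" .
  show 1: "(LINT p|lebesgue_on Omega. f p) = integral {0..1} (\<lambda>x. integral {0..1} (\<lambda>y. f (x, y)))"
    unfolding * using integral_prod_continuous[OF cont] by simp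
  show "(LINT p|lebesgue_on Omega. f p) = integral {0..1} (\<lambda>y. integral {0..1} (\<lambda>x. f (x, y)))"
    unfolding 1 using integral_swap_continuous[of 0 0 1 1 "\<lambda>x y. f (x, y)"] cont by simp
qed

lemma integral_Omega_prod:
  fixes a b :: "real \<Rightarrow> real"
  assumes "continuous_on UNIV a" "continuous_on UNIV b"
  shows "(LINT p|lebesgue_on Omega. a (fst p) * b (snd p)) = integral {0..1} a * integral {0..1} b"
proof -
  have "continuous_on UNIV (\<lambda>p. a (fst p) * b (snd p))"
    using assms by (intro continuous_intros continuous_on_compose2[OF assms(1)] continuous_on_compose2[OF assms(2)]) auto
  then show ?thesis
    by (simp add: integral_Omega_eq(1))
qed

section \<open>Cosine series on the unit square\<close>

definition cmode :: "nat \<Rightarrow> real \<Rightarrow> real" where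
  "cmode k x = (if k = 0 then 1 else sqrt 2) * cos (real k * pi * x)"

text \<open>The companion of \<open>cmode\<close>: its derivative is
  \<open>real k * pi * cmode k\<close>, for \<open>k = 0\<close> as well, so sine coefficients of a
  derivative are multiples of cosine coefficients of the function.\<close>

definition smode :: "nat \<Rightarrow> real \<Rightarrow> real" where
  "smode k x = sqrt 2 * sin (real k * pi * x)"

definition tensor :: "(nat \<Rightarrow> real \<Rightarrow> real) \<Rightarrow> (nat \<Rightarrow> real \<Rightarrow> real) \<Rightarrow> nat \<times> nat \<Rightarrow> real \<times> real \<Rightarrow> real" where
  "tensor a b i p = a (fst i) (fst p) * b (snd i) (snd p)"

lemma integral_cos_int:
  fixes m :: int
  shows "integral {0..1} (\<lambda>x. cos (of_int m * pi * x)) = (if m = 0 then 1 else 0)"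
proof (cases "m = 0")
  case False
  have "((\<lambda>x. cos (of_int m * pi * x)) has_integral
      (sin (of_int m * pi * 1) / (of_int m * pi) - sin (of_int m * pi * 0) / (of_int m * pi))) {0..1}"
    using False by (intro fundamental_theorem_of_calculus)
      (auto intro!: derivative_eq_intros simp flip: has_real_derivative_iff_has_vector_derivative)
  then show ?thesis using False by (auto simp: mult.commute[of _ pi] dest!: integral_unique)
qed simp

text \<open>The sign \<open>s\<close> covers both product formulas: 1 for two cosines, -1 for two
  sines. Integer frequencies are used because \<open>k - l\<close> may be negative.\<close>

lemma integral_cos_prod:
  fixes k l :: nat and s :: real
  shows "integral {0..1} (\<lambda>x. (cos (of_int (int k - int l) * pi * x) + s * cos (of_int (int k + int l) * pi * x)) / 2)
    = ((if k = l then 1 else 0) + s * (if k = 0 \<and> l = 0 then 1 else 0)) / 2"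
proof -
  have "(\<lambda>x. cos (of_int m * pi * x)) integrable_on {0..1}" for m :: int
    by (intro integrable_continuous_real continuous_intros)
  then have "integral {0..1} (\<lambda>x. (cos (of_int (int k - int l) * pi * x) + s * cos (of_int (int k + int l) * pi * x)) / 2)
     = (integral {0..1} (\<lambda>x. cos (of_int (int k - int l) * pi * x))
        + s * integral {0..1} (\<lambda>x. cos (of_int (int k + int l) * pi * x))) / 2"
    by (subst integral_divide, subst integral_add) (auto intro: integrable_on_mult_right simp del: of_int_diff of_int_add)
  then show ?thesis unfolding integral_cos_int by auto
qed

lemma cmode_orthogonal: "integral {0..1} (\<lambda>x. cmode k x * cmode l x) = (if k = l then 1 else 0)"
proof -
  let ?P = "\<lambda>x. (cos (of_int (int k - int l) * pi * x) + 1 * cos (of_int (int k + int l) * pi * x)) / 2"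
  define C where "C = (\<lambda>k::nat. if k = 0 then 1 else sqrt 2)"
  have P: "?P x = cos (real k * pi * x) * cos (real l * pi * x)" for x
    by (simp add: cos_times_cos left_diff_distrib distrib_right)
  have "cmode k x * cmode l x = C k * C l * ?P x" for x
    unfolding P cmode_def C_def by (simp only: mult_ac)
  then have "integral {0..1} (\<lambda>x. cmode k x * cmode l x) = C k * C l * integral {0..1} ?P"
    by (simp only: integral_mult_right)
  then show ?thesis unfolding integral_cos_prod by (cases "k = 0"; cases "l = 0") (simp_all add: C_def)
qed

lemma smode_orthogonal: "integral {0..1} (\<lambda>x. smode k x * smode l x) = (if k = l \<and> k \<noteq> 0 then 1 else 0)"
proof -
  let ?P = "\<lambda>x. (cos (of_int (int k - int l) * pi * x) + (-1) * cos (of_int (int k + int l) * pi * x)) / 2"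
  have P: "?P x = sin (real k * pi * x) * sin (real l * pi * x)" for x
    by (simp add: sin_times_sin left_diff_distrib distrib_right)
  have "smode k x * smode l x = (sqrt 2 * sqrt 2) * ?P x" for x
    unfolding P smode_def by (simp only: mult_ac)
  then have "integral {0..1} (\<lambda>x. smode k x * smode l x) = (sqrt 2 * sqrt 2) * integral {0..1} ?P"
    by (simp only: integral_mult_right)
  then show ?thesis unfolding integral_cos_prod by (cases "k = l"; cases "l = 0") auto
qed

lemma continuous_cmode: "continuous_on UNIV (cmode k)"
  unfolding cmode_def by (intro continuous_intros)

lemma continuous_smode: "continuous_on UNIV (smode k)"
  unfolding smode_def by (intro continuous_intros)

lemma continuous_tensor:
  assumes "\<And>k. continuous_on UNIV (a k)" "\<And>k. continuous_on UNIV (b k)"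
  shows "continuous_on UNIV (tensor a b i)"
  unfolding tensor_def
  by (intro continuous_intros continuous_on_compose2[OF assms(1)] continuous_on_compose2[OF assms(2)]) auto

lemma continuous_mode: "continuous_on UNIV (tensor cmode cmode i)"
  by (intro continuous_tensor continuous_cmode)

lemma orthosystem_tensor:
  assumes "\<And>k. continuous_on UNIV (a k)" "\<And>k. continuous_on UNIV (b k)"
    and "\<And>k l. integral {0..1} (\<lambda>x. a k x * a l x) = (if k = l \<and> P k then 1 else 0)"
    and "\<And>k l. integral {0..1} (\<lambda>x. b k x * b l x) = (if k = l \<and> R k then 1 else 0)"
  shows "orthosystem (lebesgue_on Omega) (tensor a b)"
proof -
  have *: "(LINT p|lebesgue_on Omega. tensor a b i p * tensor a b j p)
     = (if i = j \<and> P (fst i) \<and> R (snd i) then 1 else 0)" for i j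
  proof -
    have "(LINT p|lebesgue_on Omega. tensor a b i p * tensor a b j p)
      = (LINT p|lebesgue_on Omega. (a (fst i) (fst p) * a (fst j) (fst p)) * (b (snd i) (snd p) * b (snd j) (snd p)))"
      by (simp add: tensor_def mult_ac)
    also have "\<dots> = integral {0..1} (\<lambda>x. a (fst i) x * a (fst j) x) * integral {0..1} (\<lambda>x. b (snd i) x * b (snd j) x)"
      using assms(1,2) by (intro integral_Omega_prod[of "\<lambda>x. a (fst i) x * a (fst j) x" "\<lambda>x. b (snd i) x * b (snd j) x"] continuous_intros)
    finally show ?thesis using assms(3,4) by (auto simp: prod_eq_iff)
  qed
  show ?thesis
    unfolding orthosystem_def * using continuous_L2_Omega[OF continuous_tensor] assms(1,2) by auto
qed

lemma orthosystem_modes: "orthosystem (lebesgue_on Omega) (tensor cmode cmode)"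
  by (rule orthosystem_tensor[where P="\<lambda>_. True" and R="\<lambda>_. True"])
     (auto simp: continuous_cmode cmode_orthogonal)

lemma mode_norm: "(LINT p|lebesgue_on Omega. tensor cmode cmode i p * tensor cmode cmode i p) = 1"
proof -
  have "(LINT p|lebesgue_on Omega. tensor cmode cmode i p * tensor cmode cmode i p)
      = (LINT p|lebesgue_on Omega. (cmode (fst i) (fst p) * cmode (fst i) (fst p)) * (cmode (snd i) (snd p) * cmode (snd i) (snd p)))"
    by (simp add: tensor_def mult_ac)
  also have "\<dots> = integral {0..1} (\<lambda>x. cmode (fst i) x * cmode (fst i) x) * integral {0..1} (\<lambda>x. cmode (snd i) x * cmode (snd i) x)"
    using continuous_cmode by (intro integral_Omega_prod[of "\<lambda>x. cmode (fst i) x * cmode (fst i) x" "\<lambda>x. cmode (snd i) x * cmode (snd i) x"] continuous_intros)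
  finally show ?thesis by (simp add: cmode_orthogonal)
qed

section \<open>Partial sums of the cosine series and their completeness\<close>

definition coeff_cos :: "(real \<times> real \<Rightarrow> real) \<Rightarrow> nat \<times> nat \<Rightarrow> real" where
  "coeff_cos f i = (LINT p|lebesgue_on Omega. f p * tensor cmode cmode i p)"

definition modes :: "nat \<Rightarrow> (nat \<times> nat) set" where
  "modes N = {..<N} \<times> {..<N}"

definition cos_proj :: "nat \<Rightarrow> (real \<times> real \<Rightarrow> real) \<Rightarrow> real \<times> real \<Rightarrow> real" where
  "cos_proj N f p = (\<Sum>i\<in>modes N. coeff_cos f i * tensor cmode cmode i p)"

lemma finite_modes [simp]: "finite (modes N)"
  by (simp add: modes_def)

lemma mode_L2: "tensor cmode cmode i \<in> L2\<Omega>"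
  by (intro continuous_L2_Omega continuous_mode)

lemma cos_proj_L2: "cos_proj N f \<in> L2\<Omega>"
  unfolding cos_proj_def by (intro L2_sum L2_cmult mode_L2)

lemma coeff_cos_add: "f \<in> L2\<Omega> \<Longrightarrow> g \<in> L2\<Omega> \<Longrightarrow> coeff_cos (\<lambda>p. f p + g p) i = coeff_cos f i + coeff_cos g i"
  unfolding coeff_cos_def using L2_integrable_mult[OF _ mode_L2] by (simp add: algebra_simps)

lemma coeff_cos_diff: "f \<in> L2\<Omega> \<Longrightarrow> g \<in> L2\<Omega> \<Longrightarrow> coeff_cos (\<lambda>p. f p - g p) i = coeff_cos f i - coeff_cos g i"
  unfolding coeff_cos_def using L2_integrable_mult[OF _ mode_L2] by (simp add: algebra_simps)

lemma cos_proj_error_power2: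
  assumes "f \<in> L2\<Omega>"
  shows "(norm_L2\<Omega> (\<lambda>p. f p - cos_proj N f p))\<^sup>2 \<le> (norm_L2\<Omega> f)\<^sup>2 - (\<Sum>i\<in>modes N. (coeff_cos f i)\<^sup>2)"
  using orthosystem_diff_norm[OF orthosystem_modes finite_modes[of N] assms]
  by (simp add: cos_proj_def coeff_cos_def)

lemma cos_proj_error_le:
  assumes "f \<in> L2\<Omega>"
  shows "norm_L2\<Omega> (\<lambda>p. f p - cos_proj N f p) \<le> norm_L2\<Omega> f"
proof (rule power2_le_imp_le)
  show "(norm_L2\<Omega> (\<lambda>p. f p - cos_proj N f p))\<^sup>2 \<le> (norm_L2\<Omega> f)\<^sup>2"
    using cos_proj_error_power2[OF assms, of N] sum_nonneg[of "modes N" "\<lambda>i. (coeff_cos f i)\<^sup>2"]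
    by (smt (verit) zero_le_power2)
qed simp

text \<open>The algebra to which the Stone-Weierstrass theorem is applied. Generating it from scaled
  modes by sums reduces closure under products to the product of two modes, where the addition
  formulas for cosines apply.\<close>

inductive trig_poly :: "(real \<times> real \<Rightarrow> real) \<Rightarrow> bool" where
  trig_mode: "trig_poly (\<lambda>p. c * tensor cmode cmode i p)"
| trig_add: "trig_poly f \<Longrightarrow> trig_poly g \<Longrightarrow> trig_poly (\<lambda>p. f p + g p)"

lemma trig_poly_continuous: "trig_poly f \<Longrightarrow> continuous_on UNIV f"
  by (induction rule: trig_poly.induct) (auto intro!: continuous_intros continuous_mode)

lemma trig_poly_cos: "trig_poly (\<lambda>p. c * (cos (real k * pi * fst p) * cos (real n * pi * snd p)))"
proof -
  define d where "d = c / ((if k = 0 then 1 else sqrt 2) * (if n = 0 then 1 else sqrt 2))"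
  have "(\<lambda>p. c * (cos (real k * pi * fst p) * cos (real n * pi * snd p))) = (\<lambda>p. d * tensor cmode cmode (k, n) p)"
    by (auto simp: d_def tensor_def cmode_def)
  then show ?thesis using trig_mode[of d "(k, n)"] by simp
qed

lemma trig_poly_mode_eq: "\<exists>d k n. (\<lambda>p. c * tensor cmode cmode i p) = (\<lambda>p. d * (cos (real k * pi * fst p) * cos (real n * pi * snd p)))"
  by (rule exI[of _ "c * ((if fst i = 0 then 1 else sqrt 2) * (if snd i = 0 then 1 else sqrt 2))"],
      rule exI[of _ "fst i"], rule exI[of _ "snd i"]) (auto simp: tensor_def cmode_def fun_eq_iff)

lemma cos_nat_times_cos_nat:
  fixes k l :: nat
  obtains m where "\<And>x. cos (real k * pi * x) * cos (real l * pi * x) = (cos (real m * pi * x) + cos (real (k + l) * pi * x)) / 2"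
proof (cases "k \<le> l")
  case True
  have "cos (real k * pi * x) * cos (real l * pi * x) = (cos (real (l - k) * pi * x) + cos (real (k + l) * pi * x)) / 2" for x
    using True cos_times_cos[of "l * pi * x" "k * pi * x"] by (simp add: of_nat_diff algebra_simps)
  then show ?thesis using that by blast
next
  case False
  have "cos (real k * pi * x) * cos (real l * pi * x) = (cos (real (k - l) * pi * x) + cos (real (k + l) * pi * x)) / 2" for x
    using False cos_times_cos[of "k * pi * x" "l * pi * x"] by (simp add: of_nat_diff algebra_simps)
  then show ?thesis using that by blast
qed

lemma trig_poly_mult:
  assumes "trig_poly f" "trig_poly g"
  shows "trig_poly (\<lambda>p. f p * g p)"
  using assms
proof (induction arbitrary: g rule: trig_poly.induct)
  case (trig_mode c i)
  show ?case using trig_mode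
  proof (induction rule: trig_poly.induct)
    case (trig_mode d j)
    obtain c' k n where 1: "(\<lambda>p. c * tensor cmode cmode i p) = (\<lambda>p. c' * (cos (real k * pi * fst p) * cos (real n * pi * snd p)))"
      using trig_poly_mode_eq by metis
    obtain d' k' n' where 2: "(\<lambda>p. d * tensor cmode cmode j p) = (\<lambda>p. d' * (cos (real k' * pi * fst p) * cos (real n' * pi * snd p)))"
      using trig_poly_mode_eq by metis
    obtain a where a: "\<And>x. cos (real k * pi * x) * cos (real k' * pi * x) = (cos (real a * pi * x) + cos (real (k + k') * pi * x)) / 2"
      using cos_nat_times_cos_nat by blast
    obtain b where b: "\<And>x. cos (real n * pi * x) * cos (real n' * pi * x) = (cos (real b * pi * x) + cos (real (n + n') * pi * x)) / 2"
      using cos_nat_times_cos_nat by blast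
    define t where "t = (\<lambda>k n p. (c' * d' / 4) * (cos (real k * pi * fst p) * cos (real n * pi * snd p)))"
    have "c * tensor cmode cmode i p * (d * tensor cmode cmode j p)
       = (t a b p + t a (n + n') p) + (t (k + k') b p + t (k + k') (n + n') p)" for p
    proof -
      have "c * tensor cmode cmode i p * (d * tensor cmode cmode j p)
        = c' * d' * ((cos (real k * pi * fst p) * cos (real k' * pi * fst p)) * (cos (real n * pi * snd p) * cos (real n' * pi * snd p)))"
        using fun_cong[OF 1, of p] fun_cong[OF 2, of p] by (simp add: mult_ac)
      then show ?thesis unfolding a b t_def by (simp add: field_simps del: of_nat_add)
    qed
    moreover have "trig_poly (t k n)" for k n
      unfolding t_def by (rule trig_poly_cos)
    ultimately show ?case by (simp add: trig_poly.trig_add)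
  next
    case (trig_add f g)
    then show ?case by (simp add: distrib_left trig_poly.trig_add)
  qed
next
  case (trig_add f g h)
  then show ?case by (simp add: distrib_right trig_poly.trig_add)
qed

lemma trig_poly_const: "trig_poly (\<lambda>_. c)"
  using trig_poly_cos[of c 0 0] by simp

lemma cos_pi_inj: "x \<in> {0..1} \<Longrightarrow> y \<in> {0..1} \<Longrightarrow> cos (pi * x) = cos (pi * y) \<Longrightarrow> x = y"
  using cos_inj_pi[of "pi * x" "pi * y"] by (auto simp: mult_left_le)

text \<open>Points are separated by the two functions cos(pi x) and cos(pi y) alone, since cos(pi x)
  is injective on the unit interval.\<close>

lemma function_ring_trig_poly: "function_ring_on {f. trig_poly f} Q"
proof
  show "compact Q" by (rule compact_Q)
  show "continuous_on Q f" if "f \<in> {f. trig_poly f}" for f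
    using trig_poly_continuous that continuous_on_subset by blast
  fix x y :: "real \<times> real" assume xy: "x \<in> Q" "y \<in> Q" "x \<noteq> y"
  have 1: "(\<lambda>p. cos (pi * fst p)) \<in> {f. trig_poly f}" using trig_poly_cos[of 1 1 0] by simp
  have 2: "(\<lambda>p. cos (pi * snd p)) \<in> {f. trig_poly f}" using trig_poly_cos[of 1 0 1] by simp
  show "\<exists>f\<in>{f. trig_poly f}. f x \<noteq> f y"
  proof (cases "fst x = fst y")
    case True
    then show ?thesis using xy cos_pi_inj[of "snd x" "snd y"]
      by (intro bexI[OF _ 2]) (auto simp: Q_eq prod_eq_iff)
  next
    case False
    then show ?thesis using xy cos_pi_inj[of "fst x" "fst y"]
      by (intro bexI[OF _ 1]) (auto simp: Q_eq)
  qed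
qed (auto intro: trig_poly_mult trig_poly.trig_add trig_poly_const)

text \<open>Truncation supplies the dominating constants: it is applied to a square integrable
  function and to the continuous functions that approximate a bounded one.\<close>

definition clamp_abs :: "real \<Rightarrow> real \<Rightarrow> real" where
  "clamp_abs M x = max (- M) (min M x)"

lemma clamp_abs_bound: "0 \<le> M \<Longrightarrow> \<bar>clamp_abs M x\<bar> \<le> M"
  by (auto simp: clamp_abs_def)

lemma clamp_abs_id: "\<bar>x\<bar> \<le> M \<Longrightarrow> clamp_abs M x = x"
  by (auto simp: clamp_abs_def)

lemma continuous_clamp_abs: "continuous_on S f \<Longrightarrow> continuous_on S (\<lambda>x. clamp_abs M (f x))"
  unfolding clamp_abs_def by (intro continuous_intros)

lemma clamp_abs_tendsto: "(f \<longlongrightarrow> l) F \<Longrightarrow> ((\<lambda>x. clamp_abs M (f x)) \<longlongrightarrow> clamp_abs M l) F"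
  unfolding clamp_abs_def by (intro tendsto_intros)

text \<open>Lebesgue measurability already provides continuous functions converging off a negligible
  set. Truncating them at \<open>M\<close> keeps the limit, because \<open>f\<close> itself stays
  within that bound.\<close>

lemma bounded_ae_limit_continuous:
  fixes f :: "'a::euclidean_space \<Rightarrow> real"
  assumes S: "S \<in> sets lebesgue" and f: "f \<in> borel_measurable (lebesgue_on S)"
    and bd: "\<And>x. x \<in> S \<Longrightarrow> \<bar>f x\<bar> \<le> M" and M: "0 \<le> M"
  obtains g :: "nat \<Rightarrow> 'a \<Rightarrow> real" where "\<And>n. continuous_on UNIV (g n)" "\<And>n x. \<bar>g n x\<bar> \<le> M"
    "AE x in lebesgue_on S. (\<lambda>n. g n x) \<longlonglongrightarrow> f x"
proof -
  have "f measurable_on S" using f S by (simp add: measurable_on_iff_borel_measurable)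
  then obtain N g where N: "negligible N" and g: "\<And>n. continuous_on UNIV (g n)"
    and lim: "\<And>x. x \<notin> N \<Longrightarrow> (\<lambda>n. g n x) \<longlonglongrightarrow> (if x \<in> S then f x else 0)"
    unfolding measurable_on_def by blast
  show ?thesis
  proof (rule that[of "\<lambda>n x. clamp_abs M (g n x)"])
    show "AE x in lebesgue_on S. (\<lambda>n. clamp_abs M (g n x)) \<longlonglongrightarrow> f x"
    proof -
      have "AE x in lebesgue. x \<notin> N" using N by (simp add: AE_not_in negligible_iff_null_sets)
      then have "AE x in lebesgue_on S. x \<notin> N" using S by (simp add: AE_restrict_space_iff eventually_mono)
      then show ?thesis
      proof (rule AE_mp, intro AE_I2 impI)
        fix x assume x: "x \<in> space (lebesgue_on S)" "x \<notin> N"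
        then have "(\<lambda>n. g n x) \<longlonglongrightarrow> f x" using lim[of x] by simp
        from clamp_abs_tendsto[OF this, of M] show "(\<lambda>n. clamp_abs M (g n x)) \<longlonglongrightarrow> f x"
          using bd[of x] x by (simp add: clamp_abs_id)
      qed
    qed
  qed (auto intro: continuous_clamp_abs g clamp_abs_bound M)
qed

lemma L2_dominated_tendsto:
  assumes f: "f \<in> borel_measurable M" and g: "\<And>n. g n \<in> borel_measurable M"
    and h: "integrable M h" and lim: "AE x in M. (\<lambda>n. g n x) \<longlonglongrightarrow> f x"
    and bd: "\<And>n. AE x in M. (g n x - f x)\<^sup>2 \<le> h x"
  shows "(\<lambda>n. L2_norm M (\<lambda>x. g n x - f x)) \<longlonglongrightarrow> 0"
proof -
  have "(\<lambda>n. LINT x|M. (g n x - f x)\<^sup>2) \<longlonglongrightarrow> (LINT x|M. 0)"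
  proof (rule integral_dominated_convergence[where w=h])
    show "AE x in M. (\<lambda>n. (g n x - f x)\<^sup>2) \<longlonglongrightarrow> 0"
      using lim by (rule AE_mp) (auto intro!: AE_I2 tendsto_eq_intros)
  qed (use f g h bd in auto)
  then have "(\<lambda>n. sqrt (LINT x|M. (g n x - f x)\<^sup>2)) \<longlonglongrightarrow> sqrt 0" by (intro tendsto_real_sqrt) simp
  then show ?thesis by (simp add: L2_norm_def)
qed

text \<open>Three approximations with error e/3 each: truncation of \<open>f\<close>, a continuous
  function close in the mean, and a trigonometric polynomial uniformly close on the closed
  square.\<close>

lemma trig_poly_dense:
  assumes f: "f \<in> L2\<Omega>" and e: "e > 0"
  obtains h where "trig_poly h" "norm_L2\<Omega> (\<lambda>p. f p - h p) < e"
proof -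
  have fm: "f \<in> borel_measurable (lebesgue_on Omega)" using f by (simp add: L2_def)
  have cm: "(\<lambda>p. clamp_abs M (f p)) \<in> borel_measurable (lebesgue_on Omega)" for M
    unfolding clamp_abs_def using fm by measurable
  have "(\<lambda>n. norm_L2\<Omega> (\<lambda>p. clamp_abs (real n) (f p) - f p)) \<longlonglongrightarrow> 0"
  proof (rule L2_dominated_tendsto[where h = "\<lambda>p. (f p)\<^sup>2"])
    show "AE x in lebesgue_on Omega. (\<lambda>n. clamp_abs (real n) (f x)) \<longlonglongrightarrow> f x"
    proof (rule AE_I2)
      fix x
      obtain m where "\<bar>f x\<bar> \<le> real m" using real_arch_simple by blast
      then have "eventually (\<lambda>n. clamp_abs (real n) (f x) = f x) sequentially"
        by (intro eventually_sequentiallyI[of m] clamp_abs_id) auto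
      then show "(\<lambda>n. clamp_abs (real n) (f x)) \<longlonglongrightarrow> f x" by (rule tendsto_eventually)
    qed
    show "AE x in lebesgue_on Omega. (clamp_abs (real n) (f x) - f x)\<^sup>2 \<le> (f x)\<^sup>2" for n
    proof (rule AE_I2)
      fix x have "\<bar>clamp_abs (real n) (f x) - f x\<bar> \<le> \<bar>f x\<bar>" by (auto simp: clamp_abs_def)
      then show "(clamp_abs (real n) (f x) - f x)\<^sup>2 \<le> (f x)\<^sup>2" by (simp add: abs_le_square_iff)
    qed
  qed (use fm cm f in \<open>auto simp: L2_def\<close>)
  from order_tendstoD(2)[OF this, of "e/3"] e obtain n :: nat where
    n0: "norm_L2\<Omega> (\<lambda>p. clamp_abs (real n) (f p) - f p) < e/3"
    by (auto simp: eventually_sequentially)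
  define F where "F = (\<lambda>p. clamp_abs (real n) (f p))"
  have n: "norm_L2\<Omega> (\<lambda>p. F p - f p) < e/3" using n0 by (simp add: F_def)
  have Fb: "\<bar>F p\<bar> \<le> real n" for p by (simp add: F_def clamp_abs_bound)
  have Fm: "F \<in> borel_measurable (lebesgue_on Omega)" unfolding F_def by (rule cm)
  obtain g where g: "\<And>m. continuous_on UNIV (g m)" "\<And>m x. \<bar>g m x\<bar> \<le> real n"
    and lim: "AE x in lebesgue_on Omega. (\<lambda>m. g m x) \<longlonglongrightarrow> F x"
    using bounded_ae_limit_continuous[OF Omega_sets Fm Fb] by auto
  have "(\<lambda>m. norm_L2\<Omega> (\<lambda>p. g m p - F p)) \<longlonglongrightarrow> 0"
  proof (rule L2_dominated_tendsto[where h = "\<lambda>p. (2 * real n)\<^sup>2"])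
    show "AE x in lebesgue_on Omega. (g m x - F x)\<^sup>2 \<le> (2 * real n)\<^sup>2" for m
    proof (rule AE_I2)
      fix x have "\<bar>g m x - F x\<bar> \<le> \<bar>2 * real n\<bar>" using g(2)[of m x] Fb[of x] by simp
      then show "(g m x - F x)\<^sup>2 \<le> (2 * real n)\<^sup>2" by (simp only: abs_le_square_iff)
    qed
  qed (use Fm g lim finite_measure_Omega in \<open>auto intro: continuous_measurable_Omega finite_measure.integrable_const\<close>)
  from order_tendstoD(2)[OF this, of "e/3"] e obtain m :: nat where
    m: "norm_L2\<Omega> (\<lambda>p. g m p - F p) < e/3"
    by (auto simp: eventually_sequentially)
  have "\<exists>h\<in>{f. trig_poly f}. \<forall>x\<in>Q. \<bar>g m x - h x\<bar> < e/3"
    using e g(1) continuous_on_subset[of UNIV "g m" Q]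
    by (intro function_ring_on.Stone_Weierstrass_basic[OF function_ring_trig_poly]) auto
  then obtain h where h: "trig_poly h" "\<And>x. x \<in> Q \<Longrightarrow> \<bar>g m x - h x\<bar> < e/3" by blast
  have L: "F \<in> L2\<Omega>" "g m \<in> L2\<Omega>" "h \<in> L2\<Omega>"
    using bounded_L2_Omega[OF Fm Fb] continuous_L2_Omega[OF g(1)] continuous_L2_Omega[OF trig_poly_continuous[OF h(1)]] by auto
  have gh: "norm_L2\<Omega> (\<lambda>p. g m p - h p) \<le> e/3"
    using L2_D(1)[OF L2_diff[OF L(2,3)]] h(2) Omega_sub_Q e
    by (intro L2_norm_bounded_Omega) (auto simp: subset_iff less_imp_le)
  have "norm_L2\<Omega> (\<lambda>p. f p - h p) \<le> norm_L2\<Omega> (\<lambda>p. f p - F p) + (norm_L2\<Omega> (\<lambda>p. F p - g m p) + norm_L2\<Omega> (\<lambda>p. g m p - h p))"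
    using L2_norm_triangle_diff[OF f L(1) L(3)] L2_norm_triangle_diff[OF L] by linarith
  also have "\<dots> < e"
    using n m gh L2_norm_minus_commute[of "lebesgue_on Omega" f F] L2_norm_minus_commute[of "lebesgue_on Omega" "g m" F]
    by linarith
  finally show ?thesis using h(1) that by blast
qed

lemma cos_proj_trig_poly:
  assumes "trig_poly h"
  shows "\<exists>K. \<forall>N\<ge>K. cos_proj N h = h"
  using assms
proof (induction rule: trig_poly.induct)
  case (trig_mode c i)
  have "coeff_cos (\<lambda>p. c * tensor cmode cmode i p) j = (if j = i then c else 0)" for j
    using orthosystem_D(2)[OF orthosystem_modes, of i j] by (auto simp: coeff_cos_def mult.assoc mode_norm)
  then have "cos_proj N (\<lambda>p. c * tensor cmode cmode i p) = (\<lambda>p. c * tensor cmode cmode i p)" if "i \<in> modes N" for N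
    unfolding cos_proj_def using that by (auto simp: if_distrib[of "\<lambda>x. x * _"] cong: if_cong)
  then show ?case by (intro exI[of _ "Suc (fst i + snd i)"]) (auto simp: modes_def mem_Times_iff)
next
  case (trig_add f g)
  then obtain K K' where K: "\<And>N. N \<ge> K \<Longrightarrow> cos_proj N f = f" "\<And>N. N \<ge> K' \<Longrightarrow> cos_proj N g = g" by blast
  have "cos_proj N (\<lambda>p. f p + g p) p = cos_proj N f p + cos_proj N g p" for N p
    unfolding cos_proj_def
    using coeff_cos_add[OF continuous_L2_Omega continuous_L2_Omega, OF trig_poly_continuous trig_poly_continuous, OF trig_add(1,2)]
    by (simp add: distrib_right sum.distrib)
  with K show ?case by (intro exI[of _ "max K K'"]) (auto simp: fun_eq_iff)
qed

text \<open>The projections eventually fix every trigonometric polynomial, and the remainder of a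
  projection never exceeds the norm of the function; apply this to \<open>f - h\<close> with
  \<open>h\<close> a close trigonometric polynomial.\<close>

theorem cos_proj_tendsto:
  assumes f: "f \<in> L2\<Omega>"
  shows "(\<lambda>N. norm_L2\<Omega> (\<lambda>p. f p - cos_proj N f p)) \<longlonglongrightarrow> 0"
proof (rule LIMSEQ_I)
  fix e :: real assume "e > 0"
  then obtain h where h: "trig_poly h" "norm_L2\<Omega> (\<lambda>p. f p - h p) < e" using trig_poly_dense[OF f] by blast
  have hL: "h \<in> L2\<Omega>" using h(1) by (intro continuous_L2_Omega trig_poly_continuous)
  obtain K where K: "\<And>N. N \<ge> K \<Longrightarrow> cos_proj N h = h" using cos_proj_trig_poly[OF h(1)] by blast
  have "norm (norm_L2\<Omega> (\<lambda>p. f p - cos_proj N f p) - 0) < e" if "N \<ge> K" for N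
  proof -
    have *: "cos_proj N (\<lambda>p. f p - h p) p = cos_proj N f p - cos_proj N h p" for p
      unfolding cos_proj_def using coeff_cos_diff[OF f hL] by (simp add: left_diff_distrib sum_subtractf)
    have "norm_L2\<Omega> (\<lambda>p. f p - cos_proj N f p) = norm_L2\<Omega> (\<lambda>p. (f p - h p) - cos_proj N (\<lambda>p. f p - h p) p)"
      unfolding * K[OF that] by simp
    also have "\<dots> \<le> norm_L2\<Omega> (\<lambda>p. f p - h p)" by (rule cos_proj_error_le[OF L2_diff[OF f hL]])
    finally show ?thesis using h(2) by simp
  qed
  then show "\<exists>no. \<forall>n\<ge>no. norm (norm_L2\<Omega> (\<lambda>p. f p - cos_proj n f p) - 0) < e" by blast
qed

lemma cos_coeffs_zero_AE:
  assumes f: "f \<in> L2\<Omega>" and "\<And>i. coeff_cos f i = 0"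
  shows "AE p in lebesgue_on Omega. f p = 0"
proof (rule L2_norm_eq_0_D[OF f])
  have "cos_proj N f = (\<lambda>_. 0)" for N by (simp add: cos_proj_def assms(2) fun_eq_iff)
  then show "norm_L2\<Omega> f = 0" using cos_proj_tendsto[OF f] LIMSEQ_const_iff[of "norm_L2\<Omega> f" 0] by simp
qed

text \<open>Guarantees a non-vanishing moment for a non-zero \<phi>. As \<phi> is only integrable,
  orthogonality methods do not apply: Weierstrass approximation passes from powers to continuous
  functions, and dominated convergence from these to the sign of \<open>f\<close>, which leaves the
  integral of \<open>\<bar>f t\<bar>\<close>.\<close>

lemma moments_zero_AE:
  assumes f: "integrable unit_time f" and mom: "\<And>k::nat. (LINT t|unit_time. t ^ k * f t) = 0"
  shows "AE t in unit_time. f t = 0"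
proof -
  have S: "{0<..<1::real} \<in> sets lebesgue" by simp
  have fm: "f \<in> borel_measurable unit_time" using f by simp
  have int: "integrable unit_time (\<lambda>t. c t * f t)" if "continuous_on UNIV c" for c :: "real \<Rightarrow> real"
  proof -
    have "bounded (c ` {0..1})"
      using that by (meson compact_Icc compact_continuous_image compact_imp_bounded continuous_on_subset top_greatest)
    then obtain B where "\<forall>y\<in>c ` {0..1}. norm y \<le> B" unfolding bounded_iff by blast
    then have B: "\<And>t. t \<in> {0..1} \<Longrightarrow> \<bar>c t\<bar> \<le> B" by auto
    show ?thesis
    proof (rule Bochner_Integration.integrable_bound[of _ "\<lambda>t. B * f t"])
      show "(\<lambda>t. c t * f t) \<in> borel_measurable unit_time"
      proof (intro borel_measurable_times fm)
        show "c \<in> borel_measurable unit_time"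
          using that by (intro continuous_imp_measurable_on_sets_lebesgue) (auto intro: continuous_on_subset)
      qed
      show "AE t in unit_time. norm (c t * f t) \<le> norm (B * f t)"
      proof (rule AE_I2)
        fix t assume "t \<in> space unit_time"
        then have "\<bar>c t\<bar> \<le> B" by (intro B) auto
        then show "norm (c t * f t) \<le> norm (B * f t)" by (simp add: abs_mult mult_right_mono)
      qed
    qed (use f in simp)
  qed
  have cont: "(LINT t|unit_time. c t * f t) = 0" if c: "continuous_on UNIV c" for c :: "real \<Rightarrow> real"
  proof -
    have small: "\<bar>LINT t|unit_time. c t * f t\<bar> \<le> e * (LINT t|unit_time. \<bar>f t\<bar>)" if e: "e > 0" for e
    proof -
      obtain g where g: "real_polynomial_function g" "\<And>t. t \<in> {0..1} \<Longrightarrow> \<bar>c t - g t\<bar> < e"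
        using Stone_Weierstrass_real_polynomial_function[of "{0..1}" c e] c e continuous_on_subset[of UNIV c "{0..1}"] by auto
      obtain a n where an: "g = (\<lambda>t. \<Sum>i\<le>n. a i * t ^ i)"
        using g(1) by (auto simp: real_polynomial_function_iff_sum)
      have gc: "continuous_on UNIV g" unfolding an by (intro continuous_intros)
      have "(LINT t|unit_time. g t * f t) = (LINT t|unit_time. (\<Sum>i\<le>n. a i * (t ^ i * f t)))"
        by (simp add: an sum_distrib_right mult.assoc)
      also have "\<dots> = (\<Sum>i\<le>n. a i * (LINT t|unit_time. t ^ i * f t))"
        using int[of "\<lambda>t. t ^ _"] by (simp add: continuous_intros)
      finally have "(LINT t|unit_time. c t * f t) = (LINT t|unit_time. (c t - g t) * f t)"
        using int[OF c] int[OF gc] mom by (simp add: left_diff_distrib)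
      also have "\<bar>\<dots>\<bar> \<le> (LINT t|unit_time. \<bar>(c t - g t) * f t\<bar>)"
        by (rule integral_abs_bound)
      also have "\<dots> \<le> (LINT t|unit_time. e * \<bar>f t\<bar>)"
      proof (rule integral_mono)
        show "integrable unit_time (\<lambda>t. \<bar>(c t - g t) * f t\<bar>)"
          using int[OF continuous_on_diff[OF c gc]] by simp
        show "integrable unit_time (\<lambda>t. e * \<bar>f t\<bar>)" using f by simp
        fix t :: real assume "t \<in> space unit_time"
        then show "\<bar>(c t - g t) * f t\<bar> \<le> e * \<bar>f t\<bar>"
          using g(2)[of t] by (simp add: abs_mult mult_right_mono)
      qed
      finally show ?thesis by simp
    qed
    show ?thesis
    proof (rule ccontr)
      assume ne: "(LINT t|unit_time. c t * f t) \<noteq> 0"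
      \<comment> \<open>With \<open>e\<close> equal to half the absolute value divided by
        \<open>A + 1\<close>, the bound \<open>small\<close> would make the absolute value at most
        its own half.\<close>
      define A where "A = (LINT t|unit_time. \<bar>f t\<bar>)"
      have A: "A \<ge> 0" by (simp add: A_def)
      show False
        using small[of "\<bar>LINT t|unit_time. c t * f t\<bar> / (2 * (A + 1))"] ne A
        unfolding A_def[symmetric] by (simp add: field_simps split: if_splits)
           (smt (verit) mult_nonneg_nonneg abs_ge_zero)
    qed
  qed
  have sm: "(\<lambda>t. sgn (f t)) \<in> borel_measurable unit_time" using fm by measurable
  have sb: "\<bar>sgn (f t)\<bar> \<le> 1" for t by (simp add: sgn_real_def)
  obtain g where g: "\<And>n. continuous_on UNIV (g n)" "\<And>n x. \<bar>g n x\<bar> \<le> (1::real)"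
    and lim: "AE x in unit_time. (\<lambda>n. g n x) \<longlonglongrightarrow> sgn (f x)"
    using bounded_ae_limit_continuous[OF S sm sb] by (metis zero_le_one)
  have "(\<lambda>n. LINT t|unit_time. g n t * f t) \<longlonglongrightarrow> (LINT t|unit_time. sgn (f t) * f t)"
  proof (rule integral_dominated_convergence[where w = "\<lambda>t. \<bar>f t\<bar>"])
    show "AE t in unit_time. (\<lambda>n. g n t * f t) \<longlonglongrightarrow> sgn (f t) * f t"
      using lim by (rule AE_mp) (auto intro!: AE_I2 tendsto_intros)
    show "AE t in unit_time. norm (g n t * f t) \<le> \<bar>f t\<bar>" for n
      using g(2)[of n] by (auto intro!: AE_I2 simp: abs_mult mult_left_le_one_le)
    show "(\<lambda>t. sgn (f t) * f t) \<in> borel_measurable unit_time" using fm sm by simp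
    show "(\<lambda>t. g n t * f t) \<in> borel_measurable unit_time" for n using int[OF g(1)] by blast
  qed (use f in simp)
  then have "(LINT t|unit_time. \<bar>f t\<bar>) = 0"
    using cont[OF g(1)] by (simp add: LIMSEQ_const_iff mult.commute[of "sgn _"] flip: abs_sgn)
  then have "AE t in unit_time. \<bar>f t\<bar> = 0"
    using integral_nonneg_eq_0_iff_AE[of unit_time "\<lambda>t. \<bar>f t\<bar>"] f by simp
  then show ?thesis by simp
qed

section \<open>Smooth functions and cutoffs\<close>

lemma pderiv_along_eq: "(f has_derivative D) (at p) \<Longrightarrow> pderiv_along v f p = D v"
  unfolding pderiv_along_def by (metis frechet_derivative_at)

lemma has_derivative_pderiv:
  assumes "f differentiable (at p)"
  shows "(f has_derivative (\<lambda>v. pderiv_along v f p)) (at p)"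
  using assms unfolding pderiv_along_def by (simp add: frechet_derivative_works[symmetric])

lemma Ck_differentiable: "Ck (Suc k) f \<Longrightarrow> f differentiable (at p)"
  unfolding Ck.simps by blast

lemma differentiable_continuous_UNIV: "(\<And>p. f differentiable (at p)) \<Longrightarrow> continuous_on UNIV f"
  by (simp add: differentiable_imp_continuous_within continuous_on_eq_continuous_within)

lemma Ck_mono: "Ck (Suc k) f \<Longrightarrow> Ck k f"
proof (induction k arbitrary: f)
  case 0
  then show ?case unfolding Ck.simps by (intro differentiable_continuous_UNIV) blast
next
  case (Suc k)
  then show ?case unfolding Ck.simps(2)[of "Suc k" f] Ck.simps(2)[of k f] by blast
qed

lemma pderiv_along_add:
  assumes "\<And>p. f differentiable (at p)" "\<And>p. g differentiable (at p)"
  shows "pderiv_along v (\<lambda>p. f p + g p) = (\<lambda>p. pderiv_along v f p + pderiv_along v g p)"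
  using has_derivative_add[OF has_derivative_pderiv has_derivative_pderiv, OF assms]
  by (intro ext pderiv_along_eq)

lemma pderiv_along_mult:
  assumes "\<And>p. f differentiable (at p)" "\<And>p. g differentiable (at p)"
  shows "pderiv_along v (\<lambda>p. f p * g p) = (\<lambda>p. f p * pderiv_along v g p + pderiv_along v f p * g p)"
  using has_derivative_mult[OF has_derivative_pderiv has_derivative_pderiv, OF assms]
  by (intro ext pderiv_along_eq)

lemma Ck_add: "Ck k f \<Longrightarrow> Ck k g \<Longrightarrow> Ck k (\<lambda>p. f p + g p)"
proof (induction k arbitrary: f g)
  case (Suc k)
  then show ?case using pderiv_along_add[of f g] by (simp add: differentiable_add del: split_paired_All)
qed (auto intro: continuous_intros)

lemma Ck_mult: "Ck k f \<Longrightarrow> Ck k g \<Longrightarrow> Ck k (\<lambda>p. f p * g p)"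
proof (induction k arbitrary: f g)
  case (Suc k)
  then have "Ck k f" "Ck k g" using Ck_mono by blast+
  with Suc show ?case using pderiv_along_mult[of f g]
    by (simp add: differentiable_mult Ck_add del: split_paired_All)
qed (auto intro: continuous_intros)

lemma smooth_add: "smooth f \<Longrightarrow> smooth g \<Longrightarrow> smooth (\<lambda>p. f p + g p)"
  by (simp add: smooth_def Ck_add)

lemma smooth_mult: "smooth f \<Longrightarrow> smooth g \<Longrightarrow> smooth (\<lambda>p. f p * g p)"
  by (simp add: smooth_def Ck_mult)

lemma smooth_differentiable: "smooth f \<Longrightarrow> f differentiable (at p)"
  unfolding smooth_def using Ck_differentiable by blast

lemma smooth_continuous: "smooth f \<Longrightarrow> continuous_on UNIV f"
  by (intro differentiable_continuous_UNIV smooth_differentiable)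

lemma smooth_pderiv: "smooth f \<Longrightarrow> v \<in> {ex, ey} \<Longrightarrow> smooth (pderiv_along v f)"
  unfolding smooth_def by (metis Ck.simps(2) insert_iff empty_iff)

lemma smooth_continuous_pderiv: "smooth f \<Longrightarrow> v \<in> {ex, ey} \<Longrightarrow> continuous_on UNIV (pderiv_along v f)"
  by (intro smooth_continuous smooth_pderiv)

lemma pderiv_along_const: "pderiv_along v (\<lambda>p. c) = (\<lambda>p. 0)"
  by (intro ext pderiv_along_eq) (auto intro: derivative_intros)

lemma smooth_const: "smooth (\<lambda>p. c)"
proof -
  have "Ck k (\<lambda>p. c)" for k c by (induction k arbitrary: c) (auto simp: pderiv_along_const)
  then show ?thesis by (simp add: smooth_def)
qed

text \<open>An explicit sequence of derivatives makes closure under affine substitution a formula,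
  and lets \<open>Ck\<close> be proved by one induction for all members of the sequence
  simultaneously.\<close>

definition smooth1 :: "(real \<Rightarrow> real) \<Rightarrow> bool" where
  "smooth1 h \<longleftrightarrow> (\<exists>D. D 0 = h \<and> (\<forall>k x. (D k has_real_derivative D (Suc k) x) (at x)))"

lemma has_derivative_fst':
  assumes "(h has_real_derivative d) (at (fst p))"
  shows "((\<lambda>p. h (fst p)) has_derivative (\<lambda>v. d * fst v)) (at p)"
  using assms
  by (intro has_derivative_compose[of fst fst _ _ h "\<lambda>x. d * x", simplified])
     (auto intro!: derivative_eq_intros simp: has_field_derivative_def)

lemma has_derivative_snd':
  assumes "(h has_real_derivative d) (at (snd p))"
  shows "((\<lambda>p. h (snd p)) has_derivative (\<lambda>v. d * snd v)) (at p)"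
  using assms
  by (intro has_derivative_compose[of snd snd _ _ h "\<lambda>x. d * x", simplified])
     (auto intro!: derivative_eq_intros simp: has_field_derivative_def)

lemma pderiv_along_fst:
  assumes "\<And>x. (h has_real_derivative h' x) (at x)"
  shows "pderiv_along v (\<lambda>p. h (fst p)) = (\<lambda>p. h' (fst p) * fst v)"
  by (intro ext pderiv_along_eq has_derivative_fst' assms)

lemma pderiv_along_snd:
  assumes "\<And>x. (h has_real_derivative h' x) (at x)"
  shows "pderiv_along v (\<lambda>p. h (snd p)) = (\<lambda>p. h' (snd p) * snd v)"
  by (intro ext pderiv_along_eq has_derivative_snd' assms)

lemma smooth_fst:
  assumes "smooth1 h"
  shows "smooth (\<lambda>p. h (fst p))"
proof -
  obtain D where D: "D 0 = h" "\<And>k x. (D k has_real_derivative D (Suc k) x) (at x)"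
    using assms by (auto simp: smooth1_def)
  have "Ck k (\<lambda>p. D j (fst p))" for k j
  proof (induction k arbitrary: j)
    case 0
    have "continuous_on UNIV (D j)" using D(2) DERIV_continuous_on by blast
    then show ?case by (auto intro!: continuous_on_compose2[of UNIV "D j"] continuous_intros)
  next
    case (Suc k)
    have "\<forall>p. (\<lambda>p. D j (fst p)) differentiable (at p)"
      using has_derivative_fst'[OF D(2)] differentiableI by blast
    then show ?case
      unfolding Ck.simps pderiv_along_fst[OF D(2)] using Suc smooth_const[of 0] by (simp add: smooth_def del: split_paired_All)
  qed
  then show ?thesis using D(1) by (auto simp: smooth_def)
qed

lemma smooth_snd:
  assumes "smooth1 h"
  shows "smooth (\<lambda>p. h (snd p))"
proof -
  obtain D where D: "D 0 = h" "\<And>k x. (D k has_real_derivative D (Suc k) x) (at x)"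
    using assms by (auto simp: smooth1_def)
  have "Ck k (\<lambda>p. D j (snd p))" for k j
  proof (induction k arbitrary: j)
    case 0
    have "continuous_on UNIV (D j)" using D(2) DERIV_continuous_on by blast
    then show ?case by (auto intro!: continuous_on_compose2[of UNIV "D j"] continuous_intros)
  next
    case (Suc k)
    have "\<forall>p. (\<lambda>p. D j (snd p)) differentiable (at p)"
      using has_derivative_snd'[OF D(2)] differentiableI by blast
    then show ?case
      unfolding Ck.simps pderiv_along_snd[OF D(2)] using Suc smooth_const[of 0] by (simp add: smooth_def del: split_paired_All)
  qed
  then show ?thesis using D(1) by (auto simp: smooth_def)
qed

lemma smooth1_affine:
  assumes "smooth1 h"
  shows "smooth1 (\<lambda>x. h (a * x + b))"
proof -
  obtain D where D: "D 0 = h" "\<And>k x. (D k has_real_derivative D (Suc k) x) (at x)"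
    using assms by (auto simp: smooth1_def)
  have "((\<lambda>x. a ^ k * D k (a * x + b)) has_real_derivative a ^ Suc k * D (Suc k) (a * x + b)) (at x)" for k x
    by (rule derivative_eq_intros DERIV_chain2[OF D(2)] refl | simp)+
  then show ?thesis
    unfolding smooth1_def by (intro exI[of _ "\<lambda>k x. a ^ k * D k (a * x + b)"]) (auto simp: D(1))
qed

lemma smooth1_cmult:
  assumes "smooth1 h"
  shows "smooth1 (\<lambda>x. c * h x)"
proof -
  obtain D where D: "D 0 = h" "\<And>k x. (D k has_real_derivative D (Suc k) x) (at x)"
    using assms by (auto simp: smooth1_def)
  show ?thesis unfolding smooth1_def
    by (intro exI[of _ "\<lambda>k x. c * D k x"]) (auto simp: D(1) intro: DERIV_cmult D(2))
qed

lemma smooth1_id: "smooth1 (\<lambda>x. x)"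
  unfolding smooth1_def
  by (intro exI[of _ "\<lambda>k. if k = 0 then (\<lambda>x. x) else if k = 1 then (\<lambda>x. 1) else (\<lambda>x. 0)"])
     (auto intro!: derivative_eq_intros)

lemma smooth1_cos: "smooth1 cos"
proof -
  have "((\<lambda>x. cos (x + real k * pi / 2)) has_real_derivative cos (x + real (Suc k) * pi / 2)) (at x)" for k x
  proof -
    have "cos (x + real (Suc k) * pi / 2) = - sin (x + real k * pi / 2)"
      using cos_add[of "x + real k * pi / 2" "pi / 2"] by (simp add: algebra_simps add_divide_distrib)
    then show ?thesis by (auto intro!: derivative_eq_intros)
  qed
  then show ?thesis unfolding smooth1_def
    by (intro exI[of _ "\<lambda>k x. cos (x + real k * pi / 2)"]) auto
qed

lemma smooth1_cmode: "smooth1 (cmode k)"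
  unfolding cmode_def using smooth1_cmult[OF smooth1_affine[OF smooth1_cos, of "real k * pi" 0]] by simp

lemma smooth1_smode: "smooth1 (smode k)"
proof -
  have "smode k = (\<lambda>x. sqrt 2 * cos ((real k * pi) * x + (- (pi / 2))))"
    by (simp add: smode_def cos_diff fun_eq_iff)
  then show ?thesis
    using smooth1_cmult[OF smooth1_affine[OF smooth1_cos, of "real k * pi" "- (pi / 2)"], of "sqrt 2"] by simp
qed

lemma smooth_tensor:
  assumes "\<And>k. smooth1 (a k)" "\<And>k. smooth1 (b k)"
  shows "smooth (tensor a b i)"
  unfolding tensor_def by (intro smooth_mult smooth_fst smooth_snd assms)

section \<open>The flat function exp(-1/x) and cutoffs of the square\<close>

definition flat :: "real \<Rightarrow> real" where
  "flat x = (if x > 0 then exp (- (1 / x)) else 0)"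

definition flat' :: "real \<Rightarrow> real" where
  "flat' x = (if x > 0 then (1 / x)\<^sup>2 * exp (- (1 / x)) else 0)"

lemma poly_exp_tendsto_0: "((\<lambda>t. poly q t * exp (- t)) \<longlongrightarrow> (0::real)) at_top"
proof (induction q)
  case (pCons a q)
  have "((\<lambda>t::real. poly q t * t * exp (- t)) \<longlongrightarrow> 0) at_top"
  proof -
    have "((\<lambda>t::real. \<Sum>i\<le>degree q. coeff q i * (t ^ i * t * exp (- t))) \<longlongrightarrow> (\<Sum>i\<le>degree q. coeff q i * 0)) at_top"
    proof (intro tendsto_sum tendsto_mult tendsto_const)
      fix i
      have "((\<lambda>t::real. t ^ Suc i / exp t) \<longlongrightarrow> 0) at_top" by (rule tendsto_power_div_exp_0)
      then show "((\<lambda>t::real. t ^ i * t * exp (- t)) \<longlongrightarrow> 0) at_top"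
        by (simp add: exp_minus field_simps)
    qed
    then show ?thesis by (simp add: poly_altdef sum_distrib_right sum_distrib_left mult_ac)
  qed
  moreover have "((\<lambda>t::real. a * exp (- t)) \<longlongrightarrow> 0) at_top" by real_asymp
  ultimately have "((\<lambda>t::real. a * exp (- t) + poly q t * t * exp (- t)) \<longlongrightarrow> 0 + 0) at_top"
    by (intro tendsto_add)
  then show ?case by (simp add: algebra_simps)
qed simp

text \<open>The class of functions q(1/x) exp(-1/x) is closed under differentiation, which acts on
  the polynomial as q \<mapsto> X^2 (q - q'). This yields all derivatives of \<open>flat\<close> at
  once.\<close>

definition flat_poly :: "real poly \<Rightarrow> real \<Rightarrow> real" where
  "flat_poly q x = (if x > 0 then poly q (1 / x) * exp (- (1 / x)) else 0)"

lemma flat_poly_derivative: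
  "(flat_poly q has_real_derivative flat_poly ([:0, 0, 1:] * (q - pderiv q)) x) (at x)"
proof -
  consider "x > 0" | "x = 0" | "x < 0" by linarith
  then show ?thesis
  proof cases
    case 1
    have "((\<lambda>x. poly q (1 / x) * exp (- (1 / x))) has_real_derivative
       poly ([:0, 0, 1:] * (q - pderiv q)) (1 / x) * exp (- (1 / x))) (at x)"
      using 1 by (auto intro!: derivative_eq_intros DERIV_chain2[OF poly_DERIV] simp: field_simps power2_eq_square)
    then have "(flat_poly q has_real_derivative
       poly ([:0, 0, 1:] * (q - pderiv q)) (1 / x) * exp (- (1 / x))) (at x)"
    proof (rule has_field_derivative_transform_within_open)
      show "open {0::real<..}" by simp
    qed (use 1 in \<open>auto simp: flat_poly_def\<close>)
    then show ?thesis using 1 by (simp add: flat_poly_def)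
  next
    case 2
    have "((\<lambda>h. flat_poly q h / h) \<longlongrightarrow> 0) (at_right 0)"
    proof -
      \<comment> \<open>The difference quotient at 0 has the same shape with X q in place of q, and
        1/h tends to infinity.\<close>
      have "((\<lambda>h::real. poly ([:0, 1:] * q) (1 / h) * exp (- (1 / h))) \<longlongrightarrow> 0) (at_right 0)"
      proof (rule filterlim_compose[OF poly_exp_tendsto_0])
        show "filterlim (\<lambda>h::real. 1 / h) at_top (at_right 0)" by real_asymp
      qed
      then show ?thesis
        by (rule Lim_transform_eventually) (auto simp: eventually_at_right_less flat_poly_def eventually_at_filter)
    qed
    moreover have "((\<lambda>h. flat_poly q h / h) \<longlongrightarrow> 0) (at_left 0)"
      by (rule tendsto_eventually) (auto simp: flat_poly_def eventually_at_filter)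
    ultimately have "((\<lambda>h. flat_poly q h / h) \<longlongrightarrow> 0) (at 0)"
      by (simp add: filterlim_split_at)
    then show ?thesis using 2 by (simp add: DERIV_def flat_poly_def)
  next
    case 3
    have "((\<lambda>x. 0) has_real_derivative 0) (at x)" by simp
    then have "(flat_poly q has_real_derivative 0) (at x)"
    proof (rule has_field_derivative_transform_within_open)
      show "open {..<0::real}" by simp
    qed (use 3 in \<open>auto simp: flat_poly_def\<close>)
    then show ?thesis using 3 by (simp add: flat_poly_def)
  qed
qed

lemma flat_derivative: "(flat has_real_derivative flat' x) (at x)"
proof -
  have "flat = flat_poly 1" "flat' = flat_poly ([:0, 0, 1:] * (1 - pderiv 1))"
    by (auto simp: flat_def flat'_def flat_poly_def fun_eq_iff power2_eq_square)
  then show ?thesis using flat_poly_derivative[of 1 x] by metis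
qed

lemma smooth1_flat: "smooth1 flat"
proof -
  define q where "q k = ((\<lambda>q. [:0, 0, 1:] * (q - pderiv q)) ^^ k) (1 :: real poly)" for k
  show ?thesis unfolding smooth1_def
  proof (intro exI[of _ "\<lambda>k. flat_poly (q k)"] conjI allI)
    show "flat_poly (q 0) = flat" by (auto simp: q_def flat_def flat_poly_def fun_eq_iff)
    show "(flat_poly (q k) has_real_derivative flat_poly (q (Suc k)) x) (at x)" for k x
      using flat_poly_derivative[of "q k" x] by (simp add: q_def)
  qed
qed

lemma flat_bounds: "0 \<le> flat x" "flat x \<le> 1"
  by (auto simp: flat_def)

lemma flat'_nonneg: "0 \<le> flat' x"
  by (auto simp: flat'_def)

lemma flat_scaled_tendsto:
  assumes "x > 0"
  shows "(\<lambda>m. flat (real m * x - 1)) \<longlonglongrightarrow> 1" "(\<lambda>m. real m * flat' (real m * x - 1)) \<longlonglongrightarrow> 0"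
proof -
  have ev: "eventually (\<lambda>m. real m * x - 1 > 0) sequentially"
    using assms by real_asymp
  have "(\<lambda>m. exp (- (1 / (real m * x - 1)))) \<longlonglongrightarrow> 1" using assms by real_asymp
  then show "(\<lambda>m. flat (real m * x - 1)) \<longlonglongrightarrow> 1"
    by (rule Lim_transform_eventually) (use ev in \<open>auto elim!: eventually_mono simp: flat_def\<close>)
  have "(\<lambda>m. real m * ((1 / (real m * x - 1))\<^sup>2 * exp (- (1 / (real m * x - 1))))) \<longlonglongrightarrow> 0" using assms by real_asymp
  then show "(\<lambda>m. real m * flat' (real m * x - 1)) \<longlonglongrightarrow> 0"
    by (rule Lim_transform_eventually) (use ev in \<open>auto elim!: eventually_mono simp: flat'_def\<close>)
qed

text \<open>The weight \<open>x\<close> compensates the slope \<open>m\<close> of the rescaled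
  function uniformly in \<open>m\<close>: with t = 1/(m x - 1) the product equals (t + t^2)
  exp(-t).\<close>

lemma flat'_scaled_bound:
  assumes "x \<ge> 0"
  shows "x * (real m * flat' (real m * x - 1)) \<le> 3"
proof (cases "real m * x - 1 > 0")
  case True
  define t where "t = 1 / (real m * x - 1)"
  have t: "t > 0" "real m * x = 1 + 1 / t" using True by (simp_all add: t_def)
  have "1 + t + t\<^sup>2 / 2 \<le> exp t" using exp_lower_Taylor_quadratic[of t] t by simp
  then have "t + t\<^sup>2 \<le> 3 * exp t" using t(1) exp_ge_zero[of t] by linarith
  then have "(t + t\<^sup>2) * exp (- t) \<le> 3" by (simp add: exp_minus field_simps)
  moreover have "x * (real m * flat' (real m * x - 1)) = (t + t\<^sup>2) * exp (- t)"
  proof -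
    have "x * (real m * flat' (real m * x - 1)) = (real m * x) * (t\<^sup>2 * exp (- t))"
      using True by (simp add: flat'_def t_def)
    also have "\<dots> = ((1 + 1 / t) * t\<^sup>2) * exp (- t)" unfolding t(2) by (simp only: mult.assoc)
    also have "(1 + 1 / t) * t\<^sup>2 = t + t\<^sup>2" using t(1) by (simp add: distrib_right power2_eq_square)
    finally show ?thesis .
  qed
  ultimately show ?thesis by simp
next
  case False
  then have "flat' (real m * x - 1) = 0" unfolding flat'_def by (rule if_not_P)
  then show ?thesis by simp
qed

text \<open>There is no plateau with value 1. Pointwise convergence to 1, with derivatives
  converging pointwise to 0, is what dominated convergence asks for.\<close>

definition cutoff1 :: "nat \<Rightarrow> real \<Rightarrow> real" where
  "cutoff1 m x = flat (real m * x - 1) * flat (real m * (1 - x) - 1)"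

definition cutoff1' :: "nat \<Rightarrow> real \<Rightarrow> real" where
  "cutoff1' m x = real m * flat' (real m * x - 1) * flat (real m * (1 - x) - 1)
     - flat (real m * x - 1) * (real m * flat' (real m * (1 - x) - 1))"

lemma cutoff1_derivative: "(cutoff1 m has_real_derivative cutoff1' m x) (at x)"
  unfolding cutoff1_def cutoff1'_def
  by (rule derivative_eq_intros DERIV_chain2[OF flat_derivative] refl | simp)+

lemma cutoff1_bounds: "0 \<le> cutoff1 m x" "cutoff1 m x \<le> 1"
  using flat_bounds by (auto simp: cutoff1_def mult_le_one)

lemma cutoff1_tendsto:
  assumes "0 < x" "x < 1"
  shows "(\<lambda>m. cutoff1 m x) \<longlonglongrightarrow> 1" "(\<lambda>m. cutoff1' m x) \<longlonglongrightarrow> 0"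
proof -
  note a = flat_scaled_tendsto[OF assms(1)] and b = flat_scaled_tendsto[of "1 - x"]
  show "(\<lambda>m. cutoff1 m x) \<longlonglongrightarrow> 1"
    using tendsto_mult[OF a(1) b(1)] assms by (simp add: cutoff1_def)
  show "(\<lambda>m. cutoff1' m x) \<longlonglongrightarrow> 0"
    using tendsto_diff[OF tendsto_mult[OF a(2) b(1)] tendsto_mult[OF a(1) b(2)]] assms by (simp add: cutoff1'_def)
qed

text \<open>The derivative of the cutoff is unbounded in \<open>m\<close>, but multiplied by a
  quantity that vanishes linearly at both ends it is not: each end contributes at most
  \<open>3 * C\<close>. This is the domination that lets a cutoff be removed under a
  derivative.\<close>

lemma cutoff1'_bound:
  assumes x: "0 < x" "x < 1" and s: "\<bar>s\<bar> \<le> C * x" "\<bar>s\<bar> \<le> C * (1 - x)" and C: "0 \<le> C"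
  shows "\<bar>cutoff1' m x * s\<bar> \<le> 6 * C"
proof -
  have key: "\<bar>real m * flat' (real m * y - 1) * r * s\<bar> \<le> 3 * C"
    if "0 \<le> r" "r \<le> 1" "y > 0" "\<bar>s\<bar> \<le> C * y" for y r
  proof -
    have "\<bar>real m * flat' (real m * y - 1) * r * s\<bar> = (real m * flat' (real m * y - 1)) * (r * \<bar>s\<bar>)"
      using that flat'_nonneg by (simp add: abs_mult)
    also have "\<dots> \<le> (real m * flat' (real m * y - 1)) * (1 * (C * y))"
      using that C flat'_nonneg by (intro mult_left_mono mult_mono) auto
    also have "\<dots> = C * (y * (real m * flat' (real m * y - 1)))" by simp
    also have "\<dots> \<le> C * 3" using flat'_scaled_bound[of y m] that C by (intro mult_left_mono) auto
    finally show ?thesis by simp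
  qed
  have "cutoff1' m x * s = real m * flat' (real m * x - 1) * flat (real m * (1 - x) - 1) * s
     - real m * flat' (real m * (1 - x) - 1) * flat (real m * x - 1) * s"
    by (simp add: cutoff1'_def algebra_simps)
  then show ?thesis
    using key[of "flat (real m * (1 - x) - 1)" x] key[of "flat (real m * x - 1)" "1 - x"] flat_bounds x s by fastforce
qed

lemma cutoff1_support:
  assumes "cutoff1 m x \<noteq> 0"
  shows "m \<noteq> 0 \<and> 1 / real m \<le> x \<and> x \<le> 1 - 1 / real m"
proof -
  have *: "real m * x - 1 > 0" "real m * (1 - x) - 1 > 0"
    using assms by (auto simp: cutoff1_def flat_def split: if_splits)
  then have "m \<noteq> 0" by (intro notI) auto
  with * show ?thesis by (auto simp: field_simps)
qed

definition cutoff :: "nat \<Rightarrow> real \<times> real \<Rightarrow> real" where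
  "cutoff m p = cutoff1 m (fst p) * cutoff1 m (snd p)"

lemma smooth_cutoff1: "smooth (\<lambda>p. cutoff1 m (fst p))" "smooth (\<lambda>p. cutoff1 m (snd p))"
proof -
  have 1: "smooth1 (\<lambda>x. flat (real m * x - 1))" "smooth1 (\<lambda>x. flat (real m * (1 - x) - 1))"
    using smooth1_affine[OF smooth1_flat, of "real m" "-1"] smooth1_affine[OF smooth1_flat, of "- real m" "real m - 1"]
    by (simp_all add: algebra_simps)
  show "smooth (\<lambda>p. cutoff1 m (fst p))" unfolding cutoff1_def by (intro smooth_mult smooth_fst[OF 1(1)] smooth_fst[OF 1(2)])
  show "smooth (\<lambda>p. cutoff1 m (snd p))" unfolding cutoff1_def by (intro smooth_mult smooth_snd[OF 1(1)] smooth_snd[OF 1(2)])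
qed

lemma smooth_cut: "smooth (cutoff m)"
  unfolding cutoff_def by (intro smooth_mult smooth_cutoff1)

lemma cutoff_bounds: "0 \<le> cutoff m p" "cutoff m p \<le> 1"
  using cutoff1_bounds by (auto simp: cutoff_def mult_le_one)

lemma cutoff_tendsto: "p \<in> Omega \<Longrightarrow> (\<lambda>m. cutoff m p) \<longlonglongrightarrow> 1"
  using tendsto_mult[OF cutoff1_tendsto(1)[of "fst p"] cutoff1_tendsto(1)[of "snd p"]]
  by (auto simp: cutoff_def Omega_def)

lemma test_function_cut:
  assumes "smooth \<psi>"
  shows "test_function (\<lambda>p. cutoff m p * \<psi> p)"
proof -
  let ?K = "{1 / real m..1 - 1 / real m} \<times> {1 / real m..1 - 1 / real m}"
  have K: "closed ?K" "compact ?K" by (auto intro: closed_Times compact_Times)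
  have "closure {p. cutoff m p * \<psi> p \<noteq> 0} \<subseteq> ?K \<inter> Omega"
  \<comment> \<open>For \<open>m = 0\<close> the convention 1/0 = 0 turns \<open>?K\<close> into the
    closed unit square, which does not lie in \<open>Omega\<close>; there the cutoff vanishes
    identically.\<close>
  proof (cases "m = 0")
    case True
    then have "{p. cutoff m p * \<psi> p \<noteq> 0} = {}" using cutoff1_support[of m] by (auto simp: cutoff_def)
    then show ?thesis by (simp only:) simp
  next
    case False
    have "{p. cutoff m p * \<psi> p \<noteq> 0} \<subseteq> ?K" using cutoff1_support[of m] by (auto simp: cutoff_def)
    then have "closure {p. cutoff m p * \<psi> p \<noteq> 0} \<subseteq> ?K" using K by (simp add: closure_minimal)
    moreover have "?K \<subseteq> Omega"
    proof -
      have "{a..1 - a} \<times> {a..1 - a} \<subseteq> Omega" if "0 < a" for a :: real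
        using that by (auto simp: Omega_def)
      then show ?thesis using False by simp
    qed
    ultimately show ?thesis by blast
  qed
  moreover have "compact (closure {p. cutoff m p * \<psi> p \<noteq> 0})"
    using calculation K by (meson closed_closure compact_closure bounded_subset compact_imp_bounded le_infE closure_subset order_trans)
  ultimately show ?thesis
    unfolding test_function_def by (auto intro: smooth_mult smooth_cut assms)
qed

lemma test_function_outside: "test_function \<psi> \<Longrightarrow> p \<notin> Omega \<Longrightarrow> \<psi> p = 0"
  unfolding test_function_def using closure_subset[of "{p. \<psi> p \<noteq> 0}"] by blast

text \<open>Bundles a direction, its coordinate function and the two sides orthogonal to it, so that
  every integration by parts is proved once for both directions.\<close>

inductive opposite_sides :: "real \<times> real \<Rightarrow> (real \<times> real \<Rightarrow> real) \<Rightarrow> (real \<Rightarrow> real \<times> real) \<Rightarrow> (real \<Rightarrow> real \<times> real) \<Rightarrow> bool" where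
  "opposite_sides ex fst (\<lambda>y. (0, y)) (\<lambda>y. (1, y))"
| "opposite_sides ey snd (\<lambda>x. (x, 0)) (\<lambda>x. (x, 1))"

lemma opposite_sides_dir: "opposite_sides v c \<gamma>0 \<gamma>1 \<Longrightarrow> v \<in> {ex, ey}"
  by (auto elim: opposite_sides.cases)

lemma opposite_sides_Omega: "opposite_sides v c \<gamma>0 \<gamma>1 \<Longrightarrow> p \<in> Omega \<Longrightarrow> 0 < c p \<and> c p < 1"
  by (auto elim!: opposite_sides.cases simp: Omega_def)

lemma opposite_sides_boundary:
  "opposite_sides v c \<gamma>0 \<gamma>1 \<Longrightarrow> \<gamma>0 s \<notin> Omega \<and> \<gamma>1 s \<notin> Omega \<and> c (\<gamma>0 s) = 0 \<and> c (\<gamma>1 s) = 1"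
  by (auto elim!: opposite_sides.cases simp: Omega_def)

lemma opposite_sides_continuous:
  "opposite_sides v c \<gamma>0 \<gamma>1 \<Longrightarrow> continuous_on UNIV \<gamma>0 \<and> continuous_on UNIV \<gamma>1"
  by (auto elim!: opposite_sides.cases intro!: continuous_intros)

lemma pderiv_cut_bound:
  assumes "opposite_sides v c \<gamma>0 \<gamma>1"
  shows "\<bar>pderiv_along v (cutoff m) p\<bar> \<le> \<bar>cutoff1' m (c p)\<bar>"
    and "p \<in> Omega \<Longrightarrow> (\<lambda>m. pderiv_along v (cutoff m) p) \<longlonglongrightarrow> 0"
proof -
  have d: "pderiv_along v (cutoff m) p = cutoff1 m (fst p) * (cutoff1' m (snd p) * snd v) + cutoff1' m (fst p) * fst v * cutoff1 m (snd p)" for m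
    unfolding cutoff_def[abs_def]
    using pderiv_along_mult[OF smooth_differentiable smooth_differentiable, OF smooth_cutoff1]
    by (simp add: pderiv_along_fst[OF cutoff1_derivative] pderiv_along_snd[OF cutoff1_derivative])
  have *: "\<bar>pderiv_along v (cutoff m) p\<bar> \<le> \<bar>cutoff1' m (c p)\<bar>" for m
    using assms cutoff1_bounds[of m] d[of m]
    by cases (auto simp: abs_mult intro: mult_left_le mult_left_le_one_le)
  show "\<bar>pderiv_along v (cutoff m) p\<bar> \<le> \<bar>cutoff1' m (c p)\<bar>" by (rule *)
  assume p: "p \<in> Omega"
  have "(\<lambda>m. cutoff1' m (c p)) \<longlonglongrightarrow> 0" using cutoff1_tendsto(2) opposite_sides_Omega[OF assms p] by blast
  then have "(\<lambda>m. \<bar>cutoff1' m (c p)\<bar>) \<longlonglongrightarrow> 0" by (simp add: tendsto_rabs_zero_iff)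
  then show "(\<lambda>m. pderiv_along v (cutoff m) p) \<longlonglongrightarrow> 0"
    by (rule Lim_null_comparison[rotated]) (use * in auto)
qed

section \<open>Weak derivatives and integration by parts\<close>

lemma has_vector_derivative_pderiv:
  assumes "f differentiable (at (x, y))"
  shows "((\<lambda>x. f (x, y)) has_vector_derivative pderiv_along ex f (x, y)) (at x within S)"
    and "((\<lambda>y. f (x, y)) has_vector_derivative pderiv_along ey f (x, y)) (at y within T)"
proof -
  let ?D = "\<lambda>v. pderiv_along v f (x, y)"
  have D: "(f has_derivative ?D) (at (x, y))" by (rule has_derivative_pderiv[OF assms])
  have lin: "?D (c *\<^sub>R v) = c * ?D v" for c v
    using linear_cmul[OF has_derivative_linear[OF D]] by simp
  have eq_ex: "(\<lambda>h. ?D (h, 0)) = (\<lambda>h. h *\<^sub>R ?D ex)"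
  proof (rule ext)
    fix h :: real
    have "h *\<^sub>R ex = (h, 0)" by simp
    from this[symmetric] show "?D (h, 0) = h *\<^sub>R ?D ex"
      by (rule ssubst) (rule trans[OF lin real_scaleR_def[symmetric]])
  qed
  have eq_ey: "(\<lambda>h. ?D (0, h)) = (\<lambda>h. h *\<^sub>R ?D ey)"
  proof (rule ext)
    fix h :: real
    have "h *\<^sub>R ey = (0, h)" by simp
    from this[symmetric] show "?D (0, h) = h *\<^sub>R ?D ey"
      by (rule ssubst) (rule trans[OF lin real_scaleR_def[symmetric]])
  qed
  have "((\<lambda>x. f (x, y)) has_derivative (\<lambda>h. ?D (h, 0))) (at x within S)"
    by (rule has_derivative_compose[where f = "\<lambda>x. (x, y)" and f' = "\<lambda>h. (h, 0)", OF _ D]) (auto intro!: derivative_eq_intros)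
  then show "((\<lambda>x. f (x, y)) has_vector_derivative pderiv_along ex f (x, y)) (at x within S)"
    unfolding has_vector_derivative_def eq_ex[symmetric] .
  have "((\<lambda>y. f (x, y)) has_derivative (\<lambda>h. ?D (0, h))) (at y within T)"
    by (rule has_derivative_compose[where f = "\<lambda>y. (x, y)" and f' = "\<lambda>h. (0, h)", OF _ D]) (auto intro!: derivative_eq_intros)
  then show "((\<lambda>y. f (x, y)) has_vector_derivative pderiv_along ey f (x, y)) (at y within T)"
    unfolding has_vector_derivative_def eq_ey[symmetric] .
qed

lemma integral_pderiv:
  assumes s: "opposite_sides v c \<gamma>0 \<gamma>1" and f: "smooth f"
  shows "(LINT p|lebesgue_on Omega. pderiv_along v f p) = integral {0..1} (\<lambda>s. f (\<gamma>1 s) - f (\<gamma>0 s))"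
  using s
proof cases
  case 1
  have "integral {0..1} (\<lambda>x. pderiv_along ex f (x, y)) = f (1, y) - f (0, y)" for y
    using has_vector_derivative_pderiv(1)[OF smooth_differentiable[OF f]]
    by (intro integral_unique fundamental_theorem_of_calculus) auto
  then show ?thesis
    using 1 integral_Omega_eq(2)[OF smooth_continuous_pderiv[OF f, of ex]] by simp
next
  case 2
  have "integral {0..1} (\<lambda>y. pderiv_along ey f (x, y)) = f (x, 1) - f (x, 0)" for x
    using has_vector_derivative_pderiv(2)[OF smooth_differentiable[OF f]]
    by (intro integral_unique fundamental_theorem_of_calculus) auto
  then show ?thesis
    using 2 integral_Omega_eq(1)[OF smooth_continuous_pderiv[OF f, of ey]] by simp
qed

lemma smooth_integration_by_parts:
  assumes s: "opposite_sides v c \<gamma>0 \<gamma>1" and f: "smooth f" and g: "smooth g"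
  shows "(LINT p|lebesgue_on Omega. pderiv_along v f p * g p) =
    integral {0..1} (\<lambda>s. f (\<gamma>1 s) * g (\<gamma>1 s) - f (\<gamma>0 s) * g (\<gamma>0 s))
      - (LINT p|lebesgue_on Omega. f p * pderiv_along v g p)"
proof -
  have "integrable (lebesgue_on Omega) (\<lambda>p. pderiv_along v f p * g p)"
    "integrable (lebesgue_on Omega) (\<lambda>p. f p * pderiv_along v g p)"
    using smooth_continuous[OF f] smooth_continuous[OF g] smooth_continuous_pderiv[OF f] smooth_continuous_pderiv[OF g] opposite_sides_dir[OF s]
    by (auto intro!: L2_Omega_integrable continuous_L2_Omega continuous_intros)
  then have "(LINT p|lebesgue_on Omega. pderiv_along v (\<lambda>p. f p * g p) p)
     = (LINT p|lebesgue_on Omega. f p * pderiv_along v g p) + (LINT p|lebesgue_on Omega. pderiv_along v f p * g p)"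
    unfolding pderiv_along_mult[OF smooth_differentiable smooth_differentiable, OF f g] by simp
  with integral_pderiv[OF s smooth_mult[OF f g]] show ?thesis by simp
qed

lemma dir_opposite_sides:
  assumes "v \<in> {ex, ey}"
  obtains c \<gamma>0 \<gamma>1 where "opposite_sides v c \<gamma>0 \<gamma>1"
  using assms opposite_sides.intros by blast

lemma smooth_has_weak_deriv:
  assumes v: "v \<in> {ex, ey}" and f: "smooth f"
  shows "has_weak_deriv v f (pderiv_along v f)"
  unfolding has_weak_deriv_def
proof (intro allI impI)
  fix \<psi> assume t: "test_function \<psi>"
  obtain c \<gamma>0 \<gamma>1 where s: "opposite_sides v c \<gamma>0 \<gamma>1" using dir_opposite_sides[OF v] .
  have "\<psi> (\<gamma>0 s) = 0" "\<psi> (\<gamma>1 s) = 0" for s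
    using test_function_outside[OF t] opposite_sides_boundary[OF s] by auto
  then show "(LINT p|lebesgue_on Omega. f p * pderiv_along v \<psi> p) = - (LINT p|lebesgue_on Omega. pderiv_along v f p * \<psi> p)"
    using smooth_integration_by_parts[OF s f] t by (simp add: test_function_def)
qed

text \<open>A cosine mode times a cutoff is a test function. Removing the cutoff in the limit shows
  that all cosine coefficients vanish, and the cosine system is complete.\<close>

lemma test_functions_separate:
  assumes h: "h \<in> L2\<Omega>" and z: "\<And>\<psi>. test_function \<psi> \<Longrightarrow> (LINT p|lebesgue_on Omega. h p * \<psi> p) = 0"
  shows "AE p in lebesgue_on Omega. h p = 0"
proof (rule cos_coeffs_zero_AE[OF h])
  fix i
  let ?e = "tensor cmode cmode i"
  have se: "smooth ?e" by (intro smooth_tensor smooth1_cmode)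
  have "(\<lambda>m. LINT p|lebesgue_on Omega. h p * (cutoff m p * ?e p)) \<longlonglongrightarrow> (LINT p|lebesgue_on Omega. h p * ?e p)"
  proof (rule integral_dominated_convergence[where w = "\<lambda>p. \<bar>h p * ?e p\<bar>"])
    show "(\<lambda>p. h p * ?e p) \<in> borel_measurable (lebesgue_on Omega)"
      using L2_integrable_mult[OF h mode_L2] by blast
    show "(\<lambda>p. h p * (cutoff m p * ?e p)) \<in> borel_measurable (lebesgue_on Omega)" for m
      using smooth_continuous[OF smooth_mult[OF smooth_cut se]] by (intro borel_measurable_integrable L2_integrable_mult[OF h continuous_L2_Omega])
    show "integrable (lebesgue_on Omega) (\<lambda>p. \<bar>h p * ?e p\<bar>)" using L2_integrable_mult[OF h mode_L2] by simp
    show "AE p in lebesgue_on Omega. (\<lambda>m. h p * (cutoff m p * ?e p)) \<longlonglongrightarrow> h p * ?e p"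
      using tendsto_mult_left[OF tendsto_mult_right[OF cutoff_tendsto]] by (intro AE_I2) force
    show "AE p in lebesgue_on Omega. norm (h p * (cutoff m p * ?e p)) \<le> \<bar>h p * ?e p\<bar>" for m
      using cutoff_bounds[of m] by (intro AE_I2) (simp add: abs_mult mult_left_le_one_le mult_left_mono)
  qed
  then show "coeff_cos h i = 0"
    using z[OF test_function_cut[OF se]] by (simp add: coeff_cos_def LIMSEQ_const_iff)
qed

lemma weak_deriv_unique:
  assumes g: "g \<in> L2\<Omega>" "has_weak_deriv v f g" and h: "h \<in> L2\<Omega>" "has_weak_deriv v f h"
  shows "AE p in lebesgue_on Omega. g p = h p"
proof -
  have "AE p in lebesgue_on Omega. g p - h p = 0"
  proof (rule test_functions_separate[OF L2_diff[OF g(1) h(1)]])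
    fix \<psi> assume t: "test_function \<psi>"
    then have "\<psi> \<in> L2\<Omega>" by (auto simp: test_function_def intro: continuous_L2_Omega smooth_continuous)
    then show "(LINT p|lebesgue_on Omega. (g p - h p) * \<psi> p) = 0"
      using g(2) h(2) t L2_integrable_mult[OF g(1)] L2_integrable_mult[OF h(1)]
      by (simp add: has_weak_deriv_def left_diff_distrib)
  qed
  then show ?thesis by simp
qed

lemma weak_deriv_H1:
  assumes "f \<in> H1" "v \<in> {ex, ey}"
  shows "weak_deriv v f \<in> L2\<Omega>" "has_weak_deriv v f (weak_deriv v f)"
proof -
  have "\<exists>g. g \<in> L2\<Omega> \<and> has_weak_deriv v f g" using assms by (auto simp: H1_def)
  from someI_ex[OF this] show "weak_deriv v f \<in> L2\<Omega>" "has_weak_deriv v f (weak_deriv v f)"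
    by (auto simp: weak_deriv_def)
qed

lemma has_weak_deriv_diff:
  assumes "has_weak_deriv v f f'" "has_weak_deriv v g g'" "f \<in> L2\<Omega>" "g \<in> L2\<Omega>" "f' \<in> L2\<Omega>" "g' \<in> L2\<Omega>" "v \<in> {ex, ey}"
  shows "has_weak_deriv v (\<lambda>p. f p - g p) (\<lambda>p. f' p - g' p)"
  unfolding has_weak_deriv_def
proof (intro allI impI)
  fix \<psi> assume t: "test_function \<psi>"
  then have "\<psi> \<in> L2\<Omega>" "pderiv_along v \<psi> \<in> L2\<Omega>" using assms(7)
    by (auto simp: test_function_def intro!: continuous_L2_Omega smooth_continuous smooth_pderiv)
  then show "(LINT p|lebesgue_on Omega. (f p - g p) * pderiv_along v \<psi> p) = - (LINT p|lebesgue_on Omega. (f' p - g' p) * \<psi> p)"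
    using assms t by (simp add: has_weak_deriv_def left_diff_distrib L2_integrable_mult)
qed

lemma H1_norm_bounds:
  "norm_L2\<Omega> f \<le> H1_norm f" "v \<in> {ex, ey} \<Longrightarrow> norm_L2\<Omega> (weak_deriv v f) \<le> H1_norm f"
  by (auto simp: H1_norm_def intro!: real_le_rsqrt)

lemma H1_norm_nonneg: "0 \<le> H1_norm f"
  by (simp add: H1_norm_def)

text \<open>The \<open>H1_norm\<close> of the difference involves a representative chosen for the
  weak derivative of \<open>W n - w\<close>. Uniqueness identifies it almost everywhere with the
  classical derivative of \<open>W n\<close> minus the chosen derivative of
  \<open>w\<close>.\<close>

lemma smooth_approx_L2:
  assumes W: "\<And>n. smooth (W n)" and w: "w \<in> H1" and v: "v \<in> {ex, ey}"
    and lim: "(\<lambda>n. H1_norm (\<lambda>p. W n p - w p)) \<longlonglongrightarrow> 0"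
  shows "(\<lambda>n. norm_L2\<Omega> (\<lambda>p. W n p - w p)) \<longlonglongrightarrow> 0"
    and "(\<lambda>n. norm_L2\<Omega> (\<lambda>p. pderiv_along v (W n) p - weak_deriv v w p)) \<longlonglongrightarrow> 0"
proof -
  show "(\<lambda>n. norm_L2\<Omega> (\<lambda>p. W n p - w p)) \<longlonglongrightarrow> 0"
    by (rule Lim_null_comparison[OF _ lim]) (auto intro!: always_eventually H1_norm_bounds(1))
  have wL: "w \<in> L2\<Omega>" using w by (simp add: H1_def)
  have "norm_L2\<Omega> (\<lambda>p. pderiv_along v (W n) p - weak_deriv v w p) \<le> H1_norm (\<lambda>p. W n p - w p)" for n
  proof -
    have WL: "W n \<in> L2\<Omega>" using W by (intro continuous_L2_Omega smooth_continuous)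
    have WdL: "pderiv_along u (W n) \<in> L2\<Omega>" if "u \<in> {ex, ey}" for u
      using W that by (intro continuous_L2_Omega smooth_continuous_pderiv)
    have d: "has_weak_deriv u (\<lambda>p. W n p - w p) (\<lambda>p. pderiv_along u (W n) p - weak_deriv u w p)"
      "(\<lambda>p. pderiv_along u (W n) p - weak_deriv u w p) \<in> L2\<Omega>" if "u \<in> {ex, ey}" for u
      using that weak_deriv_H1[OF w that] smooth_has_weak_deriv[OF that W]
      by (auto intro!: has_weak_deriv_diff WL wL WdL L2_diff simp del: insert_iff)
    then have H: "(\<lambda>p. W n p - w p) \<in> H1"
      unfolding H1_def using L2_diff[OF WL wL] by blast
    have "AE p in lebesgue_on Omega. pderiv_along v (W n) p - weak_deriv v w p = weak_deriv v (\<lambda>p. W n p - w p) p"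
      using weak_deriv_unique d[OF v] weak_deriv_H1[OF H v] by blast
    then have "norm_L2\<Omega> (\<lambda>p. pderiv_along v (W n) p - weak_deriv v w p) = norm_L2\<Omega> (weak_deriv v (\<lambda>p. W n p - w p))"
      using d(2)[OF v] weak_deriv_H1(1)[OF H v] by (intro L2_norm_cong_AE) (auto dest: L2_D)
    also have "\<dots> \<le> H1_norm (\<lambda>p. W n p - w p)" using v by (rule H1_norm_bounds)
    finally show ?thesis .
  qed
  then show "(\<lambda>n. norm_L2\<Omega> (\<lambda>p. pderiv_along v (W n) p - weak_deriv v w p)) \<longlonglongrightarrow> 0"
    by (intro Lim_null_comparison[OF _ lim]) auto
qed

text \<open>Both area integrals are continuous with respect to the convergence of
  \<open>W n\<close>, so it is enough that the boundary terms of the approximants tend to 0. Whether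
  this is due to the trace of \<open>w\<close> or to zeros of \<open>V\<close> is left to the
  applications.\<close>

lemma H1_integration_by_parts_limit:
  assumes s: "opposite_sides v c \<gamma>0 \<gamma>1" and W: "\<And>n. smooth (W n)" and w: "w \<in> H1" and V: "smooth V"
    and lim: "(\<lambda>n. H1_norm (\<lambda>p. W n p - w p)) \<longlonglongrightarrow> 0"
    and bd: "(\<lambda>n. integral {0..1} (\<lambda>s. W n (\<gamma>1 s) * V (\<gamma>1 s) - W n (\<gamma>0 s) * V (\<gamma>0 s))) \<longlonglongrightarrow> 0"
  shows "(LINT p|lebesgue_on Omega. weak_deriv v w p * V p) = - (LINT p|lebesgue_on Omega. w p * pderiv_along v V p)"
proof -
  note v = opposite_sides_dir[OF s]
  have VL: "V \<in> L2\<Omega>" "pderiv_along v V \<in> L2\<Omega>"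
    using V v by (auto intro!: continuous_L2_Omega smooth_continuous smooth_pderiv simp del: insert_iff)
  have WL: "W n \<in> L2\<Omega>" "pderiv_along v (W n) \<in> L2\<Omega>" for n
    using W v by (auto intro!: continuous_L2_Omega smooth_continuous smooth_pderiv simp del: insert_iff)
  have wL: "w \<in> L2\<Omega>" using w by (simp add: H1_def)
  have "(\<lambda>n. LINT p|lebesgue_on Omega. pderiv_along v (W n) p * V p) \<longlonglongrightarrow> (LINT p|lebesgue_on Omega. weak_deriv v w p * V p)"
    by (intro L2_inner_tendsto WL VL weak_deriv_H1[OF w v] smooth_approx_L2(2)[OF W w v lim])
  moreover have "(\<lambda>n. LINT p|lebesgue_on Omega. W n p * pderiv_along v V p) \<longlonglongrightarrow> (LINT p|lebesgue_on Omega. w p * pderiv_along v V p)"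
    by (intro L2_inner_tendsto WL VL wL smooth_approx_L2(1)[OF W w v lim])
  ultimately have "(\<lambda>n. (LINT p|lebesgue_on Omega. pderiv_along v (W n) p * V p) + (LINT p|lebesgue_on Omega. W n p * pderiv_along v V p))
     \<longlonglongrightarrow> (LINT p|lebesgue_on Omega. weak_deriv v w p * V p) + (LINT p|lebesgue_on Omega. w p * pderiv_along v V p)"
    by (rule tendsto_add)
  moreover have "(LINT p|lebesgue_on Omega. pderiv_along v (W n) p * V p) + (LINT p|lebesgue_on Omega. W n p * pderiv_along v V p)
     = integral {0..1} (\<lambda>s. W n (\<gamma>1 s) * V (\<gamma>1 s) - W n (\<gamma>0 s) * V (\<gamma>0 s))" for n
    using smooth_integration_by_parts[OF s W V] by simp
  ultimately have "(LINT p|lebesgue_on Omega. weak_deriv v w p * V p) + (LINT p|lebesgue_on Omega. w p * pderiv_along v V p) = 0"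
    using LIMSEQ_unique[OF _ bd] by simp
  then show ?thesis by linarith
qed

section \<open>Decay of the cosine coefficients\<close>

lemma pderiv_prod:
  assumes "\<And>x. (a has_real_derivative a' x) (at x)" "\<And>x. (b has_real_derivative b' x) (at x)"
  shows "pderiv_along ex (\<lambda>p. a (fst p) * b (snd p)) = (\<lambda>p. a' (fst p) * b (snd p))"
    and "pderiv_along ey (\<lambda>p. a (fst p) * b (snd p)) = (\<lambda>p. a (fst p) * b' (snd p))"
proof -
  have "(\<lambda>p. a (fst p)) differentiable (at p)" "(\<lambda>p. b (snd p)) differentiable (at p)" for p :: "real \<times> real"
    using differentiableI[OF has_derivative_fst'[OF assms(1)]] differentiableI[OF has_derivative_snd'[OF assms(2)]] .
  note * = pderiv_along_mult[OF this] pderiv_along_fst[OF assms(1)] pderiv_along_snd[OF assms(2)]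
  show "pderiv_along ex (\<lambda>p. a (fst p) * b (snd p)) = (\<lambda>p. a' (fst p) * b (snd p))"
    "pderiv_along ey (\<lambda>p. a (fst p) * b (snd p)) = (\<lambda>p. a (fst p) * b' (snd p))"
    unfolding * by simp_all
qed

text \<open>Extends the defining identity of the weak derivative to test functions vanishing
  linearly on the two sides orthogonal to \<open>v\<close>. The test function is multiplied by
  \<open>cutoff m\<close>; only the derivative along \<open>v\<close> falls on the cutoff, so linear
  decay towards these two sides keeps the integrands dominated, whatever happens on the other
  pair.\<close>

lemma weak_deriv_test_vanishing:
  assumes s: "opposite_sides v c \<gamma>0 \<gamma>1" and f: "f \<in> L2\<Omega>" and g: "g \<in> L2\<Omega>" and fg: "has_weak_deriv v f g"
    and \<psi>: "smooth \<psi>" and C: "0 \<le> C"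
    and bd: "\<And>p. p \<in> Omega \<Longrightarrow> \<bar>\<psi> p\<bar> \<le> C * c p" "\<And>p. p \<in> Omega \<Longrightarrow> \<bar>\<psi> p\<bar> \<le> C * (1 - c p)"
  shows "(LINT p|lebesgue_on Omega. f p * pderiv_along v \<psi> p) = - (LINT p|lebesgue_on Omega. g p * \<psi> p)"
proof -
  note v = opposite_sides_dir[OF s]
  have d: "pderiv_along v (\<lambda>p. cutoff m p * \<psi> p) p = cutoff m p * pderiv_along v \<psi> p + pderiv_along v (cutoff m) p * \<psi> p" for m p
    using pderiv_along_mult[OF smooth_differentiable smooth_differentiable, OF smooth_cut \<psi>] by simp
  have eq: "(LINT p|lebesgue_on Omega. f p * pderiv_along v (\<lambda>p. cutoff m p * \<psi> p) p)
    = - (LINT p|lebesgue_on Omega. g p * (cutoff m p * \<psi> p))" for m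
    using fg test_function_cut[OF \<psi>] unfolding has_weak_deriv_def by blast
  have sm: "smooth (\<lambda>p. cutoff m p * \<psi> p)" for m by (intro smooth_mult smooth_cut \<psi>)
  have \<psi>L: "\<psi> \<in> L2\<Omega>" "pderiv_along v \<psi> \<in> L2\<Omega>"
    using \<psi> v by (auto intro!: continuous_L2_Omega smooth_continuous smooth_pderiv simp del: insert_iff)
  have meas: "(\<lambda>p. g p * (cutoff m p * \<psi> p)) \<in> borel_measurable (lebesgue_on Omega)"
    "(\<lambda>p. f p * pderiv_along v (\<lambda>p. cutoff m p * \<psi> p) p) \<in> borel_measurable (lebesgue_on Omega)" for m
    using L2_integrable_mult[OF g continuous_L2_Omega[OF smooth_continuous[OF sm]]]
      L2_integrable_mult[OF f continuous_L2_Omega[OF smooth_continuous_pderiv[OF sm v]]] by blast+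
  have "(\<lambda>m. LINT p|lebesgue_on Omega. g p * (cutoff m p * \<psi> p)) \<longlonglongrightarrow> (LINT p|lebesgue_on Omega. g p * \<psi> p)"
  proof (rule integral_dominated_convergence[where w = "\<lambda>p. \<bar>g p * \<psi> p\<bar>"])
    show "AE p in lebesgue_on Omega. (\<lambda>m. g p * (cutoff m p * \<psi> p)) \<longlonglongrightarrow> g p * \<psi> p"
      using tendsto_mult_left[OF tendsto_mult_right[OF cutoff_tendsto]] by (intro AE_I2) force
    show "AE p in lebesgue_on Omega. norm (g p * (cutoff m p * \<psi> p)) \<le> \<bar>g p * \<psi> p\<bar>" for m
      using cutoff_bounds[of m] by (intro AE_I2) (simp add: abs_mult mult_left_le_one_le mult_left_mono)
  qed (use meas L2_integrable_mult[OF g \<psi>L(1)] in auto)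
  then have 1: "(\<lambda>m. - (LINT p|lebesgue_on Omega. g p * (cutoff m p * \<psi> p))) \<longlonglongrightarrow> - (LINT p|lebesgue_on Omega. g p * \<psi> p)"
    by (rule tendsto_minus)
  have 2: "(\<lambda>m. LINT p|lebesgue_on Omega. f p * pderiv_along v (\<lambda>p. cutoff m p * \<psi> p) p)
      \<longlonglongrightarrow> (LINT p|lebesgue_on Omega. f p * pderiv_along v \<psi> p)"
  proof (rule integral_dominated_convergence[where w = "\<lambda>p. \<bar>f p * pderiv_along v \<psi> p\<bar> + \<bar>f p * (6 * C)\<bar>"])
    show "integrable (lebesgue_on Omega) (\<lambda>p. \<bar>f p * pderiv_along v \<psi> p\<bar> + \<bar>f p * (6 * C)\<bar>)"
      using L2_integrable_mult[OF f \<psi>L(2)] L2_Omega_integrable[OF f] by simp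
    show "AE p in lebesgue_on Omega. (\<lambda>m. f p * pderiv_along v (\<lambda>p. cutoff m p * \<psi> p) p) \<longlonglongrightarrow> f p * pderiv_along v \<psi> p"
    proof (rule AE_I2)
      fix p assume "p \<in> space (lebesgue_on Omega)"
      then have p: "p \<in> Omega" by simp
      have "(\<lambda>m. f p * (cutoff m p * pderiv_along v \<psi> p + pderiv_along v (cutoff m) p * \<psi> p))
        \<longlonglongrightarrow> f p * (1 * pderiv_along v \<psi> p + 0 * \<psi> p)"
        by (intro tendsto_intros cutoff_tendsto[OF p] pderiv_cut_bound(2)[OF s p])
      then show "(\<lambda>m. f p * pderiv_along v (\<lambda>p. cutoff m p * \<psi> p) p) \<longlonglongrightarrow> f p * pderiv_along v \<psi> p"
        by (simp add: d)
    qed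
    show "AE p in lebesgue_on Omega. norm (f p * pderiv_along v (\<lambda>p. cutoff m p * \<psi> p) p) \<le> \<bar>f p * pderiv_along v \<psi> p\<bar> + \<bar>f p * (6 * C)\<bar>" for m
    proof (rule AE_I2)
      fix p assume "p \<in> space (lebesgue_on Omega)"
      then have p: "p \<in> Omega" by simp
      have "\<bar>pderiv_along v (cutoff m) p * \<psi> p\<bar> \<le> \<bar>cutoff1' m (c p) * \<psi> p\<bar>"
        using pderiv_cut_bound(1)[OF s] by (simp add: abs_mult mult_right_mono)
      also have "\<dots> \<le> 6 * C"
        using opposite_sides_Omega[OF s p] bd[OF p] C by (intro cutoff1'_bound) auto
      finally have a: "\<bar>pderiv_along v (cutoff m) p * \<psi> p\<bar> \<le> 6 * C" .
      have b: "\<bar>cutoff m p * pderiv_along v \<psi> p\<bar> \<le> \<bar>pderiv_along v \<psi> p\<bar>"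
        using cutoff_bounds[of m p] by (simp add: abs_mult mult_left_le_one_le)
      have "\<bar>f p\<bar> * \<bar>cutoff m p * pderiv_along v \<psi> p + pderiv_along v (cutoff m) p * \<psi> p\<bar> \<le> \<bar>f p\<bar> * (\<bar>pderiv_along v \<psi> p\<bar> + 6 * C)"
        using a b by (intro mult_left_mono) auto
      then show "norm (f p * pderiv_along v (\<lambda>p. cutoff m p * \<psi> p) p) \<le> \<bar>f p * pderiv_along v \<psi> p\<bar> + \<bar>f p * (6 * C)\<bar>"
        using C by (simp only: d abs_mult[symmetric] real_norm_def) (simp add: abs_mult distrib_left)
    qed
  qed (use meas L2_integrable_mult[OF f \<psi>L(2)] in auto)
  show ?thesis using LIMSEQ_unique[OF 2[unfolded eq] 1] .
qed

lemma smode_derivative: "(smode k has_real_derivative real k * pi * cmode k x) (at x)"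
  unfolding smode_def cmode_def by (auto intro!: derivative_eq_intros)

lemma smode_bound:
  assumes "0 < x" "x < 1"
  shows "\<bar>smode k x\<bar> \<le> sqrt 2 * (real k * pi) * x" "\<bar>smode k x\<bar> \<le> sqrt 2 * (real k * pi) * (1 - x)"
proof -
  have "\<bar>sin (real k * pi * x)\<bar> \<le> real k * pi * x" using abs_sin_x_le_abs_x[of "real k * pi * x"] assms by simp
  then show "\<bar>smode k x\<bar> \<le> sqrt 2 * (real k * pi) * x"
    by (simp add: smode_def abs_mult)
  have "sin (real k * pi * x) = - (cos (real k * pi) * sin (real k * pi * (1 - x)))"
  proof -
    have "sin (real k * pi * x) = sin (real k * pi - real k * pi * (1 - x))" by (simp add: algebra_simps)
    then show ?thesis by (simp only: sin_diff) (simp add: mult.commute[of "real k"] sin_npi2)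
  qed
  then have "\<bar>sin (real k * pi * x)\<bar> \<le> \<bar>sin (real k * pi * (1 - x))\<bar>"
    by (simp add: abs_mult mult_left_le_one_le)
  also have "\<dots> \<le> real k * pi * (1 - x)" using abs_sin_x_le_abs_x[of "real k * pi * (1 - x)"] assms by simp
  finally show "\<bar>smode k x\<bar> \<le> sqrt 2 * (real k * pi) * (1 - x)"
    by (simp add: smode_def abs_mult)
qed

lemma cmode_bound: "\<bar>cmode k x\<bar> \<le> sqrt 2"
  by (auto simp: cmode_def abs_mult real_le_rsqrt)

text \<open>The sine factor vanishes on both sides orthogonal to the direction of differentiation,
  so the identity holds for every \<open>f\<close> in \<open>H1\<close>, without boundary conditions
  on \<open>f\<close>.\<close>

lemma weak_deriv_coeff:
  assumes f: "f \<in> H1"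
  shows "(LINT p|lebesgue_on Omega. weak_deriv ex f p * tensor smode cmode i p) = - (real (fst i) * pi * coeff_cos f i)"
    and "(LINT p|lebesgue_on Omega. weak_deriv ey f p * tensor cmode smode i p) = - (real (snd i) * pi * coeff_cos f i)"
proof -
  have fL: "f \<in> L2\<Omega>" using f by (simp add: H1_def)
  have dc: "(cmode k has_real_derivative - (if k = 0 then 1 else sqrt 2) * (real k * pi) * sin (real k * pi * x)) (at x)" for k x
    unfolding cmode_def by (auto intro!: derivative_eq_intros)
  have 1: "pderiv_along ex (tensor smode cmode i) = (\<lambda>p. real (fst i) * pi * tensor cmode cmode i p)"
    unfolding tensor_def[abs_def] pderiv_prod(1)[OF smode_derivative dc] by (simp add: mult.assoc)
  have 2: "pderiv_along ey (tensor cmode smode i) = (\<lambda>p. real (snd i) * pi * tensor cmode cmode i p)"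
    unfolding tensor_def[abs_def] pderiv_prod(2)[OF dc smode_derivative] by (simp add: mult_ac)
  \<comment> \<open>The slope bound of the sine factor times the bound \<open>sqrt 2\<close> of the
    cosine factor.\<close>
  define C where "C k = sqrt 2 * (sqrt 2 * (real k * pi))" for k
  have "(LINT p|lebesgue_on Omega. f p * pderiv_along ex (tensor smode cmode i) p)
     = - (LINT p|lebesgue_on Omega. weak_deriv ex f p * tensor smode cmode i p)"
  proof (rule weak_deriv_test_vanishing[OF opposite_sides.intros(1) fL weak_deriv_H1[OF f], where C = "C (fst i)"])
    show "smooth (tensor smode cmode i)" by (intro smooth_tensor smooth1_smode smooth1_cmode)
    fix p assume "p \<in> Omega"
    then have x: "0 < fst p" "fst p < 1" by (auto simp: Omega_def)
    show "\<bar>tensor smode cmode i p\<bar> \<le> C (fst i) * fst p" "\<bar>tensor smode cmode i p\<bar> \<le> C (fst i) * (1 - fst p)"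
      using mult_mono[OF smode_bound(1)[OF x] cmode_bound, of "fst i" "snd i" "snd p"]
         mult_mono[OF smode_bound(2)[OF x] cmode_bound, of "fst i" "snd i" "snd p"] x
      by (simp_all add: tensor_def abs_mult C_def mult_ac)
  qed (auto simp: C_def)
  then show "(LINT p|lebesgue_on Omega. weak_deriv ex f p * tensor smode cmode i p) = - (real (fst i) * pi * coeff_cos f i)"
    unfolding 1 by (simp add: coeff_cos_def mult.left_commute[of "f _"])
  have "(LINT p|lebesgue_on Omega. f p * pderiv_along ey (tensor cmode smode i) p)
     = - (LINT p|lebesgue_on Omega. weak_deriv ey f p * tensor cmode smode i p)"
  proof (rule weak_deriv_test_vanishing[OF opposite_sides.intros(2) fL weak_deriv_H1[OF f], where C = "C (snd i)"])
    show "smooth (tensor cmode smode i)" by (intro smooth_tensor smooth1_smode smooth1_cmode)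
    fix p assume "p \<in> Omega"
    then have x: "0 < snd p" "snd p < 1" by (auto simp: Omega_def)
    show "\<bar>tensor cmode smode i p\<bar> \<le> C (snd i) * snd p" "\<bar>tensor cmode smode i p\<bar> \<le> C (snd i) * (1 - snd p)"
      using mult_mono[OF smode_bound(1)[OF x] cmode_bound, of "snd i" "fst i" "fst p"]
         mult_mono[OF smode_bound(2)[OF x] cmode_bound, of "snd i" "fst i" "fst p"] x
      by (simp_all add: tensor_def abs_mult C_def mult_ac)
  qed (auto simp: C_def)
  then show "(LINT p|lebesgue_on Omega. weak_deriv ey f p * tensor cmode smode i p) = - (real (snd i) * pi * coeff_cos f i)"
    unfolding 2 by (simp add: coeff_cos_def mult.left_commute[of "f _"])
qed

text \<open>Bessel's inequality for the two mixed sine-cosine systems, applied to the two weak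
  derivatives; the factor \<open>pi\<^sup>2\<close> is at least 1 and is dropped.\<close>

lemma H1_coeff_sum:
  assumes f: "f \<in> H1" and I: "finite I"
  shows "(\<Sum>i\<in>I. ((real (fst i))\<^sup>2 + (real (snd i))\<^sup>2) * (coeff_cos f i)\<^sup>2) \<le> (H1_norm f)\<^sup>2"
proof -
  have os: "orthosystem (lebesgue_on Omega) (tensor smode cmode)" "orthosystem (lebesgue_on Omega) (tensor cmode smode)"
    by (rule orthosystem_tensor[where P="\<lambda>k. k \<noteq> 0" and R="\<lambda>_. True"] orthosystem_tensor[where P="\<lambda>_. True" and R="\<lambda>k. k \<noteq> 0"];
        simp add: continuous_cmode continuous_smode cmode_orthogonal smode_orthogonal)+
  have "(\<Sum>i\<in>I. (real (fst i) * pi * coeff_cos f i)\<^sup>2) \<le> (norm_L2\<Omega> (weak_deriv ex f))\<^sup>2"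
    using Bessel_inequality[OF os(1) I weak_deriv_H1(1)[OF f, of ex]] unfolding weak_deriv_coeff[OF f] by simp
  moreover have "(\<Sum>i\<in>I. (real (snd i) * pi * coeff_cos f i)\<^sup>2) \<le> (norm_L2\<Omega> (weak_deriv ey f))\<^sup>2"
    using Bessel_inequality[OF os(2) I weak_deriv_H1(1)[OF f, of ey]] unfolding weak_deriv_coeff[OF f] by simp
  ultimately have 1: "(\<Sum>i\<in>I. (real (fst i) * pi * coeff_cos f i)\<^sup>2 + (real (snd i) * pi * coeff_cos f i)\<^sup>2) \<le> (H1_norm f)\<^sup>2"
    unfolding H1_norm_def sum.distrib by (simp add: add_increasing add_mono)
  have "(\<Sum>i\<in>I. ((real (fst i))\<^sup>2 + (real (snd i))\<^sup>2) * (coeff_cos f i)\<^sup>2)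
     \<le> (\<Sum>i\<in>I. (real (fst i) * pi * coeff_cos f i)\<^sup>2 + (real (snd i) * pi * coeff_cos f i)\<^sup>2)"
  proof (rule sum_mono)
    fix i
    have "1 * (((real (fst i))\<^sup>2 + (real (snd i))\<^sup>2) * (coeff_cos f i)\<^sup>2) \<le> pi\<^sup>2 * (((real (fst i))\<^sup>2 + (real (snd i))\<^sup>2) * (coeff_cos f i)\<^sup>2)"
      using pi_gt3 by (intro mult_right_mono) (auto simp: one_le_power)
    then show "((real (fst i))\<^sup>2 + (real (snd i))\<^sup>2) * (coeff_cos f i)\<^sup>2
       \<le> (real (fst i) * pi * coeff_cos f i)\<^sup>2 + (real (snd i) * pi * coeff_cos f i)\<^sup>2"
      by (simp add: power_mult_distrib algebra_simps)
  qed
  with 1 show ?thesis by linarith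
qed

text \<open>Comparison with a larger projection \<open>M\<close> replaces the tail of the series by
  a finite sum, in which every index has a component at least \<open>N\<close>. The remaining error
  vanishes as \<open>M\<close> grows, by completeness.\<close>

lemma cos_proj_H1_rate:
  assumes f: "f \<in> H1" and N: "N > 0"
  shows "norm_L2\<Omega> (\<lambda>p. f p - cos_proj N f p) \<le> H1_norm f / real N"
proof (rule LIMSEQ_le_const)
  have fL: "f \<in> L2\<Omega>" using f by (simp add: H1_def)
  show "(\<lambda>M. norm_L2\<Omega> (\<lambda>p. f p - cos_proj M f p) + H1_norm f / real N) \<longlonglongrightarrow> H1_norm f / real N"
    using tendsto_add[OF cos_proj_tendsto[OF fL] tendsto_const] by simp
  have "norm_L2\<Omega> (\<lambda>p. f p - cos_proj N f p) \<le> norm_L2\<Omega> (\<lambda>p. f p - cos_proj M f p) + H1_norm f / real N" if "M \<ge> N" for M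
  proof -
    have sub: "modes N \<subseteq> modes M" using that by (auto simp: modes_def)
    let ?I = "modes M - modes N"
    have "cos_proj M f p - cos_proj N f p = (\<Sum>i\<in>?I. coeff_cos f i * tensor cmode cmode i p)" for p
      unfolding cos_proj_def
      using sum.subset_diff[OF sub, of "\<lambda>i. coeff_cos f i * tensor cmode cmode i p"] by simp
    then have "(norm_L2\<Omega> (\<lambda>p. cos_proj M f p - cos_proj N f p))\<^sup>2 = (\<Sum>i\<in>?I. (coeff_cos f i)\<^sup>2)"
      using orthosystem_sum_norm[OF orthosystem_modes, of ?I "coeff_cos f"] by (simp add: mode_norm)
    also have "\<dots> \<le> (\<Sum>i\<in>?I. ((real (fst i))\<^sup>2 + (real (snd i))\<^sup>2) * (coeff_cos f i)\<^sup>2 / (real N)\<^sup>2)"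
    proof (rule sum_mono)
      fix i assume i: "i \<in> ?I"
      then have "N \<le> fst i \<or> N \<le> snd i" by (cases i) (auto simp: modes_def)
      then have "(real N)\<^sup>2 \<le> (real (fst i))\<^sup>2 \<or> (real N)\<^sup>2 \<le> (real (snd i))\<^sup>2" by (auto intro!: power_mono)
      then have "(real N)\<^sup>2 \<le> (real (fst i))\<^sup>2 + (real (snd i))\<^sup>2" by (smt (verit) zero_le_power2)
      then have "(real N)\<^sup>2 * (coeff_cos f i)\<^sup>2 \<le> ((real (fst i))\<^sup>2 + (real (snd i))\<^sup>2) * (coeff_cos f i)\<^sup>2"
        by (rule mult_right_mono) simp
      then show "(coeff_cos f i)\<^sup>2 \<le> ((real (fst i))\<^sup>2 + (real (snd i))\<^sup>2) * (coeff_cos f i)\<^sup>2 / (real N)\<^sup>2"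
        using N by (simp add: pos_le_divide_eq mult.commute)
    qed
    also have "\<dots> \<le> (H1_norm f)\<^sup>2 / (real N)\<^sup>2"
      using H1_coeff_sum[OF f, of ?I] by (simp add: divide_right_mono flip: sum_divide_distrib)
    finally have "(norm_L2\<Omega> (\<lambda>p. cos_proj M f p - cos_proj N f p))\<^sup>2 \<le> (H1_norm f / real N)\<^sup>2"
      by (simp add: power_divide)
    then have "norm_L2\<Omega> (\<lambda>p. cos_proj M f p - cos_proj N f p) \<le> H1_norm f / real N"
      by (rule power2_le_imp_le) (simp add: H1_norm_nonneg)
    then show ?thesis
      using L2_norm_triangle_diff[OF fL cos_proj_L2[of M f] cos_proj_L2[of N f]] by linarith
  qed
  then show "\<exists>K. \<forall>M\<ge>K. norm_L2\<Omega> (\<lambda>p. f p - cos_proj N f p) \<le> norm_L2\<Omega> (\<lambda>p. f p - cos_proj M f p) + H1_norm f / real N"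
    by blast
qed

section \<open>The source identity\<close>

lemma unit_time_continuous:
  assumes "continuous_on {0..1} (h :: real \<Rightarrow> real)"
  shows "integrable unit_time h" "(LINT t|unit_time. h t) = integral {0..1} h"
proof -
  have "h absolutely_integrable_on {0..1}" using assms by (rule absolutely_integrable_continuous_real)
  then have "h absolutely_integrable_on {0<..<1}" by (rule set_integrable_subset) auto
  then show i: "integrable unit_time h" by (intro absolutely_integrable_imp_integrable) auto
  show "(LINT t|unit_time. h t) = integral {0..1} h"
    using lebesgue_integral_eq_integral[OF i] by (simp add: integral_open_interval_real)
qed

lemma unit_time_continuous_L2:
  assumes "continuous_on {0..1} (h :: real \<Rightarrow> real)"
  shows "h \<in> L2 unit_time"
  unfolding L2_def
  using unit_time_continuous(1)[OF assms] unit_time_continuous(1)[OF continuous_on_power[OF assms], of 2] by auto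

text \<open>A boundary integral disappears either because \<open>V\<close> vanishes on that side, or
  because the approximants of \<open>w\<close> tend to 0 there and Cauchy-Schwarz applies. If
  \<open>V\<close> vanishes on both sides, \<gamma> may be a different part of the boundary
  altogether.\<close>

lemma zero_trace_integration_by_parts:
  assumes s: "opposite_sides v c \<gamma>0 \<gamma>1" and w: "zero_trace \<gamma> w" and \<gamma>: "continuous_on UNIV \<gamma>" and V: "smooth V"
    and 0: "\<gamma>0 = \<gamma> \<or> (\<forall>s. V (\<gamma>0 s) = 0)" and 1: "\<gamma>1 = \<gamma> \<or> (\<forall>s. V (\<gamma>1 s) = 0)"
  shows "(LINT p|lebesgue_on Omega. weak_deriv v w p * V p) = - (LINT p|lebesgue_on Omega. w p * pderiv_along v V p)"
proof -
  from w obtain W where wH: "w \<in> H1" and W: "\<And>n. smooth (W n)" 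
    and lim: "(\<lambda>n. H1_norm (\<lambda>p. W n p - w p)) \<longlonglongrightarrow> 0" 
    and tr: "(\<lambda>n. L2_norm unit_time (\<lambda>s. W n (\<gamma> s))) \<longlonglongrightarrow> 0"
    unfolding zero_trace_def has_trace_def by auto
  have cont: "continuous_on {0..1} (\<lambda>s. f (\<delta> s))" if "smooth f" "continuous_on UNIV \<delta>" for f :: "real \<times> real \<Rightarrow> real" and \<delta> :: "real \<Rightarrow> real \<times> real"
    using continuous_on_compose2[OF smooth_continuous[OF that(1)] that(2)] continuous_on_subset by blast
  have \<gamma>W: "(\<lambda>n. integral {0..1} (\<lambda>s. W n (\<gamma> s) * V (\<gamma> s))) \<longlonglongrightarrow> 0"
  proof (rule Lim_null_comparison)
    show "(\<lambda>n. L2_norm unit_time (\<lambda>s. W n (\<gamma> s)) * L2_norm unit_time (\<lambda>s. V (\<gamma> s))) \<longlonglongrightarrow> 0"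
      using tendsto_mult_left_zero[OF tr] .
    show "\<forall>\<^sub>F n in sequentially. norm (integral {0..1} (\<lambda>s. W n (\<gamma> s) * V (\<gamma> s)))
        \<le> L2_norm unit_time (\<lambda>s. W n (\<gamma> s)) * L2_norm unit_time (\<lambda>s. V (\<gamma> s))"
      using unit_time_continuous(2)[OF continuous_on_mult[OF cont cont], OF W \<gamma> V \<gamma>]
        L2_Cauchy_Schwarz[OF unit_time_continuous_L2 unit_time_continuous_L2, OF cont cont, OF W \<gamma> V \<gamma>]
      by (intro always_eventually allI) simp
  qed
  have lims: "(\<lambda>n. integral {0..1} (\<lambda>s. W n (\<gamma>0 s) * V (\<gamma>0 s))) \<longlonglongrightarrow> 0"
    "(\<lambda>n. integral {0..1} (\<lambda>s. W n (\<gamma>1 s) * V (\<gamma>1 s))) \<longlonglongrightarrow> 0"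
    using 0 1 \<gamma>W by auto
  have "integral {0..1} (\<lambda>s. W n (\<gamma>1 s) * V (\<gamma>1 s) - W n (\<gamma>0 s) * V (\<gamma>0 s))
     = integral {0..1} (\<lambda>s. W n (\<gamma>1 s) * V (\<gamma>1 s)) - integral {0..1} (\<lambda>s. W n (\<gamma>0 s) * V (\<gamma>0 s))" for n
    using opposite_sides_continuous[OF s] W V
    by (intro integral_diff integrable_continuous_real continuous_on_mult cont) auto
  then have "(\<lambda>n. integral {0..1} (\<lambda>s. W n (\<gamma>1 s) * V (\<gamma>1 s) - W n (\<gamma>0 s) * V (\<gamma>0 s))) \<longlonglongrightarrow> 0"
    using tendsto_diff[OF lims(2,1)] by simp
  from H1_integration_by_parts_limit[OF s W wH V lim this] show ?thesis .
qed

text \<open>Splitting the test function with the weights \<open>c\<close> and \<open>1 - c\<close> lets each of the two traces,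
  which come with unrelated approximating sequences, be used on its own side.\<close>

lemma zero_traces_integration_by_parts:
  assumes s: "opposite_sides v c \<gamma>0 \<gamma>1" and w: "zero_trace \<gamma>0 w" "zero_trace \<gamma>1 w" and V: "smooth V"
  shows "(LINT p|lebesgue_on Omega. weak_deriv v w p * V p) = - (LINT p|lebesgue_on Omega. w p * pderiv_along v V p)"
proof -
  note v = opposite_sides_dir[OF s]
  have c: "smooth c" using s smooth_fst[OF smooth1_id] smooth_snd[OF smooth1_id] by cases auto
  define V0 V1 where "V0 = (\<lambda>p. V p + (- 1) * (c p * V p))" and "V1 = (\<lambda>p. c p * V p)"
  have sm: "smooth V0" "smooth V1"
    unfolding V0_def V1_def by (intro smooth_add smooth_mult smooth_const c V)+
  have wH: "w \<in> H1" using w by (simp add: zero_trace_def has_trace_def)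
  then have wL: "w \<in> L2\<Omega>" by (simp add: H1_def)
  have VL: "U \<in> L2\<Omega>" "pderiv_along v U \<in> L2\<Omega>" if "smooth U" for U
    using that v by (auto intro!: continuous_L2_Omega smooth_continuous smooth_pderiv simp del: insert_iff)
  have 0: "(LINT p|lebesgue_on Omega. weak_deriv v w p * V0 p) = - (LINT p|lebesgue_on Omega. w p * pderiv_along v V0 p)"
    using opposite_sides_continuous[OF s] opposite_sides_boundary[OF s]
    by (intro zero_trace_integration_by_parts[OF s w(1) _ sm(1)]) (auto simp: V0_def)
  have 1: "(LINT p|lebesgue_on Omega. weak_deriv v w p * V1 p) = - (LINT p|lebesgue_on Omega. w p * pderiv_along v V1 p)"
    using opposite_sides_continuous[OF s] opposite_sides_boundary[OF s]
    by (intro zero_trace_integration_by_parts[OF s w(2) _ sm(2)]) (auto simp: V1_def)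
  have V_eq: "V = (\<lambda>p. V0 p + V1 p)" by (simp add: V0_def V1_def)
  have dV: "pderiv_along v V = (\<lambda>p. pderiv_along v V0 p + pderiv_along v V1 p)"
    unfolding V_eq by (intro pderiv_along_add smooth_differentiable sm)
  have "(LINT p|lebesgue_on Omega. weak_deriv v w p * V p)
    = (LINT p|lebesgue_on Omega. weak_deriv v w p * V0 p) + (LINT p|lebesgue_on Omega. weak_deriv v w p * V1 p)"
    using L2_integrable_mult[OF weak_deriv_H1(1)[OF wH v] VL(1)] sm by (subst V_eq) (simp add: distrib_left)
  moreover have "(LINT p|lebesgue_on Omega. w p * pderiv_along v V p)
    = (LINT p|lebesgue_on Omega. w p * pderiv_along v V0 p) + (LINT p|lebesgue_on Omega. w p * pderiv_along v V1 p)"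
    using L2_integrable_mult[OF wL VL(2)] sm unfolding dV by (simp add: distrib_left)
  ultimately show ?thesis using 0 1 by simp
qed

text \<open>In the x-direction the first integration by parts uses the zero traces of the derivative
  of \<open>u\<close>, the second the zero trace of \<open>u\<close> at x = 1 and the condition on
  \<open>V\<close> at x = 0. So \<open>V\<close> is unrestricted at x = 1, which admits the
  hyperbolic modes for every parameter.\<close>

lemma laplacian_adjoint:
  assumes u: "u \<in> H2"
    and tr: "zero_trace (\<lambda>y. (0, y)) (weak_deriv ex u)" "zero_trace (\<lambda>y. (1, y)) (weak_deriv ex u)"
      "zero_trace (\<lambda>x. (x, 0)) (weak_deriv ey u)" "zero_trace (\<lambda>x. (x, 1)) (weak_deriv ey u)"
      "zero_trace (\<lambda>y. (1, y)) u"
    and V: "smooth V" and Vx: "\<And>y. pderiv_along ex V (0, y) = 0"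
    and Vy: "\<And>x. pderiv_along ey V (x, 0) = 0" "\<And>x. pderiv_along ey V (x, 1) = 0"
  shows "(LINT p|lebesgue_on Omega. laplacian u p * V p)
     = (LINT p|lebesgue_on Omega. u p * (pderiv_along ex (pderiv_along ex V) p + pderiv_along ey (pderiv_along ey V) p))"
proof -
  have uH: "u \<in> H1" "weak_deriv ex u \<in> H1" "weak_deriv ey u \<in> H1" using u by (auto simp: H2_def)
  then have uL: "u \<in> L2\<Omega>" by (simp add: H1_def)
  have sm: "smooth (pderiv_along ex V)" "smooth (pderiv_along ey V)"
    "smooth (pderiv_along ex (pderiv_along ex V))" "smooth (pderiv_along ey (pderiv_along ey V))"
    using V by (auto intro!: smooth_pderiv simp del: insert_iff)
  have L: "weak_deriv ex (weak_deriv ex u) \<in> L2\<Omega>" "weak_deriv ey (weak_deriv ey u) \<in> L2\<Omega>"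
    using uH weak_deriv_H1 by auto
  note VL = continuous_L2_Omega[OF smooth_continuous]
  have "(LINT p|lebesgue_on Omega. weak_deriv ex (weak_deriv ex u) p * V p) = - (LINT p|lebesgue_on Omega. weak_deriv ex u p * pderiv_along ex V p)"
    by (rule zero_traces_integration_by_parts[OF opposite_sides.intros(1) tr(1,2) V])
  also have "(LINT p|lebesgue_on Omega. weak_deriv ex u p * pderiv_along ex V p) = - (LINT p|lebesgue_on Omega. u p * pderiv_along ex (pderiv_along ex V) p)"
    by (rule zero_trace_integration_by_parts[OF opposite_sides.intros(1) tr(5) _ sm(1)]) (auto simp: Vx intro!: continuous_intros)
  finally have 1: "(LINT p|lebesgue_on Omega. weak_deriv ex (weak_deriv ex u) p * V p) = (LINT p|lebesgue_on Omega. u p * pderiv_along ex (pderiv_along ex V) p)"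
    by simp
  have "(LINT p|lebesgue_on Omega. weak_deriv ey (weak_deriv ey u) p * V p) = - (LINT p|lebesgue_on Omega. weak_deriv ey u p * pderiv_along ey V p)"
    by (rule zero_traces_integration_by_parts[OF opposite_sides.intros(2) tr(3,4) V])
  \<comment> \<open>The y-derivative of \<open>V\<close> vanishes on both horizontal sides, so the
    trace of \<open>u\<close> on x = 1 serves only as a source of smooth functions converging to
    \<open>u\<close>.\<close>
  also have "(LINT p|lebesgue_on Omega. weak_deriv ey u p * pderiv_along ey V p) = - (LINT p|lebesgue_on Omega. u p * pderiv_along ey (pderiv_along ey V) p)"
    by (rule zero_trace_integration_by_parts[OF opposite_sides.intros(2) tr(5) _ sm(2)]) (auto simp: Vy intro!: continuous_intros)
  finally have 2: "(LINT p|lebesgue_on Omega. weak_deriv ey (weak_deriv ey u) p * V p) = (LINT p|lebesgue_on Omega. u p * pderiv_along ey (pderiv_along ey V) p)"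
    by simp
  show ?thesis
    using L2_integrable_mult[OF L(1) VL[OF V]] L2_integrable_mult[OF L(2) VL[OF V]]
      L2_integrable_mult[OF uL VL[OF sm(3)]] L2_integrable_mult[OF uL VL[OF sm(4)]] 1 2
    by (simp add: laplacian_def distrib_left distrib_right)
qed

definition hyp_mode :: "real \<Rightarrow> nat \<Rightarrow> real \<times> real \<Rightarrow> real" where
  "hyp_mode a n p = cosh (a * fst p) * cos (real n * pi * snd p)"

lemma smooth1_cosh: "smooth1 cosh"
  unfolding smooth1_def
  by (intro exI[of _ "\<lambda>k. if even k then cosh else sinh"]) (auto intro!: derivative_eq_intros)

lemma smooth_hyp_mode: "smooth (hyp_mode a n)"
  unfolding hyp_mode_def
  using smooth_fst[OF smooth1_affine[OF smooth1_cosh, of a 0]] smooth_snd[OF smooth1_affine[OF smooth1_cos, of "real n * pi" 0]]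
  by (intro smooth_mult) simp_all

lemma hyp_mode_L2: "hyp_mode a n \<in> L2\<Omega>"
  by (intro continuous_L2_Omega smooth_continuous smooth_hyp_mode)

lemma hyp_mode_derivs:
  "pderiv_along ex (hyp_mode a n) = (\<lambda>p. (a * sinh (a * fst p)) * cos (real n * pi * snd p))"
  "pderiv_along ex (pderiv_along ex (hyp_mode a n)) = (\<lambda>p. a\<^sup>2 * hyp_mode a n p)"
  "pderiv_along ey (hyp_mode a n) = (\<lambda>p. cosh (a * fst p) * (- (real n * pi) * sin (real n * pi * snd p)))"
  "pderiv_along ey (pderiv_along ey (hyp_mode a n)) = (\<lambda>p. - (real n * pi)\<^sup>2 * hyp_mode a n p)"
proof -
  have c: "((\<lambda>x. cosh (a * x)) has_real_derivative a * sinh (a * x)) (at x)"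
     "((\<lambda>x. a * sinh (a * x)) has_real_derivative a * (a * cosh (a * x))) (at x)" for x
    by (auto intro!: derivative_eq_intros)
  have d: "((\<lambda>x. cos (real n * pi * x)) has_real_derivative - (real n * pi) * sin (real n * pi * x)) (at x)"
     "((\<lambda>x. - (real n * pi) * sin (real n * pi * x)) has_real_derivative - (real n * pi) * (real n * pi * cos (real n * pi * x))) (at x)" for x
    by (auto intro!: derivative_eq_intros)
  show 1: "pderiv_along ex (hyp_mode a n) = (\<lambda>p. (a * sinh (a * fst p)) * cos (real n * pi * snd p))"
    unfolding hyp_mode_def[abs_def] by (rule pderiv_prod(1)[OF c(1) d(1)])
  show "pderiv_along ex (pderiv_along ex (hyp_mode a n)) = (\<lambda>p. a\<^sup>2 * hyp_mode a n p)"
    unfolding 1 pderiv_prod(1)[OF c(2) d(1)] by (simp add: hyp_mode_def power2_eq_square mult.assoc)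
  show 2: "pderiv_along ey (hyp_mode a n) = (\<lambda>p. cosh (a * fst p) * (- (real n * pi) * sin (real n * pi * snd p)))"
    unfolding hyp_mode_def[abs_def] by (rule pderiv_prod(2)[OF c(1) d(1)])
  show "pderiv_along ey (pderiv_along ey (hyp_mode a n)) = (\<lambda>p. - (real n * pi)\<^sup>2 * hyp_mode a n p)"
    unfolding 2 pderiv_prod(2)[OF c(1) d(2)] by (simp add: hyp_mode_def power2_eq_square mult_ac)
qed

lemma laplacian_hyp_mode:
  assumes u: "u \<in> H2"
    and tr: "zero_trace (\<lambda>y. (0, y)) (weak_deriv ex u)" "zero_trace (\<lambda>y. (1, y)) (weak_deriv ex u)"
      "zero_trace (\<lambda>x. (x, 0)) (weak_deriv ey u)" "zero_trace (\<lambda>x. (x, 1)) (weak_deriv ey u)"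
      "zero_trace (\<lambda>y. (1, y)) u"
  shows "(LINT p|lebesgue_on Omega. laplacian u p * hyp_mode a n p)
     = (a\<^sup>2 - (real n * pi)\<^sup>2) * (LINT p|lebesgue_on Omega. u p * hyp_mode a n p)"
proof -
  have "(LINT p|lebesgue_on Omega. laplacian u p * hyp_mode a n p)
     = (LINT p|lebesgue_on Omega. u p * (pderiv_along ex (pderiv_along ex (hyp_mode a n)) p + pderiv_along ey (pderiv_along ey (hyp_mode a n)) p))"
    by (rule laplacian_adjoint[OF u tr smooth_hyp_mode]) (simp_all add: hyp_mode_derivs(1,3) mult.commute[of _ pi])
  also have "\<dots> = (LINT p|lebesgue_on Omega. (a\<^sup>2 - (real n * pi)\<^sup>2) * (u p * hyp_mode a n p))"
    unfolding hyp_mode_derivs(2,4) by (simp add: algebra_simps)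
  finally show ?thesis by simp
qed

definition laplace_transform :: "(real \<Rightarrow> real) \<Rightarrow> real \<Rightarrow> real" where
  "laplace_transform \<phi> l = (LINT t|unit_time. exp (- (l * t)) * \<phi> t)"

section \<open>The identity obtained by testing the equation\<close>

lemma C1_L2_inner_derivative:
  assumes u: "C1_L2_with_deriv u u'" and V: "V \<in> L2\<Omega>" and t: "t \<in> {0..1}"
  shows "((\<lambda>t. LINT p|lebesgue_on Omega. u t p * V p) has_real_derivative (LINT p|lebesgue_on Omega. u' t p * V p)) (at t within {0..1})"
    and "((\<lambda>s. LINT p|lebesgue_on Omega. u' s p * V p) \<longlongrightarrow> (LINT p|lebesgue_on Omega. u' t p * V p)) (at t within {0..1})"
proof -
  have L: "u s \<in> L2\<Omega>" "u' s \<in> L2\<Omega>" if "s \<in> {0..1}" for s using u that by (auto simp: C1_L2_with_deriv_def)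
  have lim: "((\<lambda>s. norm_L2\<Omega> (\<lambda>p. (u s p - u t p) / (s - t) - u' t p)) \<longlongrightarrow> 0) (at t within {0..1})"
    "((\<lambda>s. norm_L2\<Omega> (\<lambda>p. u' s p - u' t p)) \<longlongrightarrow> 0) (at t within {0..1})"
    using u t by (auto simp: C1_L2_with_deriv_def)
  have ev: "eventually (\<lambda>s. s \<in> {0..1}) (at t within {0..1})" by (simp add: eventually_at_filter)
  let ?U = "\<lambda>t. LINT p|lebesgue_on Omega. u t p * V p"
  let ?U' = "\<lambda>t. LINT p|lebesgue_on Omega. u' t p * V p"
  have "((\<lambda>s. (?U s - ?U t) / (s - t) - ?U' t) \<longlongrightarrow> 0) (at t within {0..1})"
  proof (rule Lim_null_comparison)
    show "((\<lambda>s. norm_L2\<Omega> (\<lambda>p. (u s p - u t p) / (s - t) - u' t p) * norm_L2\<Omega> V) \<longlongrightarrow> 0) (at t within {0..1})"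
      by (rule tendsto_mult_left_zero[OF lim(1)])
    show "\<forall>\<^sub>F s in at t within {0..1}. norm ((?U s - ?U t) / (s - t) - ?U' t)
       \<le> norm_L2\<Omega> (\<lambda>p. (u s p - u t p) / (s - t) - u' t p) * norm_L2\<Omega> V"
      using ev
    proof eventually_elim
      case (elim s)
      have q: "(\<lambda>p. (u s p - u t p) / (s - t) - u' t p) \<in> L2\<Omega>"
        using L2_diff[OF L2_cmult[OF L2_diff[OF L(1)[OF elim] L(1)[OF t]], of "1 / (s - t)"] L(2)[OF t]] by simp
      have "(?U s - ?U t) / (s - t) - ?U' t = (LINT p|lebesgue_on Omega. (u s p * V p - u t p * V p) / (s - t) - u' t p * V p)"
        using L2_integrable_mult[OF L(1)[OF elim] V] L2_integrable_mult[OF L(1)[OF t] V] L2_integrable_mult[OF L(2)[OF t] V] by simp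
      also have "\<dots> = (LINT p|lebesgue_on Omega. ((u s p - u t p) / (s - t) - u' t p) * V p)"
        by (simp add: left_diff_distrib diff_divide_distrib)
      finally show ?case using L2_Cauchy_Schwarz[OF q V] by simp
    qed
  qed
  then have "((\<lambda>s. (?U s - ?U t) / (s - t)) \<longlongrightarrow> ?U' t) (at t within {0..1})" by (rule LIM_zero_cancel)
  then show "(?U has_real_derivative ?U' t) (at t within {0..1})" by (simp add: has_field_derivative_iff)
  have "((\<lambda>s. ?U' s - ?U' t) \<longlongrightarrow> 0) (at t within {0..1})"
  proof (rule Lim_null_comparison)
    show "((\<lambda>s. norm_L2\<Omega> (\<lambda>p. u' s p - u' t p) * norm_L2\<Omega> V) \<longlongrightarrow> 0) (at t within {0..1})"
      by (rule tendsto_mult_left_zero[OF lim(2)])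
    show "\<forall>\<^sub>F s in at t within {0..1}. norm (?U' s - ?U' t) \<le> norm_L2\<Omega> (\<lambda>p. u' s p - u' t p) * norm_L2\<Omega> V"
      using ev
    proof eventually_elim
      case (elim s)
      have "?U' s - ?U' t = (LINT p|lebesgue_on Omega. (u' s p - u' t p) * V p)"
        using L2_integrable_mult[OF L(2)[OF elim] V] L2_integrable_mult[OF L(2)[OF t] V] by (simp add: left_diff_distrib)
      then show ?case using L2_Cauchy_Schwarz[OF L2_diff[OF L(2)[OF elim] L(2)[OF t]] V] by simp
    qed
  qed
  then show "(?U' \<longlongrightarrow> ?U' t) (at t within {0..1})" by (rule LIM_zero_cancel)
qed

text \<open>The pairing \<open>U\<close> of \<open>u\<close> with the mode is continuously
  differentiable on the whole interval, so exp(-l t) U(t) can be integrated by the fundamental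
  theorem of calculus. The equation U' - l U = \<phi> F holds for almost every t only and enters
  afterwards, under the integral.\<close>

theorem source_identity:
  fixes a :: real and n :: nat
  assumes sol: "solves_source_problem \<phi> g0 g1 u f" and g: "g0 \<in> L2\<Omega>" "g1 \<in> L2\<Omega>"
    and \<phi>: "\<phi> \<in> L1 unit_time"
  defines "l \<equiv> a\<^sup>2 - (real n * pi)\<^sup>2"
  shows "laplace_transform \<phi> l * (LINT p|lebesgue_on Omega. f p * hyp_mode a n p)
    = exp (- l) * (LINT p|lebesgue_on Omega. g1 p * hyp_mode a n p) - (LINT p|lebesgue_on Omega. g0 p * hyp_mode a n p)"
proof -
  let ?V = "hyp_mode a n"
  from sol obtain u' where fL: "f \<in> L2\<Omega>" and u2: "u \<in> L2_H2" and u': "C1_L2_with_deriv u u'"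
    and eq: "AE t in unit_time. AE p in lebesgue_on Omega. u' t p - laplacian (u t) p = \<phi> t * f p"
    and tr: "AE t in unit_time.
        zero_trace (\<lambda>y. (0, y)) (weak_deriv ex (u t)) \<and> zero_trace (\<lambda>y. (1, y)) (weak_deriv ex (u t)) \<and>
        zero_trace (\<lambda>x. (x, 0)) (weak_deriv ey (u t)) \<and> zero_trace (\<lambda>x. (x, 1)) (weak_deriv ey (u t)) \<and>
        zero_trace (\<lambda>y. (1, y)) (u t)"
    and u0: "AE p in lebesgue_on Omega. u 0 p = g0 p" and u1: "AE p in lebesgue_on Omega. u 1 p = g1 p"
    unfolding solves_source_problem_def by blast
  have L: "u s \<in> L2\<Omega>" "u' s \<in> L2\<Omega>" if "s \<in> {0..1}" for s using u' that by (auto simp: C1_L2_with_deriv_def)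
  have H2: "AE t in unit_time. u t \<in> H2" using u2 by (simp add: L2_H2_def)
  define U U' F where "U = (\<lambda>t. LINT p|lebesgue_on Omega. u t p * ?V p)" 
    and "U' = (\<lambda>t. LINT p|lebesgue_on Omega. u' t p * ?V p)" and "F = (LINT p|lebesgue_on Omega. f p * ?V p)"
  have dU: "(U has_real_derivative U' t) (at t within {0..1})" and cU': "(U' \<longlongrightarrow> U' t) (at t within {0..1})"
    if "t \<in> {0..1}" for t
    unfolding U_def U'_def using C1_L2_inner_derivative[OF u' hyp_mode_L2 that] by auto
  have cont: "continuous_on {0..1} U" "continuous_on {0..1} U'"
    using DERIV_continuous_on[of "{0..1}" U U'] dU cU' by (blast, simp add: continuous_on_def)
  have ode: "AE t in unit_time. exp (- (l * t)) * (U' t - l * U t) = exp (- (l * t)) * \<phi> t * F"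
    using eq tr H2 AE_space
  proof eventually_elim
    case (elim t)
    then have t: "t \<in> {0..1}" by auto
    have lapL: "laplacian (u t) \<in> L2\<Omega>"
      using elim(3) weak_deriv_H1 unfolding laplacian_def[abs_def] H2_def by (intro L2_add) auto
    have "U' t - (LINT p|lebesgue_on Omega. laplacian (u t) p * ?V p) = (LINT p|lebesgue_on Omega. (u' t p - laplacian (u t) p) * ?V p)"
      unfolding U'_def using L2_integrable_mult[OF L(2)[OF t] hyp_mode_L2] L2_integrable_mult[OF lapL hyp_mode_L2]
      by (simp add: left_diff_distrib)
    also have "\<dots> = (LINT p|lebesgue_on Omega. \<phi> t * (f p * ?V p))"
    proof (rule integral_cong_AE)
      show "AE p in lebesgue_on Omega. (u' t p - laplacian (u t) p) * ?V p = \<phi> t * (f p * ?V p)"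
        using elim(1) by eventually_elim simp
    qed (use L2_D(1)[OF L(2)[OF t]] L2_D(1)[OF lapL] L2_D(1)[OF hyp_mode_L2] L2_D(1)[OF fL] in simp_all)
    also have "\<dots> = \<phi> t * F" by (simp add: F_def)
    finally have "U' t - l * U t = \<phi> t * F"
      using laplacian_hyp_mode[OF elim(3)] elim(2) unfolding l_def U_def by simp
    then show ?case by simp
  qed
  have "((\<lambda>t. exp (- (l * t)) * (U' t - l * U t)) has_integral exp (- (l * 1)) * U 1 - exp (- (l * 0)) * U 0) {0..1}"
  proof (rule fundamental_theorem_of_calculus)
    fix t :: real assume t: "t \<in> {0..1}"
    have "((\<lambda>t. exp (- (l * t)) * U t) has_real_derivative exp (- (l * t)) * (U' t - l * U t)) (at t within {0..1})"
      by (rule derivative_eq_intros dU[OF t] refl | simp add: algebra_simps)+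
    then show "((\<lambda>t. exp (- (l * t)) * U t) has_vector_derivative exp (- (l * t)) * (U' t - l * U t)) (at t within {0..1})"
      by (simp add: has_real_derivative_iff_has_vector_derivative)
  qed simp
  then have "exp (- l) * U 1 - U 0 = integral {0..1} (\<lambda>t. exp (- (l * t)) * (U' t - l * U t))"
    by (simp add: integral_unique)
  also have "\<dots> = (LINT t|unit_time. exp (- (l * t)) * (U' t - l * U t))"
    by (rule unit_time_continuous(2)[symmetric]) (intro continuous_intros cont)
  also have "\<dots> = (LINT t|unit_time. exp (- (l * t)) * \<phi> t * F)"
  proof (rule integral_cong_AE[OF _ _ ode])
    show "(\<lambda>t. exp (- (l * t)) * (U' t - l * U t)) \<in> borel_measurable unit_time"
      by (intro borel_measurable_integrable unit_time_continuous(1) continuous_intros cont)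
    have "(\<lambda>t. exp (- (l * t))) \<in> borel_measurable unit_time"
      by (intro borel_measurable_integrable unit_time_continuous(1) continuous_intros)
    then show "(\<lambda>t. exp (- (l * t)) * \<phi> t * F) \<in> borel_measurable unit_time"
      using \<phi> by (simp add: L1_def)
  qed
  also have "\<dots> = laplace_transform \<phi> l * F" by (simp add: laplace_transform_def)
  finally have *: "laplace_transform \<phi> l * F = exp (- l) * U 1 - U 0" by simp
  have "U 1 = (LINT p|lebesgue_on Omega. g1 p * ?V p)" "U 0 = (LINT p|lebesgue_on Omega. g0 p * ?V p)"
    unfolding U_def using u0 u1 L2_D(1)[OF L(1)[of 0]] L2_D(1)[OF L(1)[of 1]] L2_D(1)[OF g(1)] L2_D(1)[OF g(2)] L2_D(1)[OF hyp_mode_L2]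
    by (auto intro!: integral_cong_AE)
  with * show ?thesis by (simp add: F_def)
qed

section \<open>Interpolation of the hyperbolic modes in the spectral parameter\<close>

text \<open>The k-th Taylor coefficient at 0 of the m-th z-derivative. The power series in z treats
  positive and negative z alike, so one real function contains both the hyperbolic modes and the
  cosines.\<close>

definition osc_coeff :: "real \<Rightarrow> nat \<Rightarrow> nat \<Rightarrow> real" where
  "osc_coeff x m k = fact (k + m) / fact k * (x ^ (2 * (k + m)) / fact (2 * (k + m)))"

text \<open>\<open>osc x 0 z\<close> is the entire function $\cosh(\sqrt{z}\,x)$ of \<open>z\<close>, and \<open>osc x m\<close> is its \<open>m\<close>-th
  derivative in \<open>z\<close>.\<close>

definition osc :: "real \<Rightarrow> nat \<Rightarrow> real \<Rightarrow> real" where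
  "osc x m z = (\<Sum>k. osc_coeff x m k * z ^ k)"

text \<open>Since (k+m)! m! is at most (2(k+m))!, the m-th derivative gains a factor 1/m!. This is
  the quantitative form of order 1/2 and the source of the second factorial in the extrapolation
  error.\<close>

lemma osc_coeff_bound:
  assumes "0 \<le> x" "x \<le> 1"
  shows "\<bar>osc_coeff x m k\<bar> \<le> 1 / (fact k * fact m)"
proof -
  have "(fact (k + m) * fact m :: nat) \<le> fact (k + m) * fact (k + m)"
    by (intro mult_left_mono fact_mono) auto
  also have "\<dots> \<le> fact ((k + m) + (k + m))"
    by (intro dvd_imp_le fact_fact_dvd_fact) simp
  finally have "real (fact (k + m) * fact m) \<le> real (fact (2 * (k + m)))"
    unfolding mult_2 of_nat_le_iff .
  then have a: "fact (k + m) / fact (2 * (k + m)) \<le> (1 / fact m :: real)"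
    by (simp add: field_simps)
  have "\<bar>osc_coeff x m k\<bar> = (1 / fact k) * (fact (k + m) / fact (2 * (k + m))) * x ^ (2 * (k + m))"
    using assms by (simp add: osc_coeff_def abs_mult)
  also have "\<dots> \<le> (1 / fact k) * (1 / fact m) * 1"
    using assms by (intro mult_mono a power_le_one order_refl) auto
  finally show ?thesis by simp
qed

lemma osc_coeff_term_bound:
  assumes "0 \<le> x" "x \<le> 1"
  shows "norm (osc_coeff x m k * z ^ k) \<le> (1 / fact m) * (\<bar>z\<bar> ^ k /\<^sub>R fact k)"
proof -
  have "norm (osc_coeff x m k * z ^ k) \<le> (1 / (fact k * fact m)) * \<bar>z\<bar> ^ k"
    using mult_right_mono[OF osc_coeff_bound[OF assms, of m k], of "\<bar>z\<bar> ^ k"] by (simp add: abs_mult power_abs)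
  then show ?thesis by (simp add: field_simps)
qed

lemma exp_series_scaled: "(\<lambda>k. (1 / fact m) * (\<bar>z\<bar> ^ k /\<^sub>R fact k)) sums (exp \<bar>z\<bar> / fact m)" for z :: real
  using sums_mult[OF exp_converges[of "\<bar>z\<bar>"], of "1 / fact m"] by simp

lemma osc_summable:
  assumes "0 \<le> x" "x \<le> 1"
  shows "summable (\<lambda>k. osc_coeff x m k * z ^ k)"
  by (rule summable_comparison_test'[OF sums_summable[OF exp_series_scaled], of 0])
     (use osc_coeff_term_bound[OF assms] in auto)

lemma osc_bound:
  assumes "0 \<le> x" "x \<le> 1"
  shows "\<bar>osc x m z\<bar> \<le> exp \<bar>z\<bar> / fact m"
  using norm_suminf_le[OF osc_coeff_term_bound[OF assms] sums_summable[OF exp_series_scaled]]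
  unfolding osc_def sums_unique[OF exp_series_scaled, symmetric] by simp

lemma osc_derivative:
  assumes "0 \<le> x" "x \<le> 1"
  shows "(osc x m has_real_derivative osc x (Suc m) z) (at z)"
proof -
  have "diffs (osc_coeff x m) = osc_coeff x (Suc m)"
  proof (rule ext)
    fix n
    have "real (Suc n) * (1 / fact (Suc n)) = 1 / fact n"
      unfolding fact_Suc by (simp del: of_nat_Suc)
    then have "real (Suc n) * (fact (n + Suc m) / fact (Suc n) * c) = fact (n + Suc m) / fact n * c" for c :: real
      by (simp add: field_simps del: fact_Suc of_nat_Suc add_Suc_right)
    then show "diffs (osc_coeff x m) n = osc_coeff x (Suc m) n"
      unfolding diffs_def osc_coeff_def add_Suc_shift .
  qed
  then show ?thesis
    using termdiffs_strong_converges_everywhere[OF osc_summable[OF assms], of m z]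
    unfolding osc_def[abs_def] by simp
qed

lemma osc_cosh: "osc x 0 (a\<^sup>2) = cosh (a * x)"
proof -
  have "(\<lambda>n. if even n then (a * x) ^ n /\<^sub>R fact n else 0) sums cosh (a * x)" by (rule cosh_converges)
  then have "(\<lambda>n. if even (2 * n) then (a * x) ^ (2 * n) /\<^sub>R fact (2 * n) else 0) sums cosh (a * x)"
    by (subst sums_mono_reindex) (auto simp: strict_mono_def elim!: evenE)
  then have "(\<lambda>k. osc_coeff x 0 k * (a\<^sup>2) ^ k) sums cosh (a * x)"
    by (simp add: osc_coeff_def power_mult_distrib power_mult[symmetric] field_simps)
  then show ?thesis unfolding osc_def by (rule sums_unique[symmetric])
qed

lemma osc_cos: "osc x 0 (- a\<^sup>2) = cos (a * x)"
proof -
  have "(\<lambda>n. (- 1) ^ n / (fact (2 * n)) * (a * x) ^ (2 * n)) sums cos (a * x)" by (rule cos_paired)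
  moreover have "(- 1) ^ k / (fact (2 * k)) * (a * x) ^ (2 * k) = osc_coeff x 0 k * (- a\<^sup>2) ^ k" for k
    by (simp add: osc_coeff_def power_mult_distrib power_mult[symmetric] power_minus[of "a\<^sup>2"])
  ultimately have "(\<lambda>k. osc_coeff x 0 k * (- a\<^sup>2) ^ k) sums cos (a * x)" by (simp only:)
  then show ?thesis unfolding osc_def by (rule sums_unique[symmetric])
qed

section \<open>Divided differences and the extrapolation error\<close>

lemma generalized_Rolle:
  fixes G :: "nat \<Rightarrow> real \<Rightarrow> real"
  assumes "\<And>k z. (G k has_real_derivative G (Suc k) z) (at z)"
    and "\<And>i. i < m \<Longrightarrow> y i < y (Suc i)" and "\<And>i. i \<le> m \<Longrightarrow> G 0 (y i) = 0"
  shows "\<exists>\<xi>\<in>{y 0..y m}. G m \<xi> = 0"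
  using assms
proof (induction m arbitrary: G y)
  case 0
  then show ?case by auto
next
  case (Suc m)
  have "\<exists>z. y i < z \<and> z < y (Suc i) \<and> G 1 z = 0" if "i \<le> m" for i
  proof -
    have "\<exists>z. y i < z \<and> z < y (Suc i) \<and> (*) (G (Suc 0) z) = (\<lambda>v. 0)"
    proof (rule Rolle_deriv)
      show "continuous_on {y i..y (Suc i)} (G 0)"
        using Suc.prems(1) by (intro DERIV_continuous_on) (auto intro: DERIV_subset)
      show "(G 0 has_derivative (*) (G (Suc 0) x)) (at x)" for x
        using Suc.prems(1)[of 0 x] by (simp add: has_field_derivative_def)
    qed (use Suc.prems(2,3) that in auto)
    then show ?thesis by (metis One_nat_def mult.right_neutral)
  qed
  then obtain z where z: "\<And>i. i \<le> m \<Longrightarrow> y i < z i \<and> z i < y (Suc i) \<and> G 1 (z i) = 0" by metis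
  have "\<exists>\<xi>\<in>{z 0..z m}. G (Suc m) \<xi> = 0"
  proof (rule Suc.IH[of "\<lambda>k. G (Suc k)"])
    show "z i < z (Suc i)" if "i < m" for i
      using z[of i] z[of "Suc i"] that by force
  qed (use Suc.prems(1) z in auto)
  moreover have "y 0 < z 0" "z m < y (Suc m)" using z by auto
  ultimately show ?case by force
qed

text \<open>Subtracting the Lagrange interpolant \<open>P\<close> at all \<open>m + 1\<close> nodes
  leaves a function with \<open>m + 1\<close> zeros, whose m-th derivative vanishes somewhere. The
  m-th derivative of \<open>P\<close> is the constant m! times its coefficient of degree m, which is
  the divided difference.\<close>

lemma divided_difference_mean_value:
  fixes G :: "nat \<Rightarrow> real \<Rightarrow> real"
  assumes der: "\<And>k z. (G k has_real_derivative G (Suc k) z) (at z)"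
    and y: "\<And>i. i < m \<Longrightarrow> y i < y (Suc i)"
  shows "\<exists>\<xi>\<in>{y 0..y m}. (\<Sum>i\<le>m. G 0 (y i) / (\<Prod>j\<in>{..m} - {i}. y i - y j)) = G m \<xi> / fact m"
proof -
  have mono: "y i < y j" if "i < j" "j \<le> m" for i j
    using that
  proof (induction j)
    case (Suc j)
    then show ?case using y[of j] by (cases "i = j") (auto intro: less_trans)
  qed simp
  have inj: "y i \<noteq> y j" if "i \<le> m" "j \<le> m" "i \<noteq> j" for i j
    using mono[of i j] mono[of j i] that by (cases i j rule: linorder_cases) auto
  define L where "L i = (\<Prod>j\<in>{..m} - {i}. [:- y j, 1:])" for i
  define a where "a i = G 0 (y i) / (\<Prod>j\<in>{..m} - {i}. y i - y j)" for i
  define P where "P = (\<Sum>i\<le>m. smult (a i) (L i))"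
  have L: "degree (L i) = m" "coeff (L i) m = 1" if "i \<le> m" for i
  proof -
    have "degree (L i) = (\<Sum>j\<in>{..m} - {i}. degree [:- y j, 1:])"
      unfolding L_def by (intro degree_prod_eq_sum_degree) auto
    then show d: "degree (L i) = m" using that by simp
    show "coeff (L i) m = 1" using lead_coeff_prod[of "\<lambda>j. [:- y j, 1:]" "{..m} - {i}"] d by (simp add: L_def)
  qed
  have degP: "degree P \<le> m"
    unfolding P_def using L(1) by (intro degree_sum_le) (auto intro: order_trans[OF degree_smult_le])
  have coP: "coeff P m = (\<Sum>i\<le>m. a i)"
    unfolding P_def using L(2) by (simp add: coeff_sum)
  have Ly: "poly (L i) (y k) = (if i = k then (\<Prod>j\<in>{..m} - {i}. y i - y j) else 0)" if "i \<le> m" "k \<le> m" for i k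
  proof -
    have "poly (L i) (y k) = (\<Prod>j\<in>{..m} - {i}. y k - y j)" by (simp add: L_def poly_prod)
    moreover have "(\<Prod>j\<in>{..m} - {i}. y k - y j) = 0" if "i \<noteq> k"
      using that \<open>k \<le> m\<close> by (intro prod_zero) auto
    ultimately show ?thesis by auto
  qed
  have Py: "poly P (y k) = G 0 (y k)" if "k \<le> m" for k
  proof -
    have "poly P (y k) = (\<Sum>i\<le>m. a i * poly (L i) (y k))" by (simp add: P_def poly_sum)
    also have "\<dots> = (\<Sum>i\<le>m. if i = k then a i * (\<Prod>j\<in>{..m} - {i}. y i - y j) else 0)"
      using Ly that by (intro sum.cong) auto
    also have "\<dots> = a k * (\<Prod>j\<in>{..m} - {k}. y k - y j)" using that by simp
    also have "\<dots> = G 0 (y k)"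
    proof -
      have "(\<Prod>j\<in>{..m} - {k}. y k - y j) \<noteq> 0" using inj[OF that] by auto
      then show ?thesis by (simp add: a_def)
    qed
    finally show ?thesis .
  qed
  have "\<exists>\<xi>\<in>{y 0..y m}. (\<lambda>k z. G k z - poly ((pderiv ^^ k) P) z) m \<xi> = 0"
  proof (rule generalized_Rolle)
    show "((\<lambda>z. G k z - poly ((pderiv ^^ k) P) z) has_real_derivative G (Suc k) z - poly ((pderiv ^^ Suc k) P) z) (at z)" for k z
      using DERIV_diff[OF der poly_DERIV[of "(pderiv ^^ k) P"]] by simp
  qed (use y Py in auto)
  then obtain \<xi> where \<xi>: "\<xi> \<in> {y 0..y m}" "G m \<xi> = poly ((pderiv ^^ m) P) \<xi>" by auto
  have "(pderiv ^^ m) P = [:fact m * coeff P m:]"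
  proof (rule poly_eqI)
    fix n
    show "coeff ((pderiv ^^ m) P) n = coeff [:fact m * coeff P m:] n"
      using degP coeff_eq_0[of P "n + m"]
      by (cases n) (simp_all add: coeff_higher_pderiv pochhammer_fact[symmetric])
  qed
  with \<xi>(2) coP have "(\<Sum>i\<le>m. a i) = G m \<xi> / fact m" by simp
  with \<xi>(1) show ?thesis unfolding a_def by blast
qed

text \<open>The value at \<open>y 0\<close> of the Lagrange interpolant with the nodes \<open>y 1, \<dots>, y m\<close> is the sum of the
  values at the nodes with these weights.\<close>

definition extrapolation_weight :: "(nat \<Rightarrow> real) \<Rightarrow> nat \<Rightarrow> nat \<Rightarrow> real" where
  "extrapolation_weight y m i = - (\<Prod>j\<in>{1..m}. y 0 - y j) / (\<Prod>j\<in>{..m} - {i}. y i - y j)"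

text \<open>Multiplying the divided difference over all nodes including \<open>y 0\<close> by the
  product of the \<open>y 0 - y j\<close> isolates the value at \<open>y 0\<close> and gives exactly
  the error. One factorial stems from the divided difference, the other from the bound on the m-th
  derivative.\<close>

lemma extrapolation_error:
  assumes x: "0 \<le> x" "x \<le> 1" and y: "\<And>i. i < m \<Longrightarrow> y i < y (Suc i)" and R: "\<And>i. i \<le> m \<Longrightarrow> \<bar>y i\<bar> \<le> R"
  shows "\<bar>osc x 0 (y 0) - (\<Sum>i=1..m. extrapolation_weight y m i * osc x 0 (y i))\<bar>
    \<le> (2 * R) ^ m * (exp R / (fact m)\<^sup>2)"
proof -
  obtain \<xi> where \<xi>: "\<xi> \<in> {y 0..y m}"
    and eq: "(\<Sum>i\<le>m. osc x 0 (y i) / (\<Prod>j\<in>{..m} - {i}. y i - y j)) = osc x m \<xi> / fact m"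
    using divided_difference_mean_value[where G = "osc x" and m = m and y = y, OF osc_derivative[OF x] y] by blast
  define Pr where "Pr = (\<Prod>j\<in>{1..m}. y 0 - y j)"
  have mono: "y 0 < y j" if "0 < j" "j \<le> m" for j
    using that
  proof (induction j)
    case (Suc j)
    then show ?case using y[of j] by (cases "j = 0") auto
  qed simp
  have "y 0 - y j \<noteq> 0" if "j \<in> {1..m}" for j
    using mono[of j] that by simp
  then have "Pr \<noteq> 0" unfolding Pr_def by simp
  have dom: "{..m} - {0} = {1..m}" by auto
  have "Pr * (\<Sum>i\<le>m. osc x 0 (y i) / (\<Prod>j\<in>{..m} - {i}. y i - y j))
    = Pr * (osc x 0 (y 0) / Pr) + (\<Sum>i=1..m. Pr * (osc x 0 (y i) / (\<Prod>j\<in>{..m} - {i}. y i - y j)))"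
    by (subst sum.remove[of _ 0]) (auto simp: dom Pr_def distrib_left sum_distrib_left)
  also have "\<dots> = osc x 0 (y 0) - (\<Sum>i=1..m. extrapolation_weight y m i * osc x 0 (y i))"
    unfolding extrapolation_weight_def Pr_def[symmetric] using \<open>Pr \<noteq> 0\<close> by (simp add: sum_negf)
  finally have *: "osc x 0 (y 0) - (\<Sum>i=1..m. extrapolation_weight y m i * osc x 0 (y i)) = Pr * (osc x m \<xi> / fact m)"
    unfolding eq by simp
  have "\<bar>Pr\<bar> \<le> (\<Prod>j\<in>{1..m}. 2 * R)"
    unfolding Pr_def abs_prod
  proof (rule prod_mono)
    fix j assume "j \<in> {1..m}"
    then show "0 \<le> \<bar>y 0 - y j\<bar> \<and> \<bar>y 0 - y j\<bar> \<le> 2 * R" using R[of 0] R[of j] by auto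
  qed
  then have 1: "\<bar>Pr\<bar> \<le> (2 * R) ^ m" by simp
  have "\<bar>\<xi>\<bar> \<le> R" using \<xi> R[of 0] R[of m] by auto
  then have "\<bar>osc x m \<xi>\<bar> \<le> exp R / fact m"
    using osc_bound[OF x, of m \<xi>] by (smt (verit) divide_right_mono exp_le_cancel_iff fact_ge_zero)
  then have "\<bar>osc x m \<xi> / fact m\<bar> \<le> exp R / (fact m)\<^sup>2"
    by (simp add: power2_eq_square divide_right_mono flip: divide_divide_eq_left)
  with 1 show ?thesis unfolding * abs_mult by (intro mult_mono) auto
qed

text \<open>Every factor of the denominator is bounded below by the smallest gap. The estimate is
  crude, but for \<open>R\<close> and the inverse gap polynomial in N and m = N^2 it costs only
  exp(O(N^2 ln N)).\<close>

lemma extrapolation_weight_bound: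
  assumes \<delta>: "0 < \<delta>" and y: "\<And>i. i < m \<Longrightarrow> y i + \<delta> \<le> y (Suc i)" and R: "\<And>i. i \<le> m \<Longrightarrow> \<bar>y i\<bar> \<le> R" and i: "i \<le> m"
  shows "\<bar>extrapolation_weight y m i\<bar> \<le> (2 * R / \<delta>) ^ m"
proof -
  have gap: "y i + \<delta> \<le> y j" if "i < j" "j \<le> m" for i j
    using that
  proof (induction j)
    case (Suc j)
    then show ?case using y[of j] \<delta> by (cases "i = j") auto
  qed simp
  have "\<bar>\<Prod>j\<in>{1..m}. y 0 - y j\<bar> \<le> (\<Prod>j\<in>{1..m}. 2 * R)"
    unfolding abs_prod
  proof (rule prod_mono)
    fix j assume "j \<in> {1..m}"
    then show "0 \<le> \<bar>y 0 - y j\<bar> \<and> \<bar>y 0 - y j\<bar> \<le> 2 * R" using R[of 0] R[of j] by auto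
  qed
  then have 1: "\<bar>\<Prod>j\<in>{1..m}. y 0 - y j\<bar> \<le> (2 * R) ^ m" by simp
  have "(\<Prod>j\<in>{..m} - {i}. \<delta>) \<le> \<bar>\<Prod>j\<in>{..m} - {i}. y i - y j\<bar>"
    unfolding abs_prod
  proof (rule prod_mono)
    fix j assume "j \<in> {..m} - {i}"
    then have "i < j \<or> j < i" "j \<le> m" by auto
    then show "0 \<le> \<delta> \<and> \<delta> \<le> \<bar>y i - y j\<bar>" using gap[of i j] gap[of j i] i \<delta> by auto
  qed
  then have 2: "\<delta> ^ m \<le> \<bar>\<Prod>j\<in>{..m} - {i}. y i - y j\<bar>" using i by simp
  have "0 \<le> 2 * R" using R[OF i] by linarith
  then show ?thesis
    unfolding extrapolation_weight_def abs_divide abs_minus_cancel power_divide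
    using 1 2 \<delta> by (intro frac_le) auto
qed

section \<open>Lower bound for the Laplace transform near the origin\<close>

lemma bounded_mult_integrable:
  assumes f: "integrable unit_time f" and g: "continuous_on {0..1} g" "\<And>t. t \<in> {0..1} \<Longrightarrow> \<bar>g t\<bar> \<le> B"
  shows "integrable unit_time (\<lambda>t. g t * f t)" "\<bar>LINT t|unit_time. g t * f t\<bar> \<le> B * L1_norm unit_time f"
proof -
  have *: "\<bar>g t * f t\<bar> \<le> B * \<bar>f t\<bar>" if "t \<in> space unit_time" for t
  proof -
    have "\<bar>g t\<bar> \<le> B" using that by (intro g(2)) auto
    then show ?thesis by (simp add: abs_mult mult_right_mono)
  qed
  have B: "0 \<le> B" using g(2)[of 0] by simp
  show i: "integrable unit_time (\<lambda>t. g t * f t)"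
  proof (rule Bochner_Integration.integrable_bound[of _ "\<lambda>t. B * f t"])
    show "(\<lambda>t. g t * f t) \<in> borel_measurable unit_time"
      using f borel_measurable_integrable[OF unit_time_continuous(1)[OF g(1)]] by simp
    show "AE t in unit_time. norm (g t * f t) \<le> norm (B * f t)"
      using * B by (intro AE_I2) (simp add: abs_mult)
  qed (use f in simp)
  have "\<bar>LINT t|unit_time. g t * f t\<bar> \<le> (LINT t|unit_time. \<bar>g t * f t\<bar>)" by (rule integral_abs_bound)
  also have "\<dots> \<le> (LINT t|unit_time. B * \<bar>f t\<bar>)"
    using i f * by (intro integral_mono) auto
  finally show "\<bar>LINT t|unit_time. g t * f t\<bar> \<le> B * L1_norm unit_time f" by (simp add: L1_norm_def)
qed

lemma L1_norm_nonneg: "0 \<le> L1_norm M f"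
  by (simp add: L1_norm_def)

lemma laplace_transform_diff:
  assumes "\<phi> \<in> L1 unit_time" "\<psi> \<in> L1 unit_time" "0 \<le> l"
  shows "\<bar>laplace_transform \<phi> l - laplace_transform \<psi> l\<bar> \<le> L1_norm unit_time (\<lambda>t. \<phi> t - \<psi> t)"
proof -
  have c: "continuous_on {0..1} (\<lambda>t. exp (- (l * t)))" by (intro continuous_intros)
  have b: "\<bar>exp (- (l * t))\<bar> \<le> 1" if "t \<in> {0..1}" for t using that assms by simp
  have "laplace_transform \<phi> l - laplace_transform \<psi> l = (LINT t|unit_time. exp (- (l * t)) * (\<phi> t - \<psi> t))"
    unfolding laplace_transform_def
    using bounded_mult_integrable(1)[OF _ c b, of \<phi>] bounded_mult_integrable(1)[OF _ c b, of \<psi>] assms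
    by (simp add: L1_def right_diff_distrib)
  then show ?thesis
    using bounded_mult_integrable(2)[OF _ c b, of "\<lambda>t. \<phi> t - \<psi> t"] assms by (simp add: L1_def)
qed

text \<open>Expand exp(-l t) to order \<open>p\<close>, the index of the first non-zero moment: the
  lower terms integrate to 0, the term of order \<open>p\<close> gives \<open>b * l ^ p\<close> in
  absolute value, and the remainder is of order l^(p+1).\<close>

lemma laplace_transform_lower_bound:
  assumes \<phi>: "\<phi> \<in> L1 unit_time" and nz: "\<not> (AE t in unit_time. \<phi> t = 0)"
  obtains c l0 :: real and p :: nat where "0 < c" "0 < l0" "\<And>l. 0 < l \<Longrightarrow> l \<le> l0 \<Longrightarrow> c * l ^ p \<le> \<bar>laplace_transform \<phi> l\<bar>"
proof -
  have i: "integrable unit_time \<phi>" using \<phi> by (simp add: L1_def)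
  define M where "M k = (LINT t|unit_time. t ^ k * \<phi> t)" for k
  have "\<exists>k. M k \<noteq> 0" using moments_zero_AE[OF i] nz unfolding M_def by blast
  then obtain p where p: "M p \<noteq> 0" and least: "\<And>k. k < p \<Longrightarrow> M k = 0"
    using LeastI_ex[of "\<lambda>k. M k \<noteq> 0"] not_less_Least[of _ "\<lambda>k. M k \<noteq> 0"] by blast
  define A where "A = L1_norm unit_time \<phi>"
  have A: "0 \<le> A" by (simp add: A_def L1_norm_nonneg)
  define b where "b = \<bar>M p\<bar> / fact p"
  have b: "b > 0" using p by (simp add: b_def)
  \<comment> \<open>The bound 1 on \<open>l\<close> keeps the exponential in the Taylor remainder
    below 3, so the remainder contributes at most \<open>3 * l ^ Suc p * A\<close>; the other bound
    makes this at most half of the leading term, which leaves \<open>b / 2\<close>.\<close>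
  show ?thesis
  proof (rule that[of "b / 2" "min 1 (b / (6 * (A + 1)))" p])
    show "0 < b / 2" "0 < min 1 (b / (6 * (A + 1)))" using b A by auto
    fix l :: real assume l: "0 < l" "l \<le> min 1 (b / (6 * (A + 1)))"
    define r where "r t = exp (- (l * t)) - (\<Sum>k\<le>p. (- (l * t)) ^ k / fact k)" for t
    have rb: "\<bar>r t\<bar> \<le> 3 * l ^ Suc p" if t: "t \<in> {0..1}" for t
    proof -
      obtain s where s: "\<bar>s\<bar> \<le> \<bar>- (l * t)\<bar>" 
        "exp (- (l * t)) = (\<Sum>m<Suc p. (- (l * t)) ^ m / fact m) + exp s / fact (Suc p) * (- (l * t)) ^ Suc p"
        using Maclaurin_exp_le by blast
      have lt: "0 \<le> l * t" "l * t \<le> l" using l t by (auto simp: mult_left_le)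
      have "\<bar>s\<bar> \<le> 1" using s(1) lt l by linarith
      then have e3: "exp s \<le> 3" using exp_le exp_le_cancel_iff[of s 1] by linarith
      have "3 * 1 \<le> (3::real) * fact (Suc p)" by (intro mult_left_mono fact_ge_1) simp
      with e3 have "exp s \<le> 3 * fact (Suc p)" by linarith
      then have e: "exp s / fact (Suc p) \<le> 3" by (simp add: divide_le_eq del: fact_Suc)
      have "r t = exp s / fact (Suc p) * (- (l * t)) ^ Suc p"
        using s(2) by (simp add: r_def lessThan_Suc_atMost del: fact_Suc power_Suc sum.lessThan_Suc)
      then have "\<bar>r t\<bar> = exp s / fact (Suc p) * (l * t) ^ Suc p"
        using lt t by (simp add: abs_mult power_abs del: fact_Suc power_Suc)
      also have "\<dots> \<le> 3 * l ^ Suc p"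
        using e lt by (intro mult_mono power_mono) auto
      finally show ?thesis .
    qed
    have rc: "continuous_on {0..1} r" unfolding r_def by (intro continuous_intros) auto
    have int: "integrable unit_time (\<lambda>t. t ^ k * \<phi> t)" for k
      by (rule bounded_mult_integrable(1)[OF i, where B = 1]) (auto intro!: continuous_intros power_le_one simp: power_abs)
    have "laplace_transform \<phi> l = (LINT t|unit_time. (\<Sum>k\<le>p. ((- l) ^ k / fact k) * (t ^ k * \<phi> t)) + r t * \<phi> t)"
      unfolding laplace_transform_def
    proof (intro Bochner_Integration.integral_cong refl)
      fix t
      have "(- (l * t)) ^ k = (- l) ^ k * t ^ k" for k by (metis minus_mult_left power_mult_distrib)
      then have "(\<Sum>k\<le>p. ((- l) ^ k / fact k) * (t ^ k * \<phi> t)) = (\<Sum>k\<le>p. (- (l * t)) ^ k / fact k) * \<phi> t"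
        unfolding sum_distrib_right by (intro sum.cong) simp_all
      then show "exp (- (l * t)) * \<phi> t = (\<Sum>k\<le>p. ((- l) ^ k / fact k) * (t ^ k * \<phi> t)) + r t * \<phi> t"
        by (simp add: r_def left_diff_distrib)
    qed
    also have "\<dots> = (\<Sum>k\<le>p. ((- l) ^ k / fact k) * M k) + (LINT t|unit_time. r t * \<phi> t)"
      using int bounded_mult_integrable(1)[OF i rc rb] by (simp add: M_def)
    also have "(\<Sum>k\<le>p. ((- l) ^ k / fact k) * M k) = ((- l) ^ p / fact p) * M p"
      using least by (simp add: atMost_Suc sum.lessThan_Suc flip: lessThan_Suc_atMost)
    finally have D: "laplace_transform \<phi> l = ((- l) ^ p / fact p) * M p + (LINT t|unit_time. r t * \<phi> t)" .
    have "\<bar>LINT t|unit_time. r t * \<phi> t\<bar> \<le> 3 * l ^ Suc p * A"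
      unfolding A_def by (rule bounded_mult_integrable(2)[OF i rc rb])
    also have "\<dots> = l ^ p * (3 * (l * A))" by simp
    also have "\<dots> \<le> l ^ p * (b / 2)"
    proof (rule mult_left_mono)
      have "l * (6 * (A + 1)) \<le> b" using l A by (simp add: pos_le_divide_eq)
      then show "3 * (l * A) \<le> b / 2" using l by (simp add: algebra_simps)
    qed (use l in simp)
    finally have E: "\<bar>LINT t|unit_time. r t * \<phi> t\<bar> \<le> l ^ p * (b / 2)" .
    have "\<bar>((- l) ^ p / fact p) * M p\<bar> = l ^ p * b"
      using l by (simp add: b_def abs_mult power_abs)
    with D E have "l ^ p * b - l ^ p * (b / 2) \<le> \<bar>laplace_transform \<phi> l\<bar>" by linarith
    then show "b / 2 * l ^ p \<le> \<bar>laplace_transform \<phi> l\<bar>" by (simp add: algebra_simps)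
  qed
qed

section \<open>The regularised reconstruction\<close>

text \<open>The power 3 is one more than the exponent in the number N^2 of nodes. All points then
  lie below 1/N, hence eventually in the unknown range where the transform is bounded below, while
  their distances and the smallest point remain polynomial in 1/N.\<close>

definition sample_point :: "nat \<Rightarrow> nat \<Rightarrow> real" where
  "sample_point N i = real i / real N ^ 3"

text \<open>Index 0 is the target of the extrapolation, where the entire function becomes the
  cosine; the other indices are the values of z belonging to the sample points.\<close>

definition node :: "nat \<Rightarrow> nat \<times> nat \<Rightarrow> nat \<Rightarrow> real" where
  "node N \<kappa> i = (if i = 0 then - (real (fst \<kappa>) * pi)\<^sup>2 else (real (snd \<kappa>) * pi)\<^sup>2 + sample_point N i)"

definition sample_mode :: "nat \<Rightarrow> nat \<Rightarrow> nat \<Rightarrow> real \<times> real \<Rightarrow> real" where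
  "sample_mode N n i = hyp_mode (sqrt ((real n * pi)\<^sup>2 + sample_point N i)) n"

text \<open>The source identity solved for the integral of the source against the mode, with given
  data inserted. For large noise the denominator may be 0; the quotient is then 0 and the
  reconstruction stays total.\<close>

definition sample_coeff :: "nat \<Rightarrow> (real \<times> real \<Rightarrow> real) \<Rightarrow> (real \<times> real \<Rightarrow> real) \<Rightarrow> (real \<Rightarrow> real) \<Rightarrow> nat \<Rightarrow> nat \<Rightarrow> real" where
  "sample_coeff N g0 g1 \<phi> n i =
    (exp (- sample_point N i) * (LINT p|lebesgue_on Omega. g1 p * sample_mode N n i p)
       - (LINT p|lebesgue_on Omega. g0 p * sample_mode N n i p)) / laplace_transform \<phi> (sample_point N i)"

definition mode_scale :: "nat \<times> nat \<Rightarrow> real" where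
  "mode_scale \<kappa> = (if fst \<kappa> = 0 then 1 else sqrt 2) * (if snd \<kappa> = 0 then 1 else sqrt 2)"

abbreviation node_weight :: "nat \<Rightarrow> nat \<times> nat \<Rightarrow> nat \<Rightarrow> real" where
  "node_weight N \<kappa> i \<equiv> extrapolation_weight (node N \<kappa>) (N\<^sup>2) i"

definition recon_coeff :: "nat \<Rightarrow> (real \<times> real \<Rightarrow> real) \<Rightarrow> (real \<times> real \<Rightarrow> real) \<Rightarrow> (real \<Rightarrow> real) \<Rightarrow> nat \<times> nat \<Rightarrow> real" where
  "recon_coeff N g0 g1 \<phi> \<kappa> =
    mode_scale \<kappa> * (\<Sum>i=1..N\<^sup>2. node_weight N \<kappa> i * sample_coeff N g0 g1 \<phi> (snd \<kappa>) i)"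

definition recon :: "nat \<Rightarrow> (real \<times> real \<Rightarrow> real) \<Rightarrow> (real \<times> real \<Rightarrow> real) \<Rightarrow> (real \<Rightarrow> real) \<Rightarrow> real \<times> real \<Rightarrow> real" where
  "recon N g0 g1 \<phi> p =
    (if p \<in> Omega then \<Sum>\<kappa>\<in>modes N. recon_coeff N g0 g1 \<phi> \<kappa> * tensor cmode cmode \<kappa> p else 0)"

lemma sample_mode_L2: "sample_mode N n i \<in> L2\<Omega>"
  unfolding sample_mode_def by (rule hyp_mode_L2)

lemma recon_borel: "recon N g0 g1 \<phi> \<in> borel_measurable (lebesgue_on Omega)"
  "recon N g0 g1 \<phi> \<in> L2\<Omega>"
proof -
  let ?s = "\<lambda>p. \<Sum>\<kappa>\<in>modes N. recon_coeff N g0 g1 \<phi> \<kappa> * tensor cmode cmode \<kappa> p"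
  have s: "?s \<in> L2\<Omega>" by (intro L2_sum L2_cmult mode_L2)
  show m: "recon N g0 g1 \<phi> \<in> borel_measurable (lebesgue_on Omega)"
    using L2_D(1)[OF s] by (rule measurable_cong[THEN iffD1, rotated]) (simp add: recon_def)
  show "recon N g0 g1 \<phi> \<in> L2\<Omega>"
    by (rule L2_cong_AE[OF s m]) (intro AE_I2, simp add: recon_def)
qed

text \<open>The data enter only through integrals, so data equal almost everywhere yield identical
  reconstructions. The extension by zero outside the square gives an element of L2 of the
  plane.\<close>

lemma source_map_recon: "source_map (recon N)"
  unfolding source_map_def
proof (intro conjI ballI impI)
  fix g0 g1 \<phi>
  let ?s = "\<lambda>p. \<Sum>\<kappa>\<in>modes N. recon_coeff N g0 g1 \<phi> \<kappa> * tensor cmode cmode \<kappa> p"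
  have s: "?s \<in> L2\<Omega>" by (intro L2_sum L2_cmult mode_L2)
  have "recon N g0 g1 \<phi> = (\<lambda>p. if p \<in> Omega then ?s p else 0)" by (rule ext) (simp add: recon_def)
  moreover have "(\<lambda>p. if p \<in> Omega then ?s p else 0) \<in> borel_measurable lebesgue"
    using L2_D(1)[OF s] by (simp add: borel_measurable_if)
  moreover have "(\<lambda>p. (recon N g0 g1 \<phi> p)\<^sup>2) = (\<lambda>p. if p \<in> Omega then (?s p)\<^sup>2 else 0)"
    by (rule ext) (simp add: recon_def)
  moreover have "integrable lebesgue (\<lambda>p. if p \<in> Omega then (?s p)\<^sup>2 else 0)"
    using L2_D(2)[OF s] by (simp add: Lebesgue_Measure.integrable_restrict_UNIV)
  ultimately show "recon N g0 g1 \<phi> \<in> L2 lebesgue" unfolding L2_def by simp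
next
  fix g0 g1 \<phi> h0 h1 \<psi>
  assume L: "g0 \<in> L2\<Omega>" "g1 \<in> L2\<Omega>" "\<phi> \<in> L1 unit_time" "h0 \<in> L2\<Omega>" "h1 \<in> L2\<Omega>" "\<psi> \<in> L1 unit_time"
    and eq: "AE p in lebesgue_on Omega. g0 p = h0 p" "AE p in lebesgue_on Omega. g1 p = h1 p" "AE t in unit_time. \<phi> t = \<psi> t"
  have i: "(LINT p|lebesgue_on Omega. g p * sample_mode N n i p) = (LINT p|lebesgue_on Omega. h p * sample_mode N n i p)"
    if "g \<in> L2\<Omega>" "h \<in> L2\<Omega>" "AE p in lebesgue_on Omega. g p = h p" for g h n i
    using that(3) L2_D(1)[OF that(1)] L2_D(1)[OF that(2)] L2_D(1)[OF sample_mode_L2]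
    by (intro integral_cong_AE) auto
  have "laplace_transform \<phi> l = laplace_transform \<psi> l" for l
  proof -
    have "(\<lambda>t. exp (- (l * t))) \<in> borel_measurable unit_time"
      by (intro borel_measurable_integrable unit_time_continuous(1) continuous_intros)
    then show ?thesis unfolding laplace_transform_def
      using eq(3) L(3,6) by (intro integral_cong_AE) (auto simp: L1_def)
  qed
  then have "recon N g0 g1 \<phi> = recon N h0 h1 \<psi>"
    using i[OF L(1,4) eq(1)] i[OF L(2,5) eq(2)]
    by (intro ext) (simp add: recon_def recon_coeff_def sample_coeff_def)
  then show "AE p in lebesgue. recon N g0 g1 \<phi> p = recon N h0 h1 \<psi> p" by simp
qed

section \<open>Size of the nodes, modes and weights\<close>

lemma sample_point_bounds:
  assumes "1 \<le> i" "i \<le> N\<^sup>2"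
  shows "1 / real N ^ 3 \<le> sample_point N i" "sample_point N i \<le> 1 / real N"
proof -
  have N: "N > 0" using assms by (cases N) auto
  have "real i \<le> real N ^ 2" using assms(2) by (metis of_nat_le_iff of_nat_power)
  then have "real i / real N ^ 3 \<le> real N ^ 2 / real N ^ 3" by (rule divide_right_mono) simp
  then show "sample_point N i \<le> 1 / real N"
    using N by (simp add: sample_point_def power2_eq_square power3_eq_cube)
  show "1 / real N ^ 3 \<le> sample_point N i"
    using assms(1) by (simp add: sample_point_def divide_right_mono)
qed

text \<open>As pi < 4, the squares of k pi with k < N are at most 16 N^2; a sample point adds at
  most 1, hence 17. The first gap is also large enough, since the target is at most 0 and the first
  node is at least \<open>sample_point N 1\<close>.\<close>

lemma node_bounds:
  assumes \<kappa>: "\<kappa> \<in> modes N"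
  shows "i \<le> N\<^sup>2 \<Longrightarrow> \<bar>node N \<kappa> i\<bar> \<le> 17 * (real N)\<^sup>2"
    and "i < N\<^sup>2 \<Longrightarrow> node N \<kappa> i + 1 / real N ^ 3 \<le> node N \<kappa> (Suc i)"
proof -
  have N: "1 \<le> real N" using \<kappa> by (auto simp: modes_def)
  have sq: "(real k * pi)\<^sup>2 \<le> 16 * (real N)\<^sup>2" if "k < N" for k
  proof -
    have "real k * pi \<le> real N * 4" using that pi_less_4 by (intro mult_mono) auto
    then have "(real k * pi)\<^sup>2 \<le> (real N * 4)\<^sup>2" by (intro power_mono) auto
    then show ?thesis by (simp add: power_mult_distrib)
  qed
  have k: "fst \<kappa> < N" "snd \<kappa> < N" using \<kappa> by (auto simp: modes_def)
  have N2: "1 \<le> (real N)\<^sup>2" using N by (simp add: one_le_power)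
  show "\<bar>node N \<kappa> i\<bar> \<le> 17 * (real N)\<^sup>2" if "i \<le> N\<^sup>2"
  proof (cases "i = 0")
    case True
    then show ?thesis using sq[OF k(1)] N2 by (simp add: node_def)
  next
    case False
    have "1 / real N \<le> 1" using N by simp
    then have s: "0 \<le> sample_point N i" "sample_point N i \<le> 1"
      using sample_point_bounds(2)[of i N] that False by (auto simp del: divide_le_eq_1 simp add: sample_point_def)
    then show ?thesis using False sq[OF k(2)] N2 by (simp add: node_def)
  qed
  show "node N \<kappa> i + 1 / real N ^ 3 \<le> node N \<kappa> (Suc i)" if "i < N\<^sup>2"
  proof (cases "i = 0")
    case True
    have "0 \<le> (real (fst \<kappa>) * pi)\<^sup>2" "0 \<le> (real (snd \<kappa>) * pi)\<^sup>2" by simp_all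
    then show ?thesis using True by (simp add: node_def sample_point_def)
  qed (simp add: node_def sample_point_def add_divide_distrib)
qed

lemma node_sqrt:
  assumes "1 \<le> i"
  shows "(sqrt ((real n * pi)\<^sup>2 + sample_point N i))\<^sup>2 = (real n * pi)\<^sup>2 + sample_point N i"
  by (simp add: sample_point_def)

lemma sample_mode_bound:
  assumes \<kappa>: "\<kappa> \<in> modes N" and i: "1 \<le> i" "i \<le> N\<^sup>2" and p: "p \<in> Omega"
  shows "sample_mode N (snd \<kappa>) i p = osc (fst p) 0 (node N \<kappa> i) * cos (real (snd \<kappa>) * pi * snd p)"
    and "\<bar>sample_mode N (snd \<kappa>) i p\<bar> \<le> exp (17 * (real N)\<^sup>2)"
proof -
  have "osc (fst p) 0 (node N \<kappa> i) = cosh (sqrt ((real (snd \<kappa>) * pi)\<^sup>2 + sample_point N i) * fst p)"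
    using i osc_cosh[of "fst p" "sqrt ((real (snd \<kappa>) * pi)\<^sup>2 + sample_point N i)"] node_sqrt[of i "snd \<kappa>" N]
    by (simp add: node_def)
  then show 1: "sample_mode N (snd \<kappa>) i p = osc (fst p) 0 (node N \<kappa> i) * cos (real (snd \<kappa>) * pi * snd p)"
    by (simp add: sample_mode_def hyp_mode_def)
  have x: "0 \<le> fst p" "fst p \<le> 1" using p by (auto simp: Omega_def)
  have "\<bar>osc (fst p) 0 (node N \<kappa> i)\<bar> \<le> exp \<bar>node N \<kappa> i\<bar>" using osc_bound[OF x, of 0] by simp
  also have "\<dots> \<le> exp (17 * (real N)\<^sup>2)" using node_bounds(1)[OF \<kappa> i(2)] by simp
  finally have "\<bar>osc (fst p) 0 (node N \<kappa> i)\<bar> * \<bar>cos (real (snd \<kappa>) * pi * snd p)\<bar> \<le> exp (17 * (real N)\<^sup>2) * 1"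
    by (intro mult_mono) auto
  then show "\<bar>sample_mode N (snd \<kappa>) i p\<bar> \<le> exp (17 * (real N)\<^sup>2)" unfolding 1 by (simp add: abs_mult)
qed

text \<open>The extrapolation error bound for N^2 nodes of modulus at most R = 17 N^2, with 34 = 2 *
  17.\<close>

definition interp_error :: "nat \<Rightarrow> real" where
  "interp_error N = (34 * (real N)\<^sup>2) ^ (N\<^sup>2) * (exp (17 * (real N)\<^sup>2) / (fact (N\<^sup>2))\<^sup>2)"

text \<open>The weight bound for the same R and N^2 nodes with gap N^(-3): 2 R divided by the gap is
  34 N^5.\<close>

definition weight_bound :: "nat \<Rightarrow> real" where
  "weight_bound N = (34 * real N ^ 5) ^ (N\<^sup>2)"

lemma node_weight_bound:
  assumes \<kappa>: "\<kappa> \<in> modes N" and i: "i \<le> N\<^sup>2"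
  shows "\<bar>node_weight N \<kappa> i\<bar> \<le> weight_bound N"
proof -
  have N: "0 < real N" using \<kappa> by (auto simp: modes_def)
  have "\<bar>node_weight N \<kappa> i\<bar> \<le> (2 * (17 * (real N)\<^sup>2) / (1 / real N ^ 3)) ^ (N\<^sup>2)"
    using N by (intro extrapolation_weight_bound node_bounds[OF \<kappa>] i) auto
  also have "2 * (17 * (real N)\<^sup>2) / (1 / real N ^ 3) = 34 * real N ^ 5"
    by (simp add: power_add[symmetric])
  finally show ?thesis by (simp add: weight_bound_def)
qed

text \<open>The cosine in y is common to the target and all nodes and is pulled out; only the factor
  in x is extrapolated, pointwise in x with weights that do not depend on x.\<close>

lemma mode_interpolation:
  assumes \<kappa>: "\<kappa> \<in> modes N" and p: "p \<in> Omega"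
  shows "\<bar>cos (real (fst \<kappa>) * pi * fst p) * cos (real (snd \<kappa>) * pi * snd p)
      - (\<Sum>i=1..N\<^sup>2. node_weight N \<kappa> i * sample_mode N (snd \<kappa>) i p)\<bar> \<le> interp_error N"
proof -
  have x: "0 \<le> fst p" "fst p \<le> 1" using p by (auto simp: Omega_def)
  have N: "0 < real N" using \<kappa> by (auto simp: modes_def)
  let ?c = "cos (real (snd \<kappa>) * pi * snd p)"
  have 0: "osc (fst p) 0 (node N \<kappa> 0) = cos (real (fst \<kappa>) * pi * fst p)"
    using osc_cos[of "fst p" "real (fst \<kappa>) * pi"] by (simp add: node_def)
  have "(\<Sum>i=1..N\<^sup>2. node_weight N \<kappa> i * sample_mode N (snd \<kappa>) i p)
     = (\<Sum>i=1..N\<^sup>2. node_weight N \<kappa> i * osc (fst p) 0 (node N \<kappa> i)) * ?c"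
    unfolding sum_distrib_right using sample_mode_bound(1)[OF \<kappa> _ _ p] by (intro sum.cong) auto
  then have eq: "cos (real (fst \<kappa>) * pi * fst p) * ?c - (\<Sum>i=1..N\<^sup>2. node_weight N \<kappa> i * sample_mode N (snd \<kappa>) i p)
    = (osc (fst p) 0 (node N \<kappa> 0) - (\<Sum>i=1..N\<^sup>2. node_weight N \<kappa> i * osc (fst p) 0 (node N \<kappa> i))) * ?c"
    unfolding 0 by (simp add: left_diff_distrib)
  have "node N \<kappa> i < node N \<kappa> (Suc i)" if "i < N\<^sup>2" for i
    using node_bounds(2)[OF \<kappa> that] N by (smt (verit) zero_less_divide_1_iff zero_less_power)
  then have "\<bar>osc (fst p) 0 (node N \<kappa> 0) - (\<Sum>i=1..N\<^sup>2. node_weight N \<kappa> i * osc (fst p) 0 (node N \<kappa> i))\<bar>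
     \<le> (2 * (17 * (real N)\<^sup>2)) ^ (N\<^sup>2) * (exp (17 * (real N)\<^sup>2) / (fact (N\<^sup>2))\<^sup>2)"
    by (intro extrapolation_error[OF x] node_bounds(1)[OF \<kappa>]) auto
  also have "\<dots> = interp_error N" by (simp add: interp_error_def)
  finally have a: "\<bar>osc (fst p) 0 (node N \<kappa> 0) - (\<Sum>i=1..N\<^sup>2. node_weight N \<kappa> i * osc (fst p) 0 (node N \<kappa> i))\<bar> \<le> interp_error N" .
  have "\<bar>osc (fst p) 0 (node N \<kappa> 0) - (\<Sum>i=1..N\<^sup>2. node_weight N \<kappa> i * osc (fst p) 0 (node N \<kappa> i))\<bar> * \<bar>?c\<bar> \<le> interp_error N * 1"
    using a by (intro mult_mono) (auto intro: order_trans[OF abs_ge_zero])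
  then show ?thesis unfolding eq abs_mult by simp
qed

lemma mode_scale_bound: "0 \<le> mode_scale \<kappa>" "mode_scale \<kappa> \<le> 2"
proof -
  have s: "sqrt 2 \<le> 2" "1 \<le> sqrt 2" using real_sqrt_le_mono[of 2 4] by auto
  then show "0 \<le> mode_scale \<kappa>" "mode_scale \<kappa> \<le> 2" by (auto simp: mode_scale_def)
qed

text \<open>Because \<open>A = D * F\<close> exactly, the error equals ((A' - A) - F (D' - D)) / D',
  and \<epsilon> \<le> d/2 keeps the perturbed denominator at least d/2. \<open>V\<close> stands for
  the bound on the sample modes, \<open>B\<close> for the norm of the source.\<close>

lemma quotient_perturbation:
  fixes A A' D D' F V d \<epsilon> :: real
  assumes "A = D * F" "\<bar>A' - A\<bar> \<le> 2 * \<epsilon> * V" "\<bar>D' - D\<bar> \<le> \<epsilon>" "d \<le> \<bar>D\<bar>" "0 < d" "\<epsilon> \<le> d / 2" "0 \<le> \<epsilon>" "\<bar>F\<bar> \<le> B * V" "0 \<le> V"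
  shows "\<bar>A' / D' - F\<bar> \<le> 2 * \<epsilon> * V * (2 + B) / d"
proof -
  have D': "d / 2 \<le> \<bar>D'\<bar>" using assms(3,4,6) by linarith
  then have "D' \<noteq> 0" using assms(5) by auto
  then have "A' / D' - F = ((A' - A) - F * (D' - D)) / D'"
    using assms(1) by (simp add: field_simps)
  also have "\<bar>\<dots>\<bar> = \<bar>(A' - A) - F * (D' - D)\<bar> / \<bar>D'\<bar>" by (simp add: abs_divide)
  also have "\<dots> \<le> (2 * \<epsilon> * V + (B * V) * \<epsilon>) / (d / 2)"
  proof (rule frac_le)
    have "\<bar>F * (D' - D)\<bar> \<le> (B * V) * \<epsilon>" unfolding abs_mult using assms by (intro mult_mono) auto
    then show "\<bar>(A' - A) - F * (D' - D)\<bar> \<le> 2 * \<epsilon> * V + (B * V) * \<epsilon>" using assms(2) by linarith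
    show "0 < d / 2" "d / 2 \<le> \<bar>D'\<bar>" using assms(5) D' by auto
    show "0 \<le> 2 * \<epsilon> * V + (B * V) * \<epsilon>"
      using assms(7,9) order_trans[OF abs_ge_zero assms(8)] by simp
  qed
  also have "\<dots> = 2 * \<epsilon> * V * (2 + B) / d" by (simp add: algebra_simps)
  finally show ?thesis .
qed

lemma sample_coeff_error:
  assumes sol: "solves_source_problem \<phi> g0 g1 u f" and g: "g0 \<in> L2\<Omega>" "g1 \<in> L2\<Omega>" and \<phi>: "\<phi> \<in> L1 unit_time"
    and noise: "noisy_data \<epsilon> g0 g1 \<phi> h0 h1 \<psi>"
    and \<kappa>: "\<kappa> \<in> modes N" and i: "1 \<le> i" "i \<le> N\<^sup>2"
    and d: "0 < d" "d \<le> \<bar>laplace_transform \<phi> (sample_point N i)\<bar>" "\<epsilon> \<le> d / 2" "0 < \<epsilon>"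
  shows "\<bar>sample_coeff N h0 h1 \<psi> (snd \<kappa>) i - (LINT p|lebesgue_on Omega. f p * sample_mode N (snd \<kappa>) i p)\<bar>
     \<le> 2 * \<epsilon> * exp (17 * (real N)\<^sup>2) * (2 + norm_L2\<Omega> f) / d"
proof -
  let ?l = "sample_point N i" and ?v = "sample_mode N (snd \<kappa>) i" and ?V = "exp (17 * (real N)\<^sup>2)"
  have f: "f \<in> L2\<Omega>" using sol by (simp add: solves_source_problem_def)
  have n: "h0 \<in> L2\<Omega>" "h1 \<in> L2\<Omega>" "\<psi> \<in> L1 unit_time" "norm_L2\<Omega> (\<lambda>p. h0 p - g0 p) \<le> \<epsilon>" "norm_L2\<Omega> (\<lambda>p. h1 p - g1 p) \<le> \<epsilon>"
    "L1_norm unit_time (\<lambda>t. \<psi> t - \<phi> t) \<le> \<epsilon>"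
    using noise by (auto simp: noisy_data_def)
  have l: "0 \<le> ?l" by (simp add: sample_point_def)
  have vb: "\<bar>LINT p|lebesgue_on Omega. h p * ?v p\<bar> \<le> norm_L2\<Omega> h * ?V" if "h \<in> L2\<Omega>" for h
    using inner_bounded_Omega[OF that L2_D(1)[OF sample_mode_L2] sample_mode_bound(2)[OF \<kappa> i]] by simp
  have db: "\<bar>(LINT p|lebesgue_on Omega. h p * ?v p) - (LINT p|lebesgue_on Omega. g p * ?v p)\<bar> \<le> \<epsilon> * ?V"
    if "h \<in> L2\<Omega>" "g \<in> L2\<Omega>" "norm_L2\<Omega> (\<lambda>p. h p - g p) \<le> \<epsilon>" for h g
  proof -
    have "(LINT p|lebesgue_on Omega. h p * ?v p) - (LINT p|lebesgue_on Omega. g p * ?v p) = (LINT p|lebesgue_on Omega. (h p - g p) * ?v p)"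
      using L2_integrable_mult[OF that(1) sample_mode_L2] L2_integrable_mult[OF that(2) sample_mode_L2] by (simp add: left_diff_distrib)
    also have "\<bar>\<dots>\<bar> \<le> norm_L2\<Omega> (\<lambda>p. h p - g p) * ?V" by (rule vb[OF L2_diff[OF that(1,2)]])
    also have "\<dots> \<le> \<epsilon> * ?V" using that(3) by (intro mult_right_mono) auto
    finally show ?thesis .
  qed
  have id: "laplace_transform \<phi> ?l * (LINT p|lebesgue_on Omega. f p * ?v p)
     = exp (- ?l) * (LINT p|lebesgue_on Omega. g1 p * ?v p) - (LINT p|lebesgue_on Omega. g0 p * ?v p)"
    using source_identity[OF sol g \<phi>, of "sqrt ((real (snd \<kappa>) * pi)\<^sup>2 + ?l)" "snd \<kappa>"] node_sqrt[OF i(1), of "snd \<kappa>" N]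
    by (simp add: sample_mode_def)
  show ?thesis unfolding sample_coeff_def
  proof (rule quotient_perturbation[where A = "exp (- ?l) * (LINT p|lebesgue_on Omega. g1 p * ?v p) - (LINT p|lebesgue_on Omega. g0 p * ?v p)"])
    show "\<bar>laplace_transform \<psi> ?l - laplace_transform \<phi> ?l\<bar> \<le> \<epsilon>"
      using laplace_transform_diff[OF n(3) \<phi> l] n(6) by linarith
    let ?a = "(LINT p|lebesgue_on Omega. h1 p * ?v p) - (LINT p|lebesgue_on Omega. g1 p * ?v p)"
    have "\<bar>exp (- ?l) * ?a\<bar> \<le> 1 * (\<epsilon> * ?V)"
      unfolding abs_mult using l by (intro mult_mono db n g) auto
    then show "\<bar>exp (- ?l) * (LINT p|lebesgue_on Omega. h1 p * ?v p) - (LINT p|lebesgue_on Omega. h0 p * ?v p)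
       - (exp (- ?l) * (LINT p|lebesgue_on Omega. g1 p * ?v p) - (LINT p|lebesgue_on Omega. g0 p * ?v p))\<bar> \<le> 2 * \<epsilon> * ?V"
      using db[OF n(1) g(1) n(4)] unfolding right_diff_distrib by linarith
  qed (use id vb[OF f] d in auto)
qed

text \<open>The first summand is the error of extrapolating exact values, the second the noise in
  N^2 sampled values, each amplified by a weight. The leading 2 bounds the normalisation of the
  cosine products.\<close>

lemma recon_coeff_error:
  assumes sol: "solves_source_problem \<phi> g0 g1 u f" and g: "g0 \<in> L2\<Omega>" "g1 \<in> L2\<Omega>" and \<phi>: "\<phi> \<in> L1 unit_time"
    and noise: "noisy_data \<epsilon> g0 g1 \<phi> h0 h1 \<psi>"
    and \<kappa>: "\<kappa> \<in> modes N"
    and d: "0 < d" "\<And>i. 1 \<le> i \<Longrightarrow> i \<le> N\<^sup>2 \<Longrightarrow> d \<le> \<bar>laplace_transform \<phi> (sample_point N i)\<bar>" "\<epsilon> \<le> d / 2" "0 < \<epsilon>"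
  shows "\<bar>recon_coeff N h0 h1 \<psi> \<kappa> - coeff_cos f \<kappa>\<bar>
     \<le> 2 * (norm_L2\<Omega> f * interp_error N
        + (real N)\<^sup>2 * (weight_bound N * (2 * \<epsilon> * exp (17 * (real N)\<^sup>2) * (2 + norm_L2\<Omega> f) / d)))"
proof -
  let ?w = "\<lambda>i. node_weight N \<kappa> i" and ?v = "\<lambda>i. sample_mode N (snd \<kappa>) i"
  let ?c = "\<lambda>p. cos (real (fst \<kappa>) * pi * fst p) * cos (real (snd \<kappa>) * pi * snd p)"
  let ?S = "\<lambda>p. \<Sum>i=1..N\<^sup>2. ?w i * ?v i p"
  let ?E = "2 * \<epsilon> * exp (17 * (real N)\<^sup>2) * (2 + norm_L2\<Omega> f) / d"
  have f: "f \<in> L2\<Omega>" using sol by (simp add: solves_source_problem_def)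
  have cL: "?c \<in> L2\<Omega>" by (intro continuous_L2_Omega continuous_intros)
  have SL: "?S \<in> L2\<Omega>" by (intro L2_sum L2_cmult sample_mode_L2)
  have E0: "0 \<le> interp_error N" by (simp add: interp_error_def)
  define I where "I i = (LINT p|lebesgue_on Omega. f p * ?v i p)" for i
  have cc: "coeff_cos f \<kappa> = mode_scale \<kappa> * (LINT p|lebesgue_on Omega. f p * ?c p)"
  proof -
    have *: "tensor cmode cmode \<kappa> p = mode_scale \<kappa> * ?c p" for p
      unfolding tensor_def cmode_def mode_scale_def by (simp only: mult_ac)
    show ?thesis unfolding coeff_cos_def * mult.left_commute[of "f _"] by simp
  qed
  have fS: "(LINT p|lebesgue_on Omega. f p * ?S p) = (\<Sum>i=1..N\<^sup>2. ?w i * I i)"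
  proof -
    have "(LINT p|lebesgue_on Omega. f p * ?S p) = (LINT p|lebesgue_on Omega. (\<Sum>i=1..N\<^sup>2. ?w i * (f p * ?v i p)))"
      by (simp add: sum_distrib_left mult.left_commute)
    then show ?thesis using L2_integrable_mult[OF f sample_mode_L2] by (simp add: I_def)
  qed
  have "(LINT p|lebesgue_on Omega. f p * ?c p) - (LINT p|lebesgue_on Omega. f p * ?S p) = (LINT p|lebesgue_on Omega. f p * (?c p - ?S p))"
    using L2_integrable_mult[OF f cL] L2_integrable_mult[OF f SL] by (simp add: right_diff_distrib)
  also have "\<bar>\<dots>\<bar> \<le> norm_L2\<Omega> f * interp_error N"
    by (rule inner_bounded_Omega[OF f L2_D(1)[OF L2_diff[OF cL SL]] mode_interpolation[OF \<kappa>] E0])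
  finally have 1: "\<bar>(LINT p|lebesgue_on Omega. f p * ?c p) - (\<Sum>i=1..N\<^sup>2. ?w i * I i)\<bar> \<le> norm_L2\<Omega> f * interp_error N"
    unfolding fS .
  have "\<bar>(\<Sum>i=1..N\<^sup>2. ?w i * sample_coeff N h0 h1 \<psi> (snd \<kappa>) i) - (\<Sum>i=1..N\<^sup>2. ?w i * I i)\<bar>
     \<le> (\<Sum>i=1..N\<^sup>2. \<bar>?w i * (sample_coeff N h0 h1 \<psi> (snd \<kappa>) i - I i)\<bar>)"
    unfolding sum_subtractf[symmetric] right_diff_distrib[symmetric] by (rule sum_abs)
  also have "\<dots> \<le> (\<Sum>i=1..N\<^sup>2. weight_bound N * ?E)"
  proof (rule sum_mono)
    fix i assume "i \<in> {1..N\<^sup>2}"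
    then have i: "1 \<le> i" "i \<le> N\<^sup>2" by auto
    show "\<bar>?w i * (sample_coeff N h0 h1 \<psi> (snd \<kappa>) i - I i)\<bar> \<le> weight_bound N * ?E"
      unfolding abs_mult I_def
      using sample_coeff_error[OF sol g \<phi> noise \<kappa> i d(1) d(2)[OF i] d(3,4)]
      by (intro mult_mono node_weight_bound[OF \<kappa> i(2)]) (auto simp: weight_bound_def)
  qed
  also have "\<dots> = (real N)\<^sup>2 * (weight_bound N * ?E)" by simp
  finally have 2: "\<bar>(\<Sum>i=1..N\<^sup>2. ?w i * sample_coeff N h0 h1 \<psi> (snd \<kappa>) i) - (LINT p|lebesgue_on Omega. f p * ?c p)\<bar>
     \<le> norm_L2\<Omega> f * interp_error N + (real N)\<^sup>2 * (weight_bound N * ?E)"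
    using 1 by linarith
  have "\<bar>recon_coeff N h0 h1 \<psi> \<kappa> - coeff_cos f \<kappa>\<bar>
     = mode_scale \<kappa> * \<bar>(\<Sum>i=1..N\<^sup>2. ?w i * sample_coeff N h0 h1 \<psi> (snd \<kappa>) i) - (LINT p|lebesgue_on Omega. f p * ?c p)\<bar>"
    unfolding recon_coeff_def cc right_diff_distrib[symmetric] abs_mult using mode_scale_bound(1)[of \<kappa>] by simp
  also have "\<dots> \<le> 2 * (norm_L2\<Omega> f * interp_error N + (real N)\<^sup>2 * (weight_bound N * ?E))"
    using 2 mode_scale_bound[of \<kappa>] by (intro mult_mono) auto
  finally show ?thesis .
qed

text \<open>By orthonormality the squared norm is a sum over the N^2 modes, whence the factor
  N.\<close>

lemma recon_norm_error:
  assumes "\<And>\<kappa>. \<kappa> \<in> modes N \<Longrightarrow> \<bar>recon_coeff N h0 h1 \<psi> \<kappa> - coeff_cos f \<kappa>\<bar> \<le> B" "0 \<le> B"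
  shows "norm_L2\<Omega> (\<lambda>p. recon N h0 h1 \<psi> p - cos_proj N f p) \<le> real N * B"
proof (rule power2_le_imp_le)
  let ?S = "\<lambda>p. \<Sum>\<kappa>\<in>modes N. (recon_coeff N h0 h1 \<psi> \<kappa> - coeff_cos f \<kappa>) * tensor cmode cmode \<kappa> p"
  have "norm_L2\<Omega> (\<lambda>p. recon N h0 h1 \<psi> p - cos_proj N f p) = norm_L2\<Omega> ?S"
  proof (rule L2_norm_cong_AE)
    show "(\<lambda>p. recon N h0 h1 \<psi> p - cos_proj N f p) \<in> borel_measurable (lebesgue_on Omega)"
      using recon_borel(1) L2_D(1)[OF cos_proj_L2] by simp
    show "?S \<in> borel_measurable (lebesgue_on Omega)"
      by (rule L2_D(1)) (intro L2_sum L2_cmult mode_L2)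
    show "AE p in lebesgue_on Omega. recon N h0 h1 \<psi> p - cos_proj N f p = ?S p"
      by (rule AE_I2) (simp add: recon_def cos_proj_def left_diff_distrib sum_subtractf)
  qed
  then have "(norm_L2\<Omega> (\<lambda>p. recon N h0 h1 \<psi> p - cos_proj N f p))\<^sup>2 = (\<Sum>\<kappa>\<in>modes N. (recon_coeff N h0 h1 \<psi> \<kappa> - coeff_cos f \<kappa>)\<^sup>2)"
    using orthosystem_sum_norm[OF orthosystem_modes finite_modes] by (simp add: mode_norm)
  also have "\<dots> \<le> (\<Sum>\<kappa>\<in>modes N. B\<^sup>2)"
    using assms(1) by (intro sum_mono) (metis abs_ge_zero power2_abs power_mono)
  also have "\<dots> = (real N * B)\<^sup>2"
    by (simp add: modes_def power2_eq_square mult_ac)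
  finally show "(norm_L2\<Omega> (\<lambda>p. recon N h0 h1 \<psi> p - cos_proj N f p))\<^sup>2 \<le> (real N * B)\<^sup>2" .
qed (use assms in simp)

section \<open>Asymptotics in the truncation index N\<close>

lemma power_over_fact_le_exp:
  assumes "0 \<le> (x::real)"
  shows "x ^ m / fact m \<le> exp x"
  using sum_le_suminf[OF sums_summable[OF exp_converges[of x]], of "{m}"] assms sums_unique[OF exp_converges[of x]]
  by (simp add: divide_inverse mult.commute)

text \<open>With m = N^2, one 1/m! turns (34 N^2)^m into at most exp(34 N^2). The other decays
  faster than any exponential: x^m / m! \<le> exp(x) at x = exp(60) gives 1/m! \<le> exp(exp(60))
  exp(-60 N^2), and 60 - 17 - 34 = 9.\<close>

lemma interp_error_bound: "interp_error N \<le> exp (exp 60) * exp (- (9 * (real N)\<^sup>2))"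
proof -
  let ?n = "(real N)\<^sup>2"
  have a: "(34 * ?n) ^ (N\<^sup>2) / fact (N\<^sup>2) \<le> exp (34 * ?n)" by (rule power_over_fact_le_exp) simp
  \<comment> \<open>Any constant exceeding \<open>17 + 34\<close> could replace 60.\<close>
  have "exp 60 ^ (N\<^sup>2) / fact (N\<^sup>2) \<le> exp (exp (60::real))" by (rule power_over_fact_le_exp) simp
  moreover have "exp (60::real) ^ (N\<^sup>2) = exp (60 * ?n)" by (simp add: exp_of_nat_mult[symmetric] mult.commute)
  ultimately have "exp (60 * ?n) / fact (N\<^sup>2) \<le> exp (exp 60)" by simp
  then have "exp (- (60 * ?n)) * (exp (60 * ?n) / fact (N\<^sup>2)) \<le> exp (- (60 * ?n)) * exp (exp 60)" by (intro mult_left_mono) auto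
  then have b: "1 / fact (N\<^sup>2) \<le> exp (- (60 * ?n)) * exp (exp 60)"
    by (simp add: exp_minus)
  have "interp_error N = exp (17 * ?n) * ((34 * ?n) ^ (N\<^sup>2) / fact (N\<^sup>2)) * (1 / fact (N\<^sup>2))"
    by (simp add: interp_error_def power2_eq_square)
  also have "\<dots> \<le> exp (17 * ?n) * exp (34 * ?n) * (exp (- (60 * ?n)) * exp (exp 60))"
    by (intro mult_mono a b order_refl) auto
  also have "\<dots> = exp (exp 60) * exp (- (9 * ?n))"
    by (simp add: exp_add[symmetric])
  finally show ?thesis .
qed

text \<open>Written as a single exponential, the weight bound has exponent of order N^2 ln N and the
  other growing factors at most N^2, so -N^4 dominates for every \<open>p\<close> and
  \<open>K\<close>.\<close>

lemma noise_amplification_tendsto_0: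
  fixes K :: real and p :: nat
  shows "(\<lambda>N. real N ^ 4 * (weight_bound N * exp (17 * (real N)\<^sup>2) * exp (- (real N ^ 4)) * (real N ^ 3) ^ p * K)) \<longlonglongrightarrow> 0"
proof -
  have "(\<lambda>N::nat. real N ^ 4 * (exp ((real N)\<^sup>2 * ln (34 * real N ^ 5)) * exp (17 * (real N)\<^sup>2) * exp (- (real N ^ 4)) * exp (3 * real p * ln (real N)) * K)) \<longlonglongrightarrow> 0"
    by real_asymp
  then show ?thesis
  proof (rule Lim_transform_eventually)
    show "\<forall>\<^sub>F N in sequentially. real N ^ 4 * (exp ((real N)\<^sup>2 * ln (34 * real N ^ 5)) * exp (17 * (real N)\<^sup>2) * exp (- (real N ^ 4)) * exp (3 * real p * ln (real N)) * K)
       = real N ^ 4 * (weight_bound N * exp (17 * (real N)\<^sup>2) * exp (- (real N ^ 4)) * (real N ^ 3) ^ p * K)"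
      using eventually_gt_at_top[of 0]
    proof eventually_elim
      case (elim N)
      have "weight_bound N = exp ((real N)\<^sup>2 * ln (34 * real N ^ 5))"
        using elim exp_of_nat_mult[of "N\<^sup>2" "ln (34 * real N ^ 5)"] by (simp add: weight_bound_def)
      moreover have "(real N ^ 3) ^ p = exp (3 * real p * ln (real N))"
        using elim exp_of_nat_mult[of "3 * p" "ln (real N)"] by (simp add: power_mult)
      ultimately show ?case by simp
    qed
  qed
qed

text \<open>\<open>N0\<close> may depend on \<phi> and on the norm of \<open>f\<close>, but the
  estimate is uniform over all noisy data. The target 1/N matches the truncation rate for sources in
  \<open>H1\<close>.\<close>

theorem recon_error:
  assumes sol: "solves_source_problem \<phi> g0 g1 u f" and g: "g0 \<in> L2\<Omega>" "g1 \<in> L2\<Omega>" and \<phi>: "\<phi> \<in> L1 unit_time"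
    and nz: "\<not> (AE t in unit_time. \<phi> t = 0)"
  shows "\<exists>N0. \<forall>N\<ge>N0. \<forall>\<epsilon> h0 h1 \<psi>. 0 < \<epsilon> \<longrightarrow> \<epsilon> \<le> exp (- (real N ^ 4)) \<longrightarrow> noisy_data \<epsilon> g0 g1 \<phi> h0 h1 \<psi> \<longrightarrow>
    norm_L2\<Omega> (\<lambda>p. recon N h0 h1 \<psi> p - cos_proj N f p) \<le> 1 / real N"
proof -
  obtain c l0 p where c: "0 < c" "0 < l0" and low: "\<And>l. 0 < l \<Longrightarrow> l \<le> l0 \<Longrightarrow> c * l ^ p \<le> \<bar>laplace_transform \<phi> l\<bar>"
    using laplace_transform_lower_bound[OF \<phi> nz] by blast
  define F where "F = norm_L2\<Omega> f"
  have F: "0 \<le> F" by (simp add: F_def)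
  \<comment> \<open>The required \<open>real N * B \<le> 1 / real N\<close> amounts to
    \<open>real N ^ 2 * B \<le> 1\<close>; extrapolation error and amplified noise are given one
    half each.\<close>
  have "(\<lambda>N::nat. real N ^ 2 * (2 * (F * (exp (exp 60) * exp (- (9 * (real N)\<^sup>2)))))) \<longlonglongrightarrow> 0"
    by real_asymp
  then have e1: "\<forall>\<^sub>F N in sequentially. real N ^ 2 * (2 * (F * (exp (exp 60) * exp (- (9 * (real N)\<^sup>2))))) < 1 / 2"
    by (rule order_tendstoD) simp
  have e2: "\<forall>\<^sub>F N in sequentially. real N ^ 4 * (weight_bound N * exp (17 * (real N)\<^sup>2) * exp (- (real N ^ 4)) * (real N ^ 3) ^ p * (4 * (2 + F) / c)) < 1 / 2"
    by (rule order_tendstoD(2)[OF noise_amplification_tendsto_0]) simp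
  \<comment> \<open>This makes the noise at most half of \<open>d\<close>, the lower bound
    \<open>c * (1 / real N ^ 3) ^ p\<close> of the transform at the sample points; the second
    exponential is (N^3)^p.\<close>
  have "(\<lambda>N::nat. exp (- (real N ^ 4)) * exp (3 * real p * ln (real N)) * (2 / c)) \<longlonglongrightarrow> 0" by real_asymp
  then have e3: "\<forall>\<^sub>F N in sequentially. exp (- (real N ^ 4)) * exp (3 * real p * ln (real N)) * (2 / c) < 1"
    by (rule order_tendstoD) simp
  \<comment> \<open>No sample point exceeds 1/N, so this brings all of them into the range of the
    lower bound for the transform.\<close>
  have "(\<lambda>N::nat. 1 / real N) \<longlonglongrightarrow> 0" by real_asymp
  then have e4: "\<forall>\<^sub>F N in sequentially. 1 / real N < l0" using c(2) by (rule order_tendstoD)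
  from e1 e2 e3 e4 eventually_gt_at_top[of 0]
  have "\<forall>\<^sub>F N in sequentially. \<forall>\<epsilon> h0 h1 \<psi>. 0 < \<epsilon> \<longrightarrow> \<epsilon> \<le> exp (- (real N ^ 4)) \<longrightarrow> noisy_data \<epsilon> g0 g1 \<phi> h0 h1 \<psi> \<longrightarrow>
    norm_L2\<Omega> (\<lambda>p. recon N h0 h1 \<psi> p - cos_proj N f p) \<le> 1 / real N"
  proof eventually_elim
    case (elim N)
    show ?case
    proof (intro allI impI)
      fix \<epsilon> h0 h1 \<psi>
      assume \<epsilon>: "0 < \<epsilon>" "\<epsilon> \<le> exp (- (real N ^ 4))" and noise: "noisy_data \<epsilon> g0 g1 \<phi> h0 h1 \<psi>"
      have N: "0 < real N" using elim(5) by simp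
      define d where "d = c * (1 / real N ^ 3) ^ p"
      have d: "0 < d" using c N by (simp add: d_def)
      have d1: "1 / d = (real N ^ 3) ^ p / c" by (simp add: d_def power_divide)
      have NN: "(real N ^ 3) ^ p = exp (3 * real p * ln (real N))"
        using N exp_of_nat_mult[of "3 * p" "ln (real N)"] by (simp add: power_mult)
      have dl: "d \<le> \<bar>laplace_transform \<phi> (sample_point N i)\<bar>" if "1 \<le> i" "i \<le> N\<^sup>2" for i
      proof -
        note s = sample_point_bounds[OF that]
        have s0: "0 < 1 / real N ^ 3" using N by simp
        have "d \<le> c * sample_point N i ^ p"
          unfolding d_def using s(1) s0 c by (intro mult_left_mono power_mono) auto
        also have "\<dots> \<le> \<bar>laplace_transform \<phi> (sample_point N i)\<bar>"
          using s s0 elim(4) by (intro low) linarith+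
        finally show ?thesis .
      qed
      have "exp (- (real N ^ 4)) * (2 / d) < 1"
        using elim(3) unfolding NN[symmetric] by (simp add: d_def power_divide mult_ac)
      then have ed: "exp (- (real N ^ 4)) \<le> d / 2" using d by (simp add: field_simps)
      define B where "B = 2 * (F * interp_error N
        + (real N)\<^sup>2 * (weight_bound N * (2 * \<epsilon> * exp (17 * (real N)\<^sup>2) * (2 + F) / d)))"
      have ie: "0 \<le> interp_error N" and wb: "0 \<le> weight_bound N"
        by (simp_all add: interp_error_def weight_bound_def)
      have B0: "0 \<le> B" unfolding B_def using F d \<epsilon> ie wb by simp
      have "norm_L2\<Omega> (\<lambda>p. recon N h0 h1 \<psi> p - cos_proj N f p) \<le> real N * B"
      proof (rule recon_norm_error[OF _ B0])
        fix \<kappa> assume "\<kappa> \<in> modes N"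
        then show "\<bar>recon_coeff N h0 h1 \<psi> \<kappa> - coeff_cos f \<kappa>\<bar> \<le> B"
          unfolding B_def F_def using ed \<epsilon>
          by (intro recon_coeff_error[OF sol g \<phi> noise _ d dl]) auto
      qed
      moreover have "real N ^ 2 * B \<le> 1"
      proof -
        have "real N ^ 2 * (2 * (F * interp_error N)) \<le> real N ^ 2 * (2 * (F * (exp (exp 60) * exp (- (9 * (real N)\<^sup>2)))))"
          using interp_error_bound[of N] F by (intro mult_left_mono) auto
        then have 1: "real N ^ 2 * (2 * (F * interp_error N)) \<le> 1 / 2" using elim(1) by linarith
        have "real N ^ 2 * (2 * ((real N)\<^sup>2 * (weight_bound N * (2 * \<epsilon> * exp (17 * (real N)\<^sup>2) * (2 + F) / d))))
          = real N ^ 4 * (weight_bound N * exp (17 * (real N)\<^sup>2) * \<epsilon> * (1 / d) * (4 * (2 + F)))"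
          by (simp add: power2_eq_square power4_eq_xxxx)
        also have "\<dots> \<le> real N ^ 4 * (weight_bound N * exp (17 * (real N)\<^sup>2) * exp (- (real N ^ 4)) * (1 / d) * (4 * (2 + F)))"
          using \<epsilon> F d wb by (intro mult_left_mono mult_right_mono) auto
        also have "\<dots> = real N ^ 4 * (weight_bound N * exp (17 * (real N)\<^sup>2) * exp (- (real N ^ 4)) * (real N ^ 3) ^ p * (4 * (2 + F) / c))"
          unfolding d1 by simp
        finally have 2: "real N ^ 2 * (2 * ((real N)\<^sup>2 * (weight_bound N * (2 * \<epsilon> * exp (17 * (real N)\<^sup>2) * (2 + F) / d)))) \<le> 1 / 2"
          using elim(2) by linarith
        from 1 2 show ?thesis unfolding B_def distrib_left by linarith
      qed
      then have "real N * B \<le> 1 / real N" using N by (simp add: field_simps power2_eq_square)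
      ultimately show "norm_L2\<Omega> (\<lambda>p. recon N h0 h1 \<psi> p - cos_proj N f p) \<le> 1 / real N" by linarith
    qed
  qed
  then show ?thesis by (simp add: eventually_sequentially)
qed

text \<open>For 0 < \<epsilon> < 1 this is the largest N with \<epsilon> \<le> exp(-N^4), the noise
  level that the error estimate tolerates. It depends on \<epsilon> alone, as the family of maps
  requires.\<close>

definition level :: "real \<Rightarrow> nat" where
  "level \<epsilon> = nat \<lfloor>ln (1 / \<epsilon>) powr (1 / 4)\<rfloor>"

lemma level_noise:
  assumes "0 < \<epsilon>" "\<epsilon> < 1"
  shows "\<epsilon> \<le> exp (- (real (level \<epsilon>) ^ 4))"
proof -
  define x where "x = ln (1 / \<epsilon>)"
  have x: "0 < x" using assms by (simp add: x_def)
  have "real (level \<epsilon>) ^ 4 \<le> (x powr (1 / 4)) ^ 4"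
    unfolding level_def x_def[symmetric] by (intro power_mono) auto
  also have "\<dots> = x" using x by (simp add: powr_power)
  finally have "exp (- x) \<le> exp (- (real (level \<epsilon>) ^ 4))" by simp
  moreover have "exp (- x) = \<epsilon>" using assms by (simp add: x_def ln_div)
  ultimately show ?thesis by simp
qed

lemma level_lower: "ln (1 / \<epsilon>) powr (1 / 4) - 1 \<le> real (level \<epsilon>)"
  unfolding level_def by linarith

lemma level_at_top: "filterlim level at_top (at_right 0)"
proof -
  have "filterlim (\<lambda>\<epsilon>::real. ln (1 / \<epsilon>) powr (1 / 4) - 1) at_top (at_right 0)" by real_asymp
  then have "filterlim (\<lambda>\<epsilon>. real (level \<epsilon>)) at_top (at_right 0)"
    by (rule filterlim_at_top_mono) (intro always_eventually allI level_lower)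
  then show ?thesis by (rule filterlim_sequentially_iff_filterlim_real[THEN iffD2])
qed

lemma recon_total_error:
  assumes "solves_source_problem \<phi> g0 g1 u f" "g0 \<in> L2\<Omega>" "g1 \<in> L2\<Omega>" "\<phi> \<in> L1 unit_time" "\<not> (AE t in unit_time. \<phi> t = 0)"
  shows "\<forall>\<^sub>F \<epsilon> in at_right 0. \<forall>h0 h1 \<psi>. noisy_data \<epsilon> g0 g1 \<phi> h0 h1 \<psi> \<longrightarrow>
    norm_L2\<Omega> (\<lambda>p. recon (level \<epsilon>) h0 h1 \<psi> p - f p)
      \<le> 1 / real (level \<epsilon>) + norm_L2\<Omega> (\<lambda>p. f p - cos_proj (level \<epsilon>) f p)"
proof -
  have f: "f \<in> L2\<Omega>" using assms(1) by (simp add: solves_source_problem_def)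
  obtain N0 where N0: "\<And>N \<epsilon> h0 h1 \<psi>. N \<ge> N0 \<Longrightarrow> 0 < \<epsilon> \<Longrightarrow> \<epsilon> \<le> exp (- (real N ^ 4)) \<Longrightarrow> noisy_data \<epsilon> g0 g1 \<phi> h0 h1 \<psi> \<Longrightarrow>
    norm_L2\<Omega> (\<lambda>p. recon N h0 h1 \<psi> p - cos_proj N f p) \<le> 1 / real N"
    using recon_error[OF assms] by blast
  have "\<forall>\<^sub>F \<epsilon> in at_right 0. N0 \<le> level \<epsilon>" using level_at_top by (simp add: filterlim_at_top)
  moreover have "\<forall>\<^sub>F \<epsilon> in at_right (0::real). 0 < \<epsilon>" by (simp add: eventually_at_right_less)
  moreover have "\<forall>\<^sub>F \<epsilon> in at_right (0::real). \<epsilon> < 1" by (intro order_tendstoD(2)[OF tendsto_ident_at]) simp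
  ultimately show ?thesis
  proof eventually_elim
    case (elim \<epsilon>)
    show ?case
    proof (intro allI impI)
      fix h0 h1 \<psi> assume "noisy_data \<epsilon> g0 g1 \<phi> h0 h1 \<psi>"
      from N0[OF elim(1,2) level_noise[OF elim(2,3)] this]
      show "norm_L2\<Omega> (\<lambda>p. recon (level \<epsilon>) h0 h1 \<psi> p - f p)
        \<le> 1 / real (level \<epsilon>) + norm_L2\<Omega> (\<lambda>p. f p - cos_proj (level \<epsilon>) f p)"
        using L2_norm_triangle_diff[OF recon_borel(2) cos_proj_L2 f, of "level \<epsilon>" h0 h1 \<psi> "level \<epsilon>" f]
          L2_norm_minus_commute[of "lebesgue_on Omega" "cos_proj (level \<epsilon>) f" f] by linarith
    qed
  qed
qed

lemma recon_bound_tendsto: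
  assumes "f \<in> L2\<Omega>"
  shows "((\<lambda>\<epsilon>. 1 / real (level \<epsilon>) + norm_L2\<Omega> (\<lambda>p. f p - cos_proj (level \<epsilon>) f p)) \<longlongrightarrow> 0) (at_right 0)"
proof -
  have "(\<lambda>N. 1 / real N) \<longlonglongrightarrow> 0" by real_asymp
  then have "(\<lambda>N. 1 / real N + norm_L2\<Omega> (\<lambda>p. f p - cos_proj N f p)) \<longlonglongrightarrow> 0"
    using tendsto_add[OF _ cos_proj_tendsto[OF assms]] by force
  from filterlim_compose[OF this level_at_top] show ?thesis .
qed

lemma recon_tendsto:
  assumes sol: "solves_source_problem \<phi> g0 g1 u f" "g0 \<in> L2\<Omega>" "g1 \<in> L2\<Omega>" "\<phi> \<in> L1 unit_time" "\<not> (AE t in unit_time. \<phi> t = 0)"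
    and noise: "\<And>\<epsilon>. \<epsilon> \<in> {0<..<1} \<Longrightarrow> noisy_data \<epsilon> g0 g1 \<phi> (h0 \<epsilon>) (h1 \<epsilon>) (\<psi> \<epsilon>)"
  shows "((\<lambda>\<epsilon>. norm_L2\<Omega> (\<lambda>p. recon (level \<epsilon>) (h0 \<epsilon>) (h1 \<epsilon>) (\<psi> \<epsilon>) p - f p)) \<longlongrightarrow> 0) (at_right 0)"
proof (rule Lim_null_comparison[OF _ recon_bound_tendsto])
  show "f \<in> L2\<Omega>" using sol(1) by (simp add: solves_source_problem_def)
  have "\<forall>\<^sub>F \<epsilon> in at_right (0::real). 0 < \<epsilon>" by (simp add: eventually_at_right_less)
  moreover have "\<forall>\<^sub>F \<epsilon> in at_right (0::real). \<epsilon> < 1" by (intro order_tendstoD(2)[OF tendsto_ident_at]) simp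
  ultimately show "\<forall>\<^sub>F \<epsilon> in at_right 0. norm (norm_L2\<Omega> (\<lambda>p. recon (level \<epsilon>) (h0 \<epsilon>) (h1 \<epsilon>) (\<psi> \<epsilon>) p - f p))
     \<le> 1 / real (level \<epsilon>) + norm_L2\<Omega> (\<lambda>p. f p - cos_proj (level \<epsilon>) f p)"
    using recon_total_error[OF sol]
  proof eventually_elim
    case (elim \<epsilon>)
    then show ?case using noise[of \<epsilon>] by simp
  qed
qed

text \<open>The squared error is at most (1 + \<open>H1_norm f\<close>)^2 / N^2, of order
  (ln(1/\<epsilon>))^(-1/2). As \<beta> is smaller than 1/2, the spare power of the logarithm
  absorbs the constant, which leaves the factor 1.\<close>

lemma recon_rate:
  assumes sol: "solves_source_problem \<phi> g0 g1 u f" "g0 \<in> L2\<Omega>" "g1 \<in> L2\<Omega>" "\<phi> \<in> L1 unit_time" "\<not> (AE t in unit_time. \<phi> t = 0)"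
    and f: "f \<in> H1" and \<beta>: "\<beta> < 1 / 2"
  shows "\<exists>e\<in>{0<..<1}. \<forall>\<epsilon> h0 h1 \<psi>. 0 < \<epsilon> \<and> \<epsilon> < e \<longrightarrow> noisy_data \<epsilon> g0 g1 \<phi> h0 h1 \<psi> \<longrightarrow>
    (norm_L2\<Omega> (\<lambda>p. recon (level \<epsilon>) h0 h1 \<psi> p - f p))\<^sup>2 \<le> ln (1 / \<epsilon>) powr (- \<beta>)"
proof -
  define C where "C = 1 + H1_norm f"
  have C: "C > 0" using H1_norm_nonneg[of f] by (simp add: C_def)
  have "((\<lambda>\<epsilon>::real. (C / (ln (1 / \<epsilon>) powr (1 / 4) - 1))\<^sup>2 * ln (1 / \<epsilon>) powr \<beta>) \<longlongrightarrow> 0) (at_right 0)"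
    using \<beta> C by real_asymp
  then have 1: "\<forall>\<^sub>F \<epsilon> in at_right (0::real). (C / (ln (1 / \<epsilon>) powr (1 / 4) - 1))\<^sup>2 * ln (1 / \<epsilon>) powr \<beta> < 1"
    by (rule order_tendstoD) simp
  have 2: "\<forall>\<^sub>F \<epsilon> in at_right (0::real). ln (1 / \<epsilon>) powr (1 / 4) - 1 > 0" by real_asymp
  have 3: "\<forall>\<^sub>F \<epsilon> in at_right (0::real). ln (1 / \<epsilon>) > 0" by real_asymp
  from 1 2 3 recon_total_error[OF sol]
  have "\<forall>\<^sub>F \<epsilon> in at_right 0. \<forall>h0 h1 \<psi>. noisy_data \<epsilon> g0 g1 \<phi> h0 h1 \<psi> \<longrightarrow>
    (norm_L2\<Omega> (\<lambda>p. recon (level \<epsilon>) h0 h1 \<psi> p - f p))\<^sup>2 \<le> ln (1 / \<epsilon>) powr (- \<beta>)"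
  proof eventually_elim
    case (elim \<epsilon>)
    show ?case
    proof (intro allI impI)
      fix h0 h1 \<psi> assume n: "noisy_data \<epsilon> g0 g1 \<phi> h0 h1 \<psi>"
      let ?N = "real (level \<epsilon>)" and ?x = "ln (1 / \<epsilon>) powr (1 / 4) - 1"
      have N: "?x \<le> ?N" by (rule level_lower)
      then have "0 < level \<epsilon>" using elim(2) by (cases "level \<epsilon>") auto
      then have "norm_L2\<Omega> (\<lambda>p. recon (level \<epsilon>) h0 h1 \<psi> p - f p) \<le> 1 / ?N + H1_norm f / ?N"
        using elim(4) n cos_proj_H1_rate[OF f] by (meson add_left_mono order_trans)
      also have "\<dots> = C / ?N" by (simp add: C_def add_divide_distrib)
      also have "\<dots> \<le> C / ?x" using N elim(2) C by (intro divide_left_mono) auto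
      finally have "(norm_L2\<Omega> (\<lambda>p. recon (level \<epsilon>) h0 h1 \<psi> p - f p))\<^sup>2 \<le> (C / ?x)\<^sup>2"
        by (intro power_mono) auto
      also have "\<dots> \<le> ln (1 / \<epsilon>) powr (- \<beta>)"
        using elim(1,3) by (simp add: powr_minus field_simps)
      finally show "(norm_L2\<Omega> (\<lambda>p. recon (level \<epsilon>) h0 h1 \<psi> p - f p))\<^sup>2 \<le> ln (1 / \<epsilon>) powr (- \<beta>)" .
    qed
  qed
  then obtain b where "b > 0" "\<And>\<epsilon>. 0 < \<epsilon> \<Longrightarrow> \<epsilon> < b \<Longrightarrow> \<forall>h0 h1 \<psi>. noisy_data \<epsilon> g0 g1 \<phi> h0 h1 \<psi> \<longrightarrow>
    (norm_L2\<Omega> (\<lambda>p. recon (level \<epsilon>) h0 h1 \<psi> p - f p))\<^sup>2 \<le> ln (1 / \<epsilon>) powr (- \<beta>)"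
    unfolding eventually_at_right_field by blast
  \<comment> \<open>The minimum with 1/2 keeps the threshold inside the open unit interval.\<close>
  then show ?thesis by (intro bexI[of _ "min b (1 / 2)"]) auto
qed

section \<open>A threshold depending only on u, \<phi> and \<beta>\<close>

lemma noisy_data_cong:
  assumes "noisy_data \<epsilon> g0 g1 \<phi> h0 h1 \<psi>"
    and "g0 \<in> L2\<Omega>" "g1 \<in> L2\<Omega>" "g0' \<in> L2\<Omega>" "g1' \<in> L2\<Omega>"
    and "AE p in lebesgue_on Omega. g0 p = g0' p" "AE p in lebesgue_on Omega. g1 p = g1' p"
  shows "noisy_data \<epsilon> g0' g1' \<phi> h0 h1 \<psi>"
proof -
  have h: "h0 \<in> L2\<Omega>" "h1 \<in> L2\<Omega>" using assms(1) by (auto simp: noisy_data_def)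
  have *: "norm_L2\<Omega> (\<lambda>p. h p - g p) = norm_L2\<Omega> (\<lambda>p. h p - g' p)"
    if "h \<in> L2\<Omega>" "g \<in> L2\<Omega>" "g' \<in> L2\<Omega>" "AE p in lebesgue_on Omega. g p = g' p" for h g g'
    using that(4) L2_D(1)[OF that(1)] L2_D(1)[OF that(2)] L2_D(1)[OF that(3)]
    by (intro L2_norm_cong_AE) auto
  show ?thesis
    using assms(1) *[OF h(1) assms(2,4,6)] *[OF h(2) assms(3,5,7)] by (simp add: noisy_data_def)
qed

lemma noisy_data_exact:
  assumes "g0 \<in> L2\<Omega>" "g1 \<in> L2\<Omega>" "\<phi> \<in> L1 unit_time" "0 \<le> \<epsilon>"
  shows "noisy_data \<epsilon> g0 g1 \<phi> g0 g1 \<phi>"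
  using assms by (simp add: noisy_data_def L2_norm_def L1_norm_def)

lemma data_unique:
  assumes "solves_source_problem \<phi> g0 g1 u f" "solves_source_problem \<phi> g0' g1' u f'"
  shows "AE p in lebesgue_on Omega. g0 p = g0' p" "AE p in lebesgue_on Omega. g1 p = g1' p"
proof -
  have a: "AE p in lebesgue_on Omega. u 0 p = g0 p" "AE p in lebesgue_on Omega. u 0 p = g0' p"
    "AE p in lebesgue_on Omega. u 1 p = g1 p" "AE p in lebesgue_on Omega. u 1 p = g1' p"
    using assms by (auto simp: solves_source_problem_def)
  show "AE p in lebesgue_on Omega. g0 p = g0' p" using a(1,2) by eventually_elim simp
  show "AE p in lebesgue_on Omega. g1 p = g1' p" using a(3,4) by eventually_elim simp
qed

text \<open>Applied to the exact data, the reconstruction converges to every source compatible with them.\<close>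

lemma source_unique:
  assumes sol: "solves_source_problem \<phi> g0 g1 u f" and g: "g0 \<in> L2\<Omega>" "g1 \<in> L2\<Omega>"
    and sol': "solves_source_problem \<phi> g0' g1' u f'" and g': "g0' \<in> L2\<Omega>" "g1' \<in> L2\<Omega>"
    and \<phi>: "\<phi> \<in> L1 unit_time" "\<not> (AE t in unit_time. \<phi> t = 0)"
  shows "AE p in lebesgue_on Omega. f p = f' p"
proof -
  have f: "f \<in> L2\<Omega>" "f' \<in> L2\<Omega>" using sol sol' by (auto simp: solves_source_problem_def)
  have ex: "noisy_data \<epsilon> g0 g1 \<phi> g0 g1 \<phi>" if "\<epsilon> \<in> {0<..<1}" for \<epsilon>
    using that by (intro noisy_data_exact g \<phi>) auto
  have ex': "noisy_data \<epsilon> g0' g1' \<phi> g0 g1 \<phi>" if "\<epsilon> \<in> {0<..<1}" for \<epsilon>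
    by (rule noisy_data_cong[OF ex[OF that] g g' data_unique[OF sol sol']])
  let ?R = "\<lambda>\<epsilon>. recon (level \<epsilon>) g0 g1 \<phi>"
  have "((\<lambda>\<epsilon>. norm_L2\<Omega> (\<lambda>p. ?R \<epsilon> p - f p) + norm_L2\<Omega> (\<lambda>p. ?R \<epsilon> p - f' p)) \<longlongrightarrow> 0 + 0) (at_right 0)"
    by (intro tendsto_add recon_tendsto[OF sol g \<phi> ex] recon_tendsto[OF sol' g' \<phi> ex'])
  moreover have "norm_L2\<Omega> (\<lambda>p. f p - f' p) \<le> norm_L2\<Omega> (\<lambda>p. ?R \<epsilon> p - f p) + norm_L2\<Omega> (\<lambda>p. ?R \<epsilon> p - f' p)" for \<epsilon>
    using L2_norm_triangle_diff[OF f(1) recon_borel(2) f(2), of "level \<epsilon>" g0 g1 \<phi>]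
      L2_norm_minus_commute[of "lebesgue_on Omega" f "?R \<epsilon>"] by simp
  ultimately have "norm_L2\<Omega> (\<lambda>p. f p - f' p) \<le> 0 + 0"
    by (intro tendsto_lowerbound[of _ "0 + 0" "at_right (0::real)"] always_eventually allI) auto
  then have "norm_L2\<Omega> (\<lambda>p. f p - f' p) = 0" using L2_norm_nonneg[of "lebesgue_on Omega" "\<lambda>p. f p - f' p"] by linarith
  from L2_norm_eq_0_D[OF L2_diff[OF f] this] show ?thesis by simp
qed

text \<open>All compatible data and sources are quantified inside the predicate, so a value
  satisfying it can be selected from \<open>u\<close>, \<phi> and \<beta> alone, which is the
  dependence allowed for the threshold.\<close>

definition rate_threshold :: "(real \<Rightarrow> real \<times> real \<Rightarrow> real) \<Rightarrow> (real \<Rightarrow> real) \<Rightarrow> real \<Rightarrow> real \<Rightarrow> bool" where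
  "rate_threshold u \<phi> \<beta> e \<longleftrightarrow> e \<in> {0<..<1} \<and>
    (\<forall>g0\<in>L2\<Omega>. \<forall>g1\<in>L2\<Omega>. \<forall>f\<in>H1. solves_source_problem \<phi> g0 g1 u f \<longrightarrow>
      (\<forall>\<epsilon> h0 h1 \<psi>. 0 < \<epsilon> \<and> \<epsilon> < e \<longrightarrow> noisy_data \<epsilon> g0 g1 \<phi> h0 h1 \<psi> \<longrightarrow>
        (norm_L2\<Omega> (\<lambda>p. recon (level \<epsilon>) h0 h1 \<psi> p - f p))\<^sup>2 \<le> ln (1 / \<epsilon>) powr (- \<beta>)))"

text \<open>The source is determined by \<open>u\<close> and \<open>\<phi>\<close>, so a threshold found for one compatible source
  serves all of them.\<close>

lemma rate_threshold_exists:
  assumes \<phi>: "\<phi> \<in> L1 unit_time" "\<not> (AE t in unit_time. \<phi> t = 0)" and \<beta>: "\<beta> < 1 / 2"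
  shows "\<exists>e. rate_threshold u \<phi> \<beta> e"
proof (cases "\<exists>g0\<in>L2\<Omega>. \<exists>g1\<in>L2\<Omega>. \<exists>f\<in>H1. solves_source_problem \<phi> g0 g1 u f")
  case False
  \<comment> \<open>Without a compatible source in \<open>H1\<close> the requirement is vacuous, and
    any number in (0,1) serves.\<close>
  then show ?thesis by (intro exI[of _ "1 / 2"]) (auto simp: rate_threshold_def)
next
  case True
  then obtain g0 g1 f where g: "g0 \<in> L2\<Omega>" "g1 \<in> L2\<Omega>" and f: "f \<in> H1" and sol: "solves_source_problem \<phi> g0 g1 u f" by blast
  obtain e where e: "e \<in> {0<..<1}" and bd: "\<And>\<epsilon> h0 h1 \<psi>. 0 < \<epsilon> \<Longrightarrow> \<epsilon> < e \<Longrightarrow> noisy_data \<epsilon> g0 g1 \<phi> h0 h1 \<psi> \<Longrightarrow>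
    (norm_L2\<Omega> (\<lambda>p. recon (level \<epsilon>) h0 h1 \<psi> p - f p))\<^sup>2 \<le> ln (1 / \<epsilon>) powr (- \<beta>)"
    using recon_rate[OF sol g \<phi> f \<beta>] by blast
  have "rate_threshold u \<phi> \<beta> e"
    unfolding rate_threshold_def
  proof (intro conjI ballI impI allI e)
    fix g0' g1' f' \<epsilon> h0 h1 \<psi>
    assume g': "g0' \<in> L2\<Omega>" "g1' \<in> L2\<Omega>" and f': "f' \<in> H1" and sol': "solves_source_problem \<phi> g0' g1' u f'"
      and \<epsilon>: "0 < \<epsilon> \<and> \<epsilon> < e" and n: "noisy_data \<epsilon> g0' g1' \<phi> h0 h1 \<psi>"
    have "noisy_data \<epsilon> g0 g1 \<phi> h0 h1 \<psi>"
      by (rule noisy_data_cong[OF n g' g data_unique[OF sol' sol]])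
    then have "(norm_L2\<Omega> (\<lambda>p. recon (level \<epsilon>) h0 h1 \<psi> p - f p))\<^sup>2 \<le> ln (1 / \<epsilon>) powr (- \<beta>)"
      using \<epsilon> bd by blast
    moreover have "norm_L2\<Omega> (\<lambda>p. recon (level \<epsilon>) h0 h1 \<psi> p - f p) = norm_L2\<Omega> (\<lambda>p. recon (level \<epsilon>) h0 h1 \<psi> p - f' p)"
      using source_unique[OF sol g sol' g' \<phi>] f f' recon_borel(1)
      by (intro L2_norm_cong_AE) (auto simp: H1_def dest: L2_D(1))
    ultimately show "(norm_L2\<Omega> (\<lambda>p. recon (level \<epsilon>) h0 h1 \<psi> p - f' p))\<^sup>2 \<le> ln (1 / \<epsilon>) powr (- \<beta>)" by simp
  qed
  then show ?thesis by blast
qed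

theorem theorem2:
  shows "\<exists>(R :: real \<Rightarrow> (real \<times> real \<Rightarrow> real) \<Rightarrow> (real \<times> real \<Rightarrow> real) \<Rightarrow> (real \<Rightarrow> real)
                \<Rightarrow> real \<times> real \<Rightarrow> real)
          (\<epsilon>0 :: (real \<Rightarrow> real \<times> real \<Rightarrow> real) \<Rightarrow> (real \<Rightarrow> real) \<Rightarrow> real \<Rightarrow> real).
    (\<forall>\<epsilon> \<in> {0<..<1}. source_map (R \<epsilon>)) \<and>
    (\<forall>g0ex \<in> L2\<Omega>. \<forall>g1ex \<in> L2\<Omega>. \<forall>\<phi>ex \<in> L1 unit_time. \<forall>uex fex g0 g1 \<phi>.
       \<not> (AE t in unit_time. \<phi>ex t = 0) \<longrightarrow>
       solves_source_problem \<phi>ex g0ex g1ex uex fex \<longrightarrow>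
       (\<forall>\<epsilon> \<in> {0<..<1}. noisy_data \<epsilon> g0ex g1ex \<phi>ex (g0 \<epsilon>) (g1 \<epsilon>) (\<phi> \<epsilon>)) \<longrightarrow>
       ((\<lambda>\<epsilon>. norm_L2\<Omega> (\<lambda>p. R \<epsilon> (g0 \<epsilon>) (g1 \<epsilon>) (\<phi> \<epsilon>) p - fex p)) \<longlongrightarrow> 0) (at_right 0) \<and>
       (fex \<in> H1 \<longrightarrow>
         (\<forall>\<beta> \<in> {0<..<1/2}.
            \<epsilon>0 uex \<phi>ex \<beta> \<in> {0<..<1} \<and>
            (\<forall>\<epsilon>. 0 < \<epsilon> \<and> \<epsilon> < \<epsilon>0 uex \<phi>ex \<beta> \<longrightarrow>
               (norm_L2\<Omega> (\<lambda>p. R \<epsilon> (g0 \<epsilon>) (g1 \<epsilon>) (\<phi> \<epsilon>) p - fex p))\<^sup>2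
                 \<le> 4 / pi * (1 + 9 * (H1_norm fex)\<^sup>2) * ln (1 / \<epsilon>) powr (- \<beta>)))))"
proof (intro exI[of _ "\<lambda>\<epsilon>. recon (level \<epsilon>)"] exI[of _ "\<lambda>u \<phi> \<beta>. SOME e. rate_threshold u \<phi> \<beta> e"]
    conjI ballI allI impI)
  show "source_map (recon (level \<epsilon>))" for \<epsilon> by (rule source_map_recon)
  fix g0ex g1ex \<phi>ex uex fex g0 g1 \<phi>
  assume g: "g0ex \<in> L2\<Omega>" "g1ex \<in> L2\<Omega>" and \<phi>: "\<phi>ex \<in> L1 unit_time" "\<not> (AE t in unit_time. \<phi>ex t = 0)"
    and sol: "solves_source_problem \<phi>ex g0ex g1ex uex fex"
    and noise: "\<forall>\<epsilon> \<in> {0<..<1}. noisy_data \<epsilon> g0ex g1ex \<phi>ex (g0 \<epsilon>) (g1 \<epsilon>) (\<phi> \<epsilon>)"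
  show "((\<lambda>\<epsilon>. norm_L2\<Omega> (\<lambda>p. recon (level \<epsilon>) (g0 \<epsilon>) (g1 \<epsilon>) (\<phi> \<epsilon>) p - fex p)) \<longlongrightarrow> 0) (at_right 0)"
    using noise by (intro recon_tendsto[OF sol g \<phi>]) auto
  fix \<beta> :: real assume f: "fex \<in> H1" and \<beta>: "\<beta> \<in> {0<..<1/2}"
  let ?e = "SOME e. rate_threshold uex \<phi>ex \<beta> e"
  have "\<exists>e. rate_threshold uex \<phi>ex \<beta> e"
    by (rule rate_threshold_exists[OF \<phi>]) (use \<beta> in simp)
  then have e: "rate_threshold uex \<phi>ex \<beta> ?e" by (rule someI_ex)
  show e1: "?e \<in> {0<..<1}" by (rule rate_threshold_def[THEN iffD1, OF e, THEN conjunct1])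
  fix \<epsilon> :: real assume \<epsilon>: "0 < \<epsilon> \<and> \<epsilon> < ?e"
  have "noisy_data \<epsilon> g0ex g1ex \<phi>ex (g0 \<epsilon>) (g1 \<epsilon>) (\<phi> \<epsilon>)"
  proof (rule bspec[OF noise])
    show "\<epsilon> \<in> {0<..<1}"
      unfolding greaterThanLessThan_iff using \<epsilon> e1[unfolded greaterThanLessThan_iff] by linarith
  qed
  then have "(norm_L2\<Omega> (\<lambda>p. recon (level \<epsilon>) (g0 \<epsilon>) (g1 \<epsilon>) (\<phi> \<epsilon>) p - fex p))\<^sup>2 \<le> ln (1 / \<epsilon>) powr (- \<beta>)"
    using rate_threshold_def[THEN iffD1, OF e, THEN conjunct2] sol g f \<epsilon> by blast
  also have "\<dots> = 1 * ln (1 / \<epsilon>) powr (- \<beta>)" by simp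
  also have "\<dots> \<le> 4 / pi * (1 + 9 * (H1_norm fex)\<^sup>2) * ln (1 / \<epsilon>) powr (- \<beta>)"
  proof (rule mult_right_mono)
    \<comment> \<open>The rate was proved with factor 1, and the claimed factor is larger because pi
      < 4.\<close>
    have "1 \<le> 4 / pi" using pi_less_4 by simp
    then have "1 * 1 \<le> 4 / pi * (1 + 9 * (H1_norm fex)\<^sup>2)" by (intro mult_mono) auto
    then show "1 \<le> 4 / pi * (1 + 9 * (H1_norm fex)\<^sup>2)" by simp
  qed simp
  finally show "(norm_L2\<Omega> (\<lambda>p. recon (level \<epsilon>) (g0 \<epsilon>) (g1 \<epsilon>) (\<phi> \<epsilon>) p - fex p))\<^sup>2
      \<le> 4 / pi * (1 + 9 * (H1_norm fex)\<^sup>2) * ln (1 / \<epsilon>) powr (- \<beta>)" .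
qed

end
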